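(* Let $R$ be a commutative ring with an ideal $\mathfrak{r}$. Let $n, m, \ell$ be integers with $n > m > \ell \geq 2$, and let \begin{align*} G &= \langle\, x, y, z \mid x^{2^n} = 1,\ y^{2^m} = 1,\ z^{2^\ell} = 1,\ [y, x] = z,\ [z, x] = z^{-2},\ [z, y] = z^{-2} \,\rangle, \\ H &= \langle\, a, b, c \mid a^{2^n} = 1,\ b^{2^m} = a^{2^m},\ c^{2^\ell} = 1,\ [b, a] = c,\ [c, a] = c^{-2},\ [c, b] = c^{-2} \,\rangle. \end{align*} If $R$ has a maximal ideal $\mathfrak{m}$ such that $\mathfrak{m}^2 \subseteq \mathfrak{r} \subseteq \mathfrak{m}$ and the quotient ring $R/\mathfrak{r}$ has characteristic $4$, then the group algebras $RG$ and $RH$ are not isomorphic as $R$-algebras. On the other hand, if $R$ has characteristic $2$, then $RG \cong RH$ as $R$-algebras.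
   Context: Commutators are $[g,h] = g^{-1}h^{-1}gh$. Rings have an identity. For a commutative ring $R$ and a group $G$, $RG$ denotes the group algebra of $G$ over $R$. *)

theory Defs
  imports "HOL-Algebra.Algebra"
begin

section \<open>Groups given by generators and relations\<close>

text \<open>
  The generators are all elements of a type. A letter \<open>(a, True)\<close> stands for the generator \<open>a\<close>,
  a letter \<open>(a, False)\<close> for its formal inverse.
\<close>

type_synonym 'a gword = "('a \<times> bool) list"

definition wgen :: "'a \<Rightarrow> 'a gword" where
  "wgen a = [(a, True)]"

definition winv :: "'a gword \<Rightarrow> 'a gword" where
  "winv w = rev (map (\<lambda>(a, e). (a, \<not> e)) w)"

definition wpow :: "'a gword \<Rightarrow> nat \<Rightarrow> 'a gword" where
  "wpow w k = concat (replicate k w)"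

definition wcomm :: "'a gword \<Rightarrow> 'a gword \<Rightarrow> 'a gword" where
  "wcomm u v = winv u @ winv v @ u @ v"

text \<open>
  The smallest congruence on words that cancels mutually inverse letters and identifies both
  sides of each relation; a pair \<open>(u, v)\<close> in \<open>rels\<close> is the relation \<open>u = v\<close>.
\<close>

inductive word_cong :: "('a gword \<times> 'a gword) set \<Rightarrow> 'a gword \<Rightarrow> 'a gword \<Rightarrow> bool"
  for rels where
  relation: "(u, v) \<in> rels \<Longrightarrow> word_cong rels u v"
| cancel: "word_cong rels [(a, e), (a, \<not> e)] []"
| refl: "word_cong rels u u"
| sym: "word_cong rels u v \<Longrightarrow> word_cong rels v u"
| trans: "word_cong rels u v \<Longrightarrow> word_cong rels v w \<Longrightarrow> word_cong rels u w"
| append: "word_cong rels u u' \<Longrightarrow> word_cong rels v v' \<Longrightarrow> word_cong rels (u @ v) (u' @ v')"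

definition wclass :: "('a gword \<times> 'a gword) set \<Rightarrow> 'a gword \<Rightarrow> 'a gword set" where
  "wclass rels u = {v. word_cong rels u v}"

definition presented_group :: "('a gword \<times> 'a gword) set \<Rightarrow> 'a gword set monoid" where
  "presented_group rels =
     \<lparr> carrier = range (wclass rels),
       monoid.mult = (\<lambda>A B. \<Union>u\<in>A. \<Union>v\<in>B. wclass rels (u @ v)),
       one = wclass rels [] \<rparr>"

lemma wclass_eq_iff: "wclass rels u = wclass rels v \<longleftrightarrow> word_cong rels u v"
proof
  assume "wclass rels u = wclass rels v"
  then have "u \<in> wclass rels v" by (auto simp: wclass_def intro: word_cong.refl)
  then show "word_cong rels u v" by (simp add: wclass_def word_cong.sym)
next
  assume uv: "word_cong rels u v"
  show "wclass rels u = wclass rels v"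
    unfolding wclass_def
    using word_cong.trans[OF uv] word_cong.trans[OF word_cong.sym[OF uv]] by blast
qed

lemma wclass_mult:
  "wclass rels u \<otimes>\<^bsub>presented_group rels\<^esub> wclass rels v = wclass rels (u @ v)"
proof -
  have "wclass rels (u' @ v') = wclass rels (u @ v)"
    if "u' \<in> wclass rels u" "v' \<in> wclass rels v" for u' v'
  proof -
    have "word_cong rels (u @ v) (u' @ v')"
      using that by (intro word_cong.append) (simp_all add: wclass_def)
    then show ?thesis unfolding wclass_eq_iff by (rule word_cong.sym)
  qed
  then have "(\<Union>u'\<in>wclass rels u. \<Union>v'\<in>wclass rels v. wclass rels (u' @ v')) =
      (\<Union>u'\<in>wclass rels u. \<Union>v'\<in>wclass rels v. wclass rels (u @ v))"
    by (intro SUP_cong) simp_all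
  moreover have "u \<in> wclass rels u" "v \<in> wclass rels v"
    by (simp_all add: wclass_def word_cong.refl)
  ultimately have "(\<Union>u'\<in>wclass rels u. \<Union>v'\<in>wclass rels v. wclass rels (u' @ v')) =
      wclass rels (u @ v)"
    by blast
  then show ?thesis by (simp add: presented_group_def)
qed

lemma word_cong_winv_left: "word_cong rels (winv u @ u) []"
proof (induction u)
  case Nil
  show ?case by (simp add: winv_def word_cong.refl)
next
  case (Cons p u)
  obtain a e where p: "p = (a, e)" by (cases p)
  have "word_cong rels ([(a, \<not> e), (a, e)]) []"
    using word_cong.cancel[of rels a "\<not> e"] by simp
  then have "word_cong rels (winv u @ ([(a, \<not> e), (a, e)] @ u)) (winv u @ ([] @ u))"
    by (intro word_cong.append word_cong.refl)
  then have "word_cong rels (winv (p # u) @ p # u) (winv u @ u)"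
    by (simp add: winv_def p)
  then show ?case using Cons.IH by (rule word_cong.trans)
qed

lemma group_presented_group: "group (presented_group rels)"
proof (rule groupI)
  fix A assume "A \<in> carrier (presented_group rels)"
  then obtain u where A: "A = wclass rels u" by (auto simp: presented_group_def)
  have "wclass rels (winv u) \<otimes>\<^bsub>presented_group rels\<^esub> A = \<one>\<^bsub>presented_group rels\<^esub>"
    unfolding A wclass_mult
    by (simp add: presented_group_def wclass_eq_iff word_cong_winv_left)
  moreover have "wclass rels (winv u) \<in> carrier (presented_group rels)"
    by (simp add: presented_group_def)
  ultimately show "\<exists>B\<in>carrier (presented_group rels).
      B \<otimes>\<^bsub>presented_group rels\<^esub> A = \<one>\<^bsub>presented_group rels\<^esub>" by blast
next
  have one: "\<one>\<^bsub>presented_group rels\<^esub> = wclass rels []"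
    by (simp add: presented_group_def)
  fix A assume "A \<in> carrier (presented_group rels)"
  then obtain u where A: "A = wclass rels u" by (auto simp: presented_group_def)
  show "\<one>\<^bsub>presented_group rels\<^esub> \<otimes>\<^bsub>presented_group rels\<^esub> A = A"
    unfolding A one wclass_mult by simp
next
  fix A B assume "A \<in> carrier (presented_group rels)" "B \<in> carrier (presented_group rels)"
  then obtain u v where "A = wclass rels u" "B = wclass rels v"
    by (auto simp: presented_group_def)
  then show "A \<otimes>\<^bsub>presented_group rels\<^esub> B \<in> carrier (presented_group rels)"
    by (simp only: wclass_mult) (simp add: presented_group_def)
next
  fix A B C assume "A \<in> carrier (presented_group rels)" "B \<in> carrier (presented_group rels)"
    "C \<in> carrier (presented_group rels)"
  then obtain u v w where "A = wclass rels u" "B = wclass rels v" "C = wclass rels w"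
    by (auto simp: presented_group_def)
  then show "A \<otimes>\<^bsub>presented_group rels\<^esub> B \<otimes>\<^bsub>presented_group rels\<^esub> C =
      A \<otimes>\<^bsub>presented_group rels\<^esub> (B \<otimes>\<^bsub>presented_group rels\<^esub> C)"
    by (simp only: wclass_mult append_assoc)
qed (simp add: presented_group_def)

text \<open>The universal property (von Dyck's theorem): existence and uniqueness.\<close>

definition weval :: "('g, 'h) monoid_scheme \<Rightarrow> ('a \<Rightarrow> 'g) \<Rightarrow> 'a gword \<Rightarrow> 'g" where
  "weval G f w =
     foldr (\<lambda>(a, e) g. (if e then f a else inv\<^bsub>G\<^esub> (f a)) \<otimes>\<^bsub>G\<^esub> g) w \<one>\<^bsub>G\<^esub>"

context
  fixes G :: "('g, 'h) monoid_scheme" (structure) and f :: "'a \<Rightarrow> 'g"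
  assumes G: "group G" and f: "\<And>a. f a \<in> carrier G"
begin

interpretation group G by (rule G)

lemma weval_closed: "weval G f w \<in> carrier G"
  by (induction w) (auto simp: weval_def f)

lemma weval_append: "weval G f (u @ v) = weval G f u \<otimes> weval G f v"
proof (induction u)
  case Nil
  show ?case using weval_closed[of v] by (simp add: weval_def)
next
  case (Cons p u)
  then show ?case
    using weval_closed[of u] weval_closed[of v] f
    by (cases p) (simp add: weval_def m_assoc)
qed

lemma weval_word_cong:
  assumes "word_cong rels u v" and "\<And>u v. (u, v) \<in> rels \<Longrightarrow> weval G f u = weval G f v"
  shows "weval G f u = weval G f v"
  using assms(1)
proof induction
  case (cancel a e)
  show ?case using f by (cases e) (simp_all add: weval_def)
next
  case (relation u v)
  then show ?case by (rule assms(2))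
next
  case (append u u' v v')
  then show ?case by (simp only: weval_append)
qed simp_all

lemma presented_group_universal:
  assumes rels: "\<And>u v. (u, v) \<in> rels \<Longrightarrow> weval G f u = weval G f v"
  shows "\<exists>h \<in> hom (presented_group rels) G. \<forall>a. h (wclass rels (wgen a)) = f a"
proof -
  define h where "h A = weval G f (SOME u. u \<in> A)" for A
  have h: "h (wclass rels u) = weval G f u" for u
  proof -
    have "u \<in> wclass rels u" by (simp add: wclass_def word_cong.refl)
    then have "(SOME v. v \<in> wclass rels u) \<in> wclass rels u" by (rule someI)
    then have "word_cong rels u (SOME v. v \<in> wclass rels u)" by (simp add: wclass_def)
    from weval_word_cong[OF this rels] show ?thesis unfolding h_def by simp
  qed
  have "h \<in> hom (presented_group rels) G"
  proof (rule homI)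
    fix A assume "A \<in> carrier (presented_group rels)"
    then obtain u where A: "A = wclass rels u" by (auto simp: presented_group_def)
    show "h A \<in> carrier G" unfolding A h by (rule weval_closed)
  next
    fix A B assume "A \<in> carrier (presented_group rels)" "B \<in> carrier (presented_group rels)"
    then obtain u v where AB: "A = wclass rels u" "B = wclass rels v"
      by (auto simp: presented_group_def)
    show "h (A \<otimes>\<^bsub>presented_group rels\<^esub> B) = h A \<otimes> h B"
      unfolding AB wclass_mult h by (rule weval_append)
  qed
  moreover have "h (wclass rels (wgen a)) = f a" for a
    unfolding h using f by (simp add: weval_def wgen_def)
  ultimately show ?thesis by blast
qed

lemma presented_group_hom_unique:
  assumes h: "h \<in> hom (presented_group rels) G" and h_gen: "\<And>a. h (wclass rels (wgen a)) = f a"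
  shows "h (wclass rels w) = weval G f w"
proof -
  interpret P: group "presented_group rels" by (rule group_presented_group)
  interpret group_hom "presented_group rels" G h
    by unfold_locales (rule h)
  have carr: "wclass rels u \<in> carrier (presented_group rels)" for u
    by (simp add: presented_group_def)
  have one: "wclass rels [] = \<one>\<^bsub>presented_group rels\<^esub>"
    by (simp add: presented_group_def)
  have neg: "h (wclass rels [(a, False)]) = inv (f a)" for a
  proof -
    have "wclass rels [(a, False)] \<otimes>\<^bsub>presented_group rels\<^esub> wclass rels (wgen a) =
        \<one>\<^bsub>presented_group rels\<^esub>"
      unfolding wclass_mult one[symmetric] wclass_eq_iff
      using word_cong.cancel[of rels a False] by (simp add: wgen_def)
    then have "h (wclass rels [(a, False)]) \<otimes> f a = \<one>"
      using hom_mult[OF carr carr, of "[(a, False)]" "wgen a"] h_gen by simp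
    then show ?thesis using f carr by (metis hom_closed inv_equality)
  qed
  show ?thesis
  proof (induction w)
    case Nil
    show ?case by (simp add: one weval_def)
  next
    case (Cons p w)
    obtain a e where p: "p = (a, e)" by (cases p)
    have "h (wclass rels (p # w)) = h (wclass rels [p]) \<otimes> h (wclass rels w)"
      using hom_mult[OF carr carr, of "[p]" w] by (simp add: wclass_mult)
    moreover have "h (wclass rels [p]) = (if e then f a else inv (f a))"
      using neg h_gen[of a] by (simp add: p wgen_def)
    ultimately show ?case by (simp add: p Cons.IH weval_def)
  qed
qed

end


section \<open>The two groups\<close>

datatype gen_G = Gx | Gy | Gz

definition group_G :: "nat \<Rightarrow> nat \<Rightarrow> nat \<Rightarrow> gen_G gword set monoid" where
  "group_G n m l =
    (let x = wgen Gx; y = wgen Gy; z = wgen Gz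
     in presented_group
          {(wpow x (2 ^ n), []),
           (wpow y (2 ^ m), []),
           (wpow z (2 ^ l), []),
           (wcomm y x, z),
           (wcomm z x, winv (wpow z 2)),
           (wcomm z y, winv (wpow z 2))})"

datatype gen_H = Ha | Hb | Hc

definition group_H :: "nat \<Rightarrow> nat \<Rightarrow> nat \<Rightarrow> gen_H gword set monoid" where
  "group_H n m l =
    (let a = wgen Ha; b = wgen Hb; c = wgen Hc
     in presented_group
          {(wpow a (2 ^ n), []),
           (wpow b (2 ^ m), wpow a (2 ^ m)),
           (wpow c (2 ^ l), []),
           (wcomm b a, c),
           (wcomm c a, winv (wpow c 2)),
           (wcomm c b, winv (wpow c 2))})"


section \<open>Characteristic and group algebras\<close>

text \<open>The additive order of the identity; it is \<open>0\<close> if that order is infinite.\<close>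

definition ring_char :: "('r, 'e) ring_scheme \<Rightarrow> nat" where
  "ring_char R = group.ord (add_monoid R) \<one>\<^bsub>R\<^esub>"

lemma (in ring) ring_char_dvd_iff: "add_pow R n \<one> = \<zero> \<longleftrightarrow> ring_char R dvd n" for n :: nat
  using add.pow_eq_id[of \<one> n] by (simp add: ring_char_def)

text \<open>
  An element is a finitely supported function from \<open>carrier G\<close> to \<open>carrier R\<close>, made
  extensional so that equality of elements is equality of functions.
\<close>

definition group_algebra ::
    "('r, 'e) ring_scheme \<Rightarrow> ('g, 'h) monoid_scheme \<Rightarrow> ('r, 'g \<Rightarrow> 'r) module" where
  "group_algebra R G =
     \<lparr> carrier = {f \<in> carrier G \<rightarrow>\<^sub>E carrier R. finite {g \<in> carrier G. f g \<noteq> \<zero>\<^bsub>R\<^esub>}},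
       monoid.mult = (\<lambda>f1 f2. \<lambda>g\<in>carrier G.
         \<Oplus>\<^bsub>R\<^esub>u\<in>{u \<in> carrier G. f1 u \<noteq> \<zero>\<^bsub>R\<^esub>}. f1 u \<otimes>\<^bsub>R\<^esub> f2 (inv\<^bsub>G\<^esub> u \<otimes>\<^bsub>G\<^esub> g)),
       one = (\<lambda>g\<in>carrier G. if g = \<one>\<^bsub>G\<^esub> then \<one>\<^bsub>R\<^esub> else \<zero>\<^bsub>R\<^esub>),
       ring.zero = (\<lambda>g\<in>carrier G. \<zero>\<^bsub>R\<^esub>),
       ring.add = (\<lambda>f1 f2. \<lambda>g\<in>carrier G. f1 g \<oplus>\<^bsub>R\<^esub> f2 g),
       smult = (\<lambda>r f. \<lambda>g\<in>carrier G. r \<otimes>\<^bsub>R\<^esub> f g) \<rparr>"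

text \<open>
  The locale \<open>algebra\<close> of the library requires commutative algebras, so isomorphism of
  \<open>R\<close>-algebras is stated here for arbitrary \<open>module\<close> records.
\<close>

definition algebra_isomorphic ::
    "('r, 'e) ring_scheme \<Rightarrow> ('r, 'a, 'c) module_scheme \<Rightarrow> ('r, 'b, 'd) module_scheme \<Rightarrow> bool" where
  "algebra_isomorphic R A B \<longleftrightarrow>
     (\<exists>h \<in> ring_iso A B. \<forall>r \<in> carrier R. \<forall>a \<in> carrier A. h (r \<odot>\<^bsub>A\<^esub> a) = r \<odot>\<^bsub>B\<^esub> h a)"

end

(*
  Both groups are generated by two elements x, y with central squares and [y, x]^(2^l) = 1; they
  differ in the relation for y^(2^m), which is 1 in G and x^(2^m) in H.

  In characteristic 2, put t = x y + y x. Then t is central and t^(2^l) = (x y)^(2^l) + (y x)^(2^l) = 0, and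
  (1 + x + y)^2 = 1 + x^2 + y^2 + t, so (1 + x + y)^(2^m) = 1 + x^(2^m) + y^(2^m) because m > l. Hence
  y |-> 1 + a + b and b |-> 1 + x + y (with x |-> a, a |-> x) define mutually inverse isomorphisms.

  In the other case let K be the residue field of the maximal ideal; it has characteristic 2, and
  2 c = 0 in R forces c = 0 in K. Let A, B be the images of a, b under an isomorphism RH -> RG, and for F in RG let
  e_ij(F) in K be the sum of the coefficients of F over the class x^i y^j modulo the squares and [y, x].
  The squares of A and B are central. Comparing coefficients of a central square in the group algebra
  of the dihedral quotient of order 16 gives e_11 = 0 and e_00 e_10 = e_00 e_01 = 0 for A and B.
  Comparing A^(2^m) = B^(2^m) in the quotient algebra over K of a cyclic group of order 2^(m+1)
  (y |-> 1) shows that A and B agree in e_00 + e_01 and e_10 + e_11. But a nonzero combination of the derivations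
  e_10 + e_11 and e_01 + e_11 cannot vanish on both generators A and B, so their values on A and B are
  linearly independent; then e_00 = 0 for A and B, so e_10 and e_01 agree on A and B, a contradiction.
*)
theory Submission
  imports Defs
begin

section \<open>Group algebras\<close>

text \<open>By the second half of the theorem the two group algebras over the residue field K are
  isomorphic, so reduction modulo the maximal ideal alone cannot separate them. The coefficients of
  a square are therefore compared over \<open>R\<close> itself, where products of two different
  terms may occur doubled: an equation 2 c = 0 is obtained in \<open>R\<close>, and only then is c
  reduced to K. The sizes of the two quotients are dictated by this comparison. In the dihedral
  group of order 8 the rotation w satisfies w^2 = w^(-2), so the coefficients at w^2 and at its
  inverse carry no information. In order 16 the elements w^2 and w^6 are distinct and conjugate, and
  their coefficients in a square differ, up to doubled terms, by squares of the odd rotation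
  coefficients; this yields e_11 = 0. Such a quotient exists because l is at least 2. The cyclic
  quotient has order 2^(m+1), the smallest order for which x^(2^m) survives, and it exists because n
  > m.\<close>

definition gsingle :: "('r, 'e) ring_scheme \<Rightarrow> ('g, 'h) monoid_scheme \<Rightarrow> 'r \<Rightarrow> 'g \<Rightarrow> 'g \<Rightarrow> 'r" where
  "gsingle R G r g = (\<lambda>k\<in>carrier G. if k = g then r else \<zero>\<^bsub>R\<^esub>)"

locale group_alg = R?: cring R + G: group G
  for R :: "('r, 'e) ring_scheme" (structure) and G :: "('g, 'h) monoid_scheme"
begin

abbreviation "RG \<equiv> group_algebra R G"
abbreviation "supp f \<equiv> {g \<in> carrier G. f g \<noteq> \<zero>}"

lemma carrier_iff:
  "f \<in> carrier RG \<longleftrightarrow> f \<in> carrier G \<rightarrow>\<^sub>E carrier R \<and> finite (supp f)"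
  by (simp add: group_algebra_def)

lemma add_eq: "f1 \<oplus>\<^bsub>RG\<^esub> f2 = (\<lambda>g\<in>carrier G. f1 g \<oplus> f2 g)"
  by (simp add: group_algebra_def)

lemma zero_eq: "\<zero>\<^bsub>RG\<^esub> = (\<lambda>g\<in>carrier G. \<zero>)"
  by (simp add: group_algebra_def)

lemma smult_eq: "r \<odot>\<^bsub>RG\<^esub> f = (\<lambda>g\<in>carrier G. r \<otimes> f g)"
  by (simp add: group_algebra_def)

lemma mult_eq: "f1 \<otimes>\<^bsub>RG\<^esub> f2 =
    (\<lambda>g\<in>carrier G. \<Oplus>u\<in>supp f1. f1 u \<otimes> f2 (inv\<^bsub>G\<^esub> u \<otimes>\<^bsub>G\<^esub> g))"
  by (simp add: group_algebra_def)

lemma one_eq: "\<one>\<^bsub>RG\<^esub> = gsingle R G \<one> \<one>\<^bsub>G\<^esub>"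
  by (simp add: group_algebra_def gsingle_def)

lemma coeff_closed [simp]: "f \<in> carrier RG \<Longrightarrow> g \<in> carrier G \<Longrightarrow> f g \<in> carrier R"
  by (auto simp: carrier_iff)

lemma finite_supp [simp]: "f \<in> carrier RG \<Longrightarrow> finite (supp f)"
  by (simp add: carrier_iff)

lemma elem_eqI:
  assumes "f \<in> carrier RG" "f' \<in> carrier RG" "\<And>g. g \<in> carrier G \<Longrightarrow> f g = f' g"
  shows "f = f'"
  using assms unfolding carrier_iff by (auto intro: PiE_ext)

lemma memI:
  assumes S: "finite S" and f: "\<And>g. g \<in> carrier G \<Longrightarrow> f g \<in> carrier R"
    and out: "\<And>g. g \<in> carrier G \<Longrightarrow> g \<notin> S \<Longrightarrow> f g = \<zero>"
  shows "(\<lambda>g\<in>carrier G. f g) \<in> carrier RG"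
  unfolding carrier_iff
proof
  show "finite {g \<in> carrier G. (\<lambda>g\<in>carrier G. f g) g \<noteq> \<zero>}"
    using S by (rule finite_subset[rotated]) (use out in auto)
qed (use f in auto)

lemma add_app [simp]: "g \<in> carrier G \<Longrightarrow> (f1 \<oplus>\<^bsub>RG\<^esub> f2) g = f1 g \<oplus> f2 g"
  by (simp add: add_eq)

lemma zero_app [simp]: "g \<in> carrier G \<Longrightarrow> \<zero>\<^bsub>RG\<^esub> g = \<zero>"
  by (simp add: zero_eq)

lemma smult_app [simp]: "g \<in> carrier G \<Longrightarrow> (r \<odot>\<^bsub>RG\<^esub> f) g = r \<otimes> f g"
  by (simp add: smult_eq)

lemma add_mem: "f1 \<in> carrier RG \<Longrightarrow> f2 \<in> carrier RG \<Longrightarrow> f1 \<oplus>\<^bsub>RG\<^esub> f2 \<in> carrier RG"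
  unfolding add_eq by (rule memI[of "supp f1 \<union> supp f2"]) auto

lemma zero_mem: "\<zero>\<^bsub>RG\<^esub> \<in> carrier RG"
  unfolding zero_eq by (rule memI[of "{}"]) auto

lemma smult_mem: "r \<in> carrier R \<Longrightarrow> f \<in> carrier RG \<Longrightarrow> r \<odot>\<^bsub>RG\<^esub> f \<in> carrier RG"
  unfolding smult_eq by (rule memI[of "supp f"]) auto

section \<open>The ring structure of a group algebra\<close>

lemma abelian_group_RG: "abelian_group RG"
proof (rule abelian_groupI)
  fix f assume f: "f \<in> carrier RG"
  have "(\<lambda>g\<in>carrier G. \<ominus> f g) \<in> carrier RG"
    by (rule memI[of "supp f"]) (use f in auto)
  then show "\<exists>f'\<in>carrier RG. f' \<oplus>\<^bsub>RG\<^esub> f = \<zero>\<^bsub>RG\<^esub>"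
    using f by (intro bexI[of _ "\<lambda>g\<in>carrier G. \<ominus> f g"] elem_eqI) (auto simp: add_mem zero_mem R.l_neg)
qed (auto intro!: elem_eqI simp: add_mem zero_mem R.a_ac)

interpretation RG: abelian_group RG by (rule abelian_group_RG)

lemma gsingle_mem [simp]: "r \<in> carrier R \<Longrightarrow> gsingle R G r g \<in> carrier RG"
  unfolding gsingle_def by (rule memI[of "{g}"]) auto

lemma gsingle_app: "k \<in> carrier G \<Longrightarrow> gsingle R G r g k = (if k = g then r else \<zero>)"
  by (simp add: gsingle_def)

lemma gsingle_zero: "gsingle R G \<zero> g = \<zero>\<^bsub>RG\<^esub>"
  by (intro elem_eqI) (auto simp: zero_mem gsingle_app)

lemma gsingle_add:
  "r \<in> carrier R \<Longrightarrow> s \<in> carrier R \<Longrightarrow> gsingle R G (r \<oplus> s) g = gsingle R G r g \<oplus>\<^bsub>RG\<^esub> gsingle R G s g"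
  by (intro elem_eqI) (auto simp: add_mem gsingle_app)

lemma smult_gsingle:
  "r \<in> carrier R \<Longrightarrow> s \<in> carrier R \<Longrightarrow> r \<odot>\<^bsub>RG\<^esub> gsingle R G s g = gsingle R G (r \<otimes> s) g"
  by (intro elem_eqI) (auto simp: smult_mem gsingle_app)

lemma smult_add:
  "r \<in> carrier R \<Longrightarrow> f \<in> carrier RG \<Longrightarrow> f' \<in> carrier RG \<Longrightarrow>
    r \<odot>\<^bsub>RG\<^esub> (f \<oplus>\<^bsub>RG\<^esub> f') = r \<odot>\<^bsub>RG\<^esub> f \<oplus>\<^bsub>RG\<^esub> r \<odot>\<^bsub>RG\<^esub> f'"
  by (intro elem_eqI) (auto simp: smult_mem add_mem R.r_distr)

text \<open>Every element is a finite sum of monomials, so a property stable under sums need only be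
  checked on monomials. The multilinear identities below, associativity included, are reduced in
  this way to the axioms of \<open>R\<close> and \<open>G\<close>. Induction is on a finite set that
  contains the support, so an inclusion suffices for the remainder after one term is split
  off.\<close>

lemma elem_induct [consumes 1, case_names single add]:
  assumes f: "f \<in> carrier RG"
    and single: "\<And>r g. r \<in> carrier R \<Longrightarrow> g \<in> carrier G \<Longrightarrow> P (gsingle R G r g)"
    and add: "\<And>f f'. f \<in> carrier RG \<Longrightarrow> f' \<in> carrier RG \<Longrightarrow> P f \<Longrightarrow> P f' \<Longrightarrow> P (f \<oplus>\<^bsub>RG\<^esub> f')"
  shows "P f"
proof -
  have "\<forall>f \<in> carrier RG. supp f \<subseteq> S \<longrightarrow> P f" if "finite S" "S \<subseteq> carrier G" for S
    using that
  proof (induction S)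
    case empty
    \<comment> \<open>The zero element is a monomial with coefficient \<open>\<zero>\<close>, so the
      rule has no separate case for it.\<close>
    have "P (gsingle R G \<zero> \<one>\<^bsub>G\<^esub>)" by (rule single) auto
    then have "P \<zero>\<^bsub>RG\<^esub>" by (simp add: gsingle_zero)
    moreover have "f = \<zero>\<^bsub>RG\<^esub>" if "f \<in> carrier RG" "supp f \<subseteq> {}" for f
      using that by (intro elem_eqI) (auto simp: zero_mem)
    ultimately show ?case by blast
  next
    case (insert k S)
    show ?case
    proof (intro ballI impI)
      fix f assume f: "f \<in> carrier RG" and S: "supp f \<subseteq> insert k S"
      define f' where "f' = (\<lambda>g\<in>carrier G. if g = k then \<zero> else f g)"
      have f': "f' \<in> carrier RG"
        unfolding f'_def by (rule memI[of "supp f"]) (use f in auto)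
      have "supp f' \<subseteq> S" using S unfolding f'_def by (auto simp: restrict_def)
      then have "P f'" using insert f' by blast
      have "P (gsingle R G (f k) k \<oplus>\<^bsub>RG\<^esub> f')"
        using insert f f' \<open>P f'\<close> by (intro add single) auto
      moreover have "f = gsingle R G (f k) k \<oplus>\<^bsub>RG\<^esub> f'"
        using f f' insert by (intro elem_eqI) (auto simp: add_mem gsingle_app f'_def)
      ultimately show "P f" by simp
    qed
  qed
  from this[of "supp f"] show ?thesis using f by auto
qed

text \<open>The defining sum ranges over the support of the left factor, which changes under
  addition. Enlarging the index set to a common \<open>S\<close> adds only zero terms and makes the
  sums for different left factors comparable.\<close>

lemma mult_app:
  assumes "f1 \<in> carrier RG" "f2 \<in> carrier RG" "finite S" "S \<subseteq> carrier G" "supp f1 \<subseteq> S" "g \<in> carrier G"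
  shows "(f1 \<otimes>\<^bsub>RG\<^esub> f2) g = (\<Oplus>u\<in>S. f1 u \<otimes> f2 (inv\<^bsub>G\<^esub> u \<otimes>\<^bsub>G\<^esub> g))"
proof -
  have "(f1 \<otimes>\<^bsub>RG\<^esub> f2) g = (\<Oplus>u\<in>supp f1. f1 u \<otimes> f2 (inv\<^bsub>G\<^esub> u \<otimes>\<^bsub>G\<^esub> g))"
    using assms(6) by (simp add: mult_eq)
  also have "\<dots> = (\<Oplus>u\<in>S. f1 u \<otimes> f2 (inv\<^bsub>G\<^esub> u \<otimes>\<^bsub>G\<^esub> g))"
    using assms by (intro R.add.finprod_mono_neutral_cong_left) auto
  finally show ?thesis .
qed

lemma mult_mem:
  assumes f: "f1 \<in> carrier RG" "f2 \<in> carrier RG"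
  shows "f1 \<otimes>\<^bsub>RG\<^esub> f2 \<in> carrier RG"
proof -
  let ?m = "\<lambda>g. \<Oplus>u\<in>supp f1. f1 u \<otimes> f2 (inv\<^bsub>G\<^esub> u \<otimes>\<^bsub>G\<^esub> g)"
  have "(\<lambda>g\<in>carrier G. ?m g) \<in> carrier RG"
  proof (rule memI)
    \<comment> \<open>The support of a product lies in the set of products of the two
      supports.\<close>
    show "finite ((\<lambda>(u, v). u \<otimes>\<^bsub>G\<^esub> v) ` (supp f1 \<times> supp f2))" using f by simp
    show "?m g \<in> carrier R" if "g \<in> carrier G" for g
      using f that by (intro R.finsum_closed) auto
    show "?m g = \<zero>" if g: "g \<in> carrier G" "g \<notin> (\<lambda>(u, v). u \<otimes>\<^bsub>G\<^esub> v) ` (supp f1 \<times> supp f2)" for g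
    proof -
      have "f2 (inv\<^bsub>G\<^esub> u \<otimes>\<^bsub>G\<^esub> g) = \<zero>" if u: "u \<in> supp f1" for u
      proof (rule ccontr)
        assume "f2 (inv\<^bsub>G\<^esub> u \<otimes>\<^bsub>G\<^esub> g) \<noteq> \<zero>"
        then have "(u, inv\<^bsub>G\<^esub> u \<otimes>\<^bsub>G\<^esub> g) \<in> supp f1 \<times> supp f2" using u g by auto
        moreover have "g = u \<otimes>\<^bsub>G\<^esub> (inv\<^bsub>G\<^esub> u \<otimes>\<^bsub>G\<^esub> g)" using u g by (simp add: G.m_assoc[symmetric])
        ultimately show False using g(2) by (metis (no_types, lifting) case_prod_conv image_eqI)
      qed
      then show ?thesis using f by (intro R.add.finprod_one_eqI) auto
    qed
  qed
  then show ?thesis unfolding mult_eq .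
qed

lemma gsingle_mult_app:
  assumes "r \<in> carrier R" "g \<in> carrier G" "f \<in> carrier RG" "k \<in> carrier G"
  shows "(gsingle R G r g \<otimes>\<^bsub>RG\<^esub> f) k = r \<otimes> f (inv\<^bsub>G\<^esub> g \<otimes>\<^bsub>G\<^esub> k)"
  using assms by (subst mult_app[where S="{g}"]) (auto simp: gsingle_app split: if_splits)

lemma l_distr_RG:
  assumes f: "f1 \<in> carrier RG" "f2 \<in> carrier RG" "f3 \<in> carrier RG"
  shows "(f1 \<oplus>\<^bsub>RG\<^esub> f2) \<otimes>\<^bsub>RG\<^esub> f3 = f1 \<otimes>\<^bsub>RG\<^esub> f3 \<oplus>\<^bsub>RG\<^esub> f2 \<otimes>\<^bsub>RG\<^esub> f3"
proof (rule elem_eqI)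
  fix g assume g: "g \<in> carrier G"
  let ?S = "supp f1 \<union> supp f2"
  have "((f1 \<oplus>\<^bsub>RG\<^esub> f2) \<otimes>\<^bsub>RG\<^esub> f3) g = (\<Oplus>u\<in>?S. (f1 \<oplus>\<^bsub>RG\<^esub> f2) u \<otimes> f3 (inv\<^bsub>G\<^esub> u \<otimes>\<^bsub>G\<^esub> g))"
    using f g by (intro mult_app) (auto simp: add_mem)
  also have "\<dots> = (\<Oplus>u\<in>?S. f1 u \<otimes> f3 (inv\<^bsub>G\<^esub> u \<otimes>\<^bsub>G\<^esub> g) \<oplus> f2 u \<otimes> f3 (inv\<^bsub>G\<^esub> u \<otimes>\<^bsub>G\<^esub> g))"
    using f g by (intro R.finsum_cong') (auto simp: R.l_distr)
  also have "\<dots> = (\<Oplus>u\<in>?S. f1 u \<otimes> f3 (inv\<^bsub>G\<^esub> u \<otimes>\<^bsub>G\<^esub> g)) \<oplus> (\<Oplus>u\<in>?S. f2 u \<otimes> f3 (inv\<^bsub>G\<^esub> u \<otimes>\<^bsub>G\<^esub> g))"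
    using f g by (intro R.finsum_addf) auto
  also have "\<dots> = (f1 \<otimes>\<^bsub>RG\<^esub> f3) g \<oplus> (f2 \<otimes>\<^bsub>RG\<^esub> f3) g"
    using f g by (intro arg_cong2[where f="(\<oplus>)"] mult_app[symmetric]) auto
  finally show "((f1 \<oplus>\<^bsub>RG\<^esub> f2) \<otimes>\<^bsub>RG\<^esub> f3) g = (f1 \<otimes>\<^bsub>RG\<^esub> f3 \<oplus>\<^bsub>RG\<^esub> f2 \<otimes>\<^bsub>RG\<^esub> f3) g"
    using g by simp
qed (use f in \<open>auto simp: mult_mem add_mem\<close>)

lemma r_distr_RG:
  assumes f: "f1 \<in> carrier RG" "f2 \<in> carrier RG" "f3 \<in> carrier RG"
  shows "f3 \<otimes>\<^bsub>RG\<^esub> (f1 \<oplus>\<^bsub>RG\<^esub> f2) = f3 \<otimes>\<^bsub>RG\<^esub> f1 \<oplus>\<^bsub>RG\<^esub> f3 \<otimes>\<^bsub>RG\<^esub> f2"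
proof (rule elem_eqI)
  fix g assume g: "g \<in> carrier G"
  let ?S = "supp f3"
  have "(f3 \<otimes>\<^bsub>RG\<^esub> (f1 \<oplus>\<^bsub>RG\<^esub> f2)) g = (\<Oplus>u\<in>?S. f3 u \<otimes> (f1 \<oplus>\<^bsub>RG\<^esub> f2) (inv\<^bsub>G\<^esub> u \<otimes>\<^bsub>G\<^esub> g))"
    using f g by (intro mult_app) (auto simp: add_mem)
  also have "\<dots> = (\<Oplus>u\<in>?S. f3 u \<otimes> f1 (inv\<^bsub>G\<^esub> u \<otimes>\<^bsub>G\<^esub> g) \<oplus> f3 u \<otimes> f2 (inv\<^bsub>G\<^esub> u \<otimes>\<^bsub>G\<^esub> g))"
    using f g by (intro R.finsum_cong') (auto simp: R.r_distr)
  also have "\<dots> = (\<Oplus>u\<in>?S. f3 u \<otimes> f1 (inv\<^bsub>G\<^esub> u \<otimes>\<^bsub>G\<^esub> g)) \<oplus> (\<Oplus>u\<in>?S. f3 u \<otimes> f2 (inv\<^bsub>G\<^esub> u \<otimes>\<^bsub>G\<^esub> g))"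
    using f g by (intro R.finsum_addf) auto
  also have "\<dots> = (f3 \<otimes>\<^bsub>RG\<^esub> f1) g \<oplus> (f3 \<otimes>\<^bsub>RG\<^esub> f2) g"
    using f g by (intro arg_cong2[where f="(\<oplus>)"] mult_app[symmetric]) auto
  finally show "(f3 \<otimes>\<^bsub>RG\<^esub> (f1 \<oplus>\<^bsub>RG\<^esub> f2)) g = (f3 \<otimes>\<^bsub>RG\<^esub> f1 \<oplus>\<^bsub>RG\<^esub> f3 \<otimes>\<^bsub>RG\<^esub> f2) g"
    using g by simp
qed (use f in \<open>auto simp: mult_mem add_mem\<close>)

lemma gsingle_mult:
  assumes "r \<in> carrier R" "s \<in> carrier R" "g \<in> carrier G" "k \<in> carrier G"
  shows "gsingle R G r g \<otimes>\<^bsub>RG\<^esub> gsingle R G s k = gsingle R G (r \<otimes> s) (g \<otimes>\<^bsub>G\<^esub> k)"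
proof (rule elem_eqI)
  fix u assume u: "u \<in> carrier G"
  have "inv\<^bsub>G\<^esub> g \<otimes>\<^bsub>G\<^esub> u = k \<longleftrightarrow> u = g \<otimes>\<^bsub>G\<^esub> k"
    using assms u by (metis G.inv_solve_left)
  then show "(gsingle R G r g \<otimes>\<^bsub>RG\<^esub> gsingle R G s k) u = gsingle R G (r \<otimes> s) (g \<otimes>\<^bsub>G\<^esub> k) u"
    using assms u by (simp add: gsingle_mult_app gsingle_app)
qed (use assms in \<open>auto simp: mult_mem\<close>)

lemma m_assoc_RG:
  assumes f: "f1 \<in> carrier RG" "f2 \<in> carrier RG" "f3 \<in> carrier RG"
  shows "(f1 \<otimes>\<^bsub>RG\<^esub> f2) \<otimes>\<^bsub>RG\<^esub> f3 = f1 \<otimes>\<^bsub>RG\<^esub> (f2 \<otimes>\<^bsub>RG\<^esub> f3)"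
  using f(1)
proof (induction f1 rule: elem_induct)
  case (single r g)
  show ?case using f(2)
  proof (induction f2 rule: elem_induct)
    case (single s k)
    show ?case using f(3)
    proof (induction f3 rule: elem_induct)
      case (single t u)
      then show ?case using \<open>r \<in> carrier R\<close> \<open>g \<in> carrier G\<close> \<open>s \<in> carrier R\<close> \<open>k \<in> carrier G\<close>
        by (simp add: gsingle_mult R.m_assoc G.m_assoc)
    next
      case (add f f')
      then show ?case using \<open>r \<in> carrier R\<close> \<open>g \<in> carrier G\<close> \<open>s \<in> carrier R\<close> \<open>k \<in> carrier G\<close>
        by (simp add: r_distr_RG mult_mem)
    qed
  next
    case (add f f')
    then show ?case using \<open>r \<in> carrier R\<close> \<open>g \<in> carrier G\<close> f
      by (simp add: r_distr_RG l_distr_RG mult_mem)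
  qed
next
  case (add f f')
  then show ?case using f by (simp add: l_distr_RG mult_mem)
qed

sublocale RG: ring RG
proof (rule ringI)
  show "monoid RG"
  proof (rule monoidI)
    fix f assume "f \<in> carrier RG"
    then show "\<one>\<^bsub>RG\<^esub> \<otimes>\<^bsub>RG\<^esub> f = f" "f \<otimes>\<^bsub>RG\<^esub> \<one>\<^bsub>RG\<^esub> = f"
      by (induction f rule: elem_induct)
        (simp_all add: one_eq gsingle_mult l_distr_RG r_distr_RG)
  qed (simp_all add: mult_mem m_assoc_RG one_eq)
qed (simp_all add: abelian_group_RG l_distr_RG r_distr_RG)

text \<open>Scalars act through the constants, so a ring homomorphism that sends each constant to
  the same constant respects the algebra structure.\<close>

lemma smult_eq_mult:
  assumes "r \<in> carrier R" "f \<in> carrier RG"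
  shows "r \<odot>\<^bsub>RG\<^esub> f = gsingle R G r \<one>\<^bsub>G\<^esub> \<otimes>\<^bsub>RG\<^esub> f"
  using assms by (intro elem_eqI) (auto simp: smult_mem mult_mem gsingle_mult_app)

definition basis :: "'g \<Rightarrow> 'g \<Rightarrow> 'r" where "basis g = gsingle R G \<one> g"

lemma basis_mem [simp]: "basis g \<in> carrier RG"
  by (simp add: basis_def)

lemma basis_mult: "g \<in> carrier G \<Longrightarrow> k \<in> carrier G \<Longrightarrow> basis g \<otimes>\<^bsub>RG\<^esub> basis k = basis (g \<otimes>\<^bsub>G\<^esub> k)"
  by (simp add: basis_def gsingle_mult)

text \<open>Landing in the unit group rather than in the ring makes the target a group, as von
  Dyck's theorem requires.\<close>

lemma basis_hom: "basis \<in> hom G (units_of RG)"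
proof (rule homI)
  fix g assume g: "g \<in> carrier G"
  have "basis g \<otimes>\<^bsub>RG\<^esub> basis (inv\<^bsub>G\<^esub> g) = \<one>\<^bsub>RG\<^esub>" "basis (inv\<^bsub>G\<^esub> g) \<otimes>\<^bsub>RG\<^esub> basis g = \<one>\<^bsub>RG\<^esub>"
    using g by (auto simp: basis_mult) (simp_all add: basis_def one_eq)
  then show "basis g \<in> carrier (units_of RG)"
    unfolding units_of_carrier Units_def by auto
qed (simp add: units_of_mult basis_mult)

lemma const_hom: "(\<lambda>r. gsingle R G r \<one>\<^bsub>G\<^esub>) \<in> ring_hom R RG"
  by (rule ring_hom_memI) (auto simp: gsingle_mult gsingle_add one_eq)

lemma const_mult_basis:
  "r \<in> carrier R \<Longrightarrow> g \<in> carrier G \<Longrightarrow> gsingle R G r \<one>\<^bsub>G\<^esub> \<otimes>\<^bsub>RG\<^esub> basis g = gsingle R G r g"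
  by (simp add: basis_def gsingle_mult)

lemma const_comm:
  assumes r: "r \<in> carrier R" and "f \<in> carrier RG"
  shows "gsingle R G r \<one>\<^bsub>G\<^esub> \<otimes>\<^bsub>RG\<^esub> f = f \<otimes>\<^bsub>RG\<^esub> gsingle R G r \<one>\<^bsub>G\<^esub>"
  using assms(2) by (induction f rule: elem_induct)
    (use r in \<open>simp_all add: gsingle_mult l_distr_RG r_distr_RG R.m_comm\<close>)

text \<open>\<open>lin T \<rho> c\<close> is the additive map \<open>r \<cdot> g \<mapsto> \<rho> r \<otimes> c g\<close> with values in \<open>T\<close>.\<close>

definition lin :: "('t, 'k) ring_scheme \<Rightarrow> ('r \<Rightarrow> 't) \<Rightarrow> ('g \<Rightarrow> 't) \<Rightarrow> ('g \<Rightarrow> 'r) \<Rightarrow> 't" where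
  "lin T \<rho> c f = (\<Oplus>\<^bsub>T\<^esub>g\<in>supp f. \<rho> (f g) \<otimes>\<^bsub>T\<^esub> c g)"

section \<open>Additive maps out of a group algebra and its universal property\<close>

context
  fixes T :: "('t, 'k) ring_scheme" and \<rho> :: "'r \<Rightarrow> 't" and c :: "'g \<Rightarrow> 't"
  assumes T: "ring T" and \<rho>: "\<rho> \<in> ring_hom R T" and c: "c \<in> carrier G \<rightarrow> carrier T"
begin

interpretation T: ring T by (rule T)

lemma rho_closed: "r \<in> carrier R \<Longrightarrow> \<rho> r \<in> carrier T"
  by (rule ring_hom_closed[OF \<rho>])

lemma c_closed: "g \<in> carrier G \<Longrightarrow> c g \<in> carrier T"
  using c by auto

lemma rho_zero: "\<rho> \<zero> = \<zero>\<^bsub>T\<^esub>"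
  by (rule ring_hom_zero[OF \<rho> R.ring_axioms T])

text \<open>Same purpose as \<open>mult_app\<close>: sums for different elements are brought to one
  index set.\<close>

lemma lin_superset:
  assumes "f \<in> carrier RG" "finite S" "S \<subseteq> carrier G" "supp f \<subseteq> S"
  shows "lin T \<rho> c f = (\<Oplus>\<^bsub>T\<^esub>g\<in>S. \<rho> (f g) \<otimes>\<^bsub>T\<^esub> c g)"
proof -
  have "\<rho> (f g) \<otimes>\<^bsub>T\<^esub> c g \<in> carrier T" if "g \<in> carrier G" for g
    using assms(1) c that by (intro T.m_closed ring_hom_closed[OF \<rho>]) auto
  moreover have "\<rho> (f g) \<otimes>\<^bsub>T\<^esub> c g = \<zero>\<^bsub>T\<^esub>" if "g \<in> S - supp f" for g
  proof -
    have "g \<in> carrier G" "f g = \<zero>" using that assms by auto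
    then show ?thesis using c by (simp add: rho_zero funcset_mem[OF c])
  qed
  ultimately show ?thesis
    unfolding lin_def using assms
    by (intro T.add.finprod_mono_neutral_cong_left) auto
qed

lemma lin_closed [simp]: "f \<in> carrier RG \<Longrightarrow> lin T \<rho> c f \<in> carrier T"
  unfolding lin_def using c by (intro T.finsum_closed) (auto intro!: T.m_closed ring_hom_closed[OF \<rho>])

lemma lin_gsingle:
  assumes "r \<in> carrier R" "g \<in> carrier G"
  shows "lin T \<rho> c (gsingle R G r g) = \<rho> r \<otimes>\<^bsub>T\<^esub> c g"
proof -
  have "lin T \<rho> c (gsingle R G r g) = (\<Oplus>\<^bsub>T\<^esub>k\<in>{g}. \<rho> (gsingle R G r g k) \<otimes>\<^bsub>T\<^esub> c k)"
    using assms by (intro lin_superset) (auto simp: gsingle_app split: if_splits)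
  also have "\<dots> = \<rho> r \<otimes>\<^bsub>T\<^esub> c g"
    using assms by (subst T.finsum_insert) (auto simp: gsingle_app rho_closed c_closed)
  finally show ?thesis .
qed

lemma lin_add:
  assumes f: "f \<in> carrier RG" "f' \<in> carrier RG"
  shows "lin T \<rho> c (f \<oplus>\<^bsub>RG\<^esub> f') = lin T \<rho> c f \<oplus>\<^bsub>T\<^esub> lin T \<rho> c f'"
proof -
  let ?S = "supp f \<union> supp f'"
  have closed: "\<rho> (f1 g) \<otimes>\<^bsub>T\<^esub> c g \<in> carrier T" if "f1 \<in> carrier RG" "g \<in> carrier G" for f1 g
    using that c by (intro T.m_closed ring_hom_closed[OF \<rho>]) auto
  have "lin T \<rho> c (f \<oplus>\<^bsub>RG\<^esub> f') = (\<Oplus>\<^bsub>T\<^esub>g\<in>?S. \<rho> ((f \<oplus>\<^bsub>RG\<^esub> f') g) \<otimes>\<^bsub>T\<^esub> c g)"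
    using f by (intro lin_superset) auto
  also have "\<dots> = (\<Oplus>\<^bsub>T\<^esub>g\<in>?S. \<rho> (f g) \<otimes>\<^bsub>T\<^esub> c g \<oplus>\<^bsub>T\<^esub> \<rho> (f' g) \<otimes>\<^bsub>T\<^esub> c g)"
    using f c by (intro T.finsum_cong')
      (auto simp: ring_hom_add[OF \<rho>] ring_hom_closed[OF \<rho>] closed T.l_distr funcset_mem[OF c])
  also have "\<dots> = (\<Oplus>\<^bsub>T\<^esub>g\<in>?S. \<rho> (f g) \<otimes>\<^bsub>T\<^esub> c g) \<oplus>\<^bsub>T\<^esub> (\<Oplus>\<^bsub>T\<^esub>g\<in>?S. \<rho> (f' g) \<otimes>\<^bsub>T\<^esub> c g)"
    using f by (intro T.finsum_addf) (auto simp: closed)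
  also have "\<dots> = lin T \<rho> c f \<oplus>\<^bsub>T\<^esub> lin T \<rho> c f'"
    using f by (intro arg_cong2[where f="\<lambda>u v. u \<oplus>\<^bsub>T\<^esub> v"] lin_superset[symmetric]) auto
  finally show ?thesis .
qed

lemma lin_smult:
  assumes r: "r \<in> carrier R" and f: "f \<in> carrier RG"
  shows "lin T \<rho> c (r \<odot>\<^bsub>RG\<^esub> f) = \<rho> r \<otimes>\<^bsub>T\<^esub> lin T \<rho> c f"
  using f
proof (induction f rule: elem_induct)
  case (single s g)
  then show ?case using r
    by (simp add: smult_gsingle lin_gsingle ring_hom_mult[OF \<rho>] T.m_assoc rho_closed c_closed)
next
  case (add f f')
  then show ?case using r
    by (simp add: smult_add lin_add smult_mem T.r_distr ring_hom_closed[OF \<rho>])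
qed

end

text \<open>Universal property of the group algebra. Since \<open>T\<close> may be noncommutative,
  the images of scalars must commute with those of group elements; by biadditivity only products of
  two monomials have to be checked, and there one such exchange is made.\<close>

theorem lin_ring_hom:
  assumes T: "ring T" and \<rho>: "\<rho> \<in> ring_hom R T" and c: "c \<in> hom G (units_of T)"
    and central: "\<And>r g. r \<in> carrier R \<Longrightarrow> g \<in> carrier G \<Longrightarrow> \<rho> r \<otimes>\<^bsub>T\<^esub> c g = c g \<otimes>\<^bsub>T\<^esub> \<rho> r"
  shows "lin T \<rho> c \<in> ring_hom RG T"
proof -
  interpret T: ring T by (rule T)
  interpret c: group_hom G "units_of T" c
    by (intro group_hom.intro group_hom_axioms.intro G.is_group T.units_group c)
  have cT: "c \<in> carrier G \<rightarrow> carrier T"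
    using c by (auto simp: hom_def units_of_carrier)
  note lin = lin_gsingle[OF T \<rho> cT] lin_add[OF T \<rho> cT] lin_closed[OF T \<rho> cT]
  have c_mult: "c (g \<otimes>\<^bsub>G\<^esub> k) = c g \<otimes>\<^bsub>T\<^esub> c k" if "g \<in> carrier G" "k \<in> carrier G" for g k
    using hom_mult[OF c that] by (simp add: units_of_mult)
  have \<rho>_closed: "\<rho> r \<in> carrier T" if "r \<in> carrier R" for r using ring_hom_closed[OF \<rho> that] .
  note cT' = funcset_mem[OF cT]
  show ?thesis
  proof (rule ring_hom_memI)
    fix f f' assume f: "f \<in> carrier RG" and f': "f' \<in> carrier RG"
    show "lin T \<rho> c (f \<otimes>\<^bsub>RG\<^esub> f') = lin T \<rho> c f \<otimes>\<^bsub>T\<^esub> lin T \<rho> c f'"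
      using f
    proof (induction f rule: elem_induct)
      case (single r g)
      show ?case using f'
      proof (induction f' rule: elem_induct)
        case (single s k)
        have "\<rho> r \<otimes>\<^bsub>T\<^esub> \<rho> s \<otimes>\<^bsub>T\<^esub> (c g \<otimes>\<^bsub>T\<^esub> c k) = \<rho> r \<otimes>\<^bsub>T\<^esub> (\<rho> s \<otimes>\<^bsub>T\<^esub> c g) \<otimes>\<^bsub>T\<^esub> c k"
          using single \<open>r \<in> carrier R\<close> \<open>g \<in> carrier G\<close> by (simp add: T.m_assoc \<rho>_closed cT')
        also have "\<dots> = \<rho> r \<otimes>\<^bsub>T\<^esub> c g \<otimes>\<^bsub>T\<^esub> (\<rho> s \<otimes>\<^bsub>T\<^esub> c k)"
          unfolding central[OF single(1) \<open>g \<in> carrier G\<close>]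
          using single \<open>r \<in> carrier R\<close> \<open>g \<in> carrier G\<close> by (simp add: T.m_assoc \<rho>_closed cT')
        finally show ?case using single \<open>r \<in> carrier R\<close> \<open>g \<in> carrier G\<close>
          by (simp add: gsingle_mult lin ring_hom_mult[OF \<rho>] units_of_mult)
      next
        case (add f f')
        then show ?case using \<open>r \<in> carrier R\<close> \<open>g \<in> carrier G\<close>
          by (simp add: RG.r_distr lin T.r_distr \<rho>_closed cT')
      qed
    next
      case (add f1 f2)
      then show ?case using f' by (simp add: RG.l_distr lin T.l_distr \<rho>_closed cT')
    qed
  next
    show "lin T \<rho> c \<one>\<^bsub>RG\<^esub> = \<one>\<^bsub>T\<^esub>"
      using c.hom_one by (simp add: one_eq lin ring_hom_one[OF \<rho>] units_of_one)
  qed (simp_all add: lin)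
qed

end

section \<open>The two presentations\<close>

text \<open>
  The relations common to both groups, without inverses, so that they also make sense in a ring.
  Given the first two of them, \<open>y x = x y z\<close> defines an element \<open>z\<close> that commutes with \<open>x y\<close>
  and the third says \<open>z ^ (2 ^ l) = 1\<close>.
\<close>

definition almost_dihedral :: "('g, 'h) monoid_scheme \<Rightarrow> nat \<Rightarrow> 'g \<Rightarrow> 'g \<Rightarrow> bool" where
  "almost_dihedral Q l x y \<longleftrightarrow>
     x \<otimes>\<^bsub>Q\<^esub> x \<otimes>\<^bsub>Q\<^esub> y = y \<otimes>\<^bsub>Q\<^esub> (x \<otimes>\<^bsub>Q\<^esub> x) \<and>
     y \<otimes>\<^bsub>Q\<^esub> y \<otimes>\<^bsub>Q\<^esub> x = x \<otimes>\<^bsub>Q\<^esub> (y \<otimes>\<^bsub>Q\<^esub> y) \<and>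
     (y \<otimes>\<^bsub>Q\<^esub> x) [^]\<^bsub>Q\<^esub> ((2::nat) ^ l) = (x \<otimes>\<^bsub>Q\<^esub> y) [^]\<^bsub>Q\<^esub> ((2::nat) ^ l)"

section \<open>The commutator relations without inverses\<close>

context group
begin

text \<open>After left multiplication by x y every x y z can be replaced by y x. What remains is y
  x^2 = x^2 y in the first case, once a final z is cancelled, and y^2 x = x y^2 in the
  second.\<close>

lemma squares_central_iff:
  assumes [simp]: "x \<in> carrier G" "y \<in> carrier G" "z \<in> carrier G" and z: "y \<otimes> x = x \<otimes> y \<otimes> z"
  shows "x \<otimes> x \<otimes> y = y \<otimes> (x \<otimes> x) \<longleftrightarrow> z \<otimes> x \<otimes> z = x"
    and "y \<otimes> y \<otimes> x = x \<otimes> (y \<otimes> y) \<longleftrightarrow> z \<otimes> y \<otimes> z = y"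
proof -
  have "z \<otimes> x \<otimes> z = x \<longleftrightarrow> x \<otimes> y \<otimes> (z \<otimes> x \<otimes> z) = x \<otimes> y \<otimes> x" by simp
  also have "x \<otimes> y \<otimes> (z \<otimes> x \<otimes> z) = x \<otimes> y \<otimes> z \<otimes> x \<otimes> z" by (simp add: m_assoc)
  also have "\<dots> = y \<otimes> x \<otimes> x \<otimes> z" by (simp only: z)
  also have "x \<otimes> y \<otimes> x = x \<otimes> (x \<otimes> y \<otimes> z)" unfolding z[symmetric] by (simp add: m_assoc)
  also have "\<dots> = x \<otimes> x \<otimes> y \<otimes> z" by (simp add: m_assoc)
  also have "(y \<otimes> x \<otimes> x \<otimes> z = \<dots>) = (x \<otimes> x \<otimes> y = y \<otimes> (x \<otimes> x))"
    by (simp add: m_assoc[of y x x]) auto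
  finally show "x \<otimes> x \<otimes> y = y \<otimes> (x \<otimes> x) \<longleftrightarrow> z \<otimes> x \<otimes> z = x" by simp
  have "z \<otimes> y \<otimes> z = y \<longleftrightarrow> x \<otimes> y \<otimes> (z \<otimes> y \<otimes> z) = x \<otimes> y \<otimes> y" by simp
  also have "x \<otimes> y \<otimes> (z \<otimes> y \<otimes> z) = x \<otimes> y \<otimes> z \<otimes> y \<otimes> z" by (simp add: m_assoc)
  also have "\<dots> = y \<otimes> x \<otimes> y \<otimes> z" by (simp only: z)
  also have "\<dots> = y \<otimes> (x \<otimes> y \<otimes> z)" by (simp add: m_assoc)
  also have "\<dots> = y \<otimes> y \<otimes> x" unfolding z[symmetric] by (simp add: m_assoc)
  finally show "y \<otimes> y \<otimes> x = x \<otimes> (y \<otimes> y) \<longleftrightarrow> z \<otimes> y \<otimes> z = y" by (simp add: m_assoc)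
qed

text \<open>Both sides say that conjugation by x inverts z; the left one is the relation [z, x] =
  z^(-2).\<close>

lemma inverts_iff:
  assumes [simp]: "x \<in> carrier G" "z \<in> carrier G"
  shows "inv z \<otimes> (inv x \<otimes> (z \<otimes> x)) = inv (z \<otimes> z) \<longleftrightarrow> z \<otimes> x \<otimes> z = x"
proof -
  have "inv z \<otimes> (inv x \<otimes> (z \<otimes> x)) = inv (z \<otimes> z) \<longleftrightarrow> inv x \<otimes> (z \<otimes> x) = inv z"
    by (simp add: inv_mult_group)
  also have "\<dots> \<longleftrightarrow> z \<otimes> x = x \<otimes> inv z"
    using inv_solve_left[of "inv z" x "z \<otimes> x"] by (metis assms inv_closed m_closed)
  also have "\<dots> \<longleftrightarrow> z \<otimes> x \<otimes> z = x"
    using inv_solve_right[of "z \<otimes> x" x z] by (metis assms m_closed)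
  finally show ?thesis .
qed

text \<open>Conjugation by x and by y both inverts z, so z commutes with x y. Hence (y x)^k = (x
  y)^k z^k, and equality of the powers with exponent 2^l amounts to z^(2^l) = 1.\<close>

lemma almost_dihedral_iff:
  assumes [simp]: "x \<in> carrier G" "y \<in> carrier G" "z \<in> carrier G" and z: "y \<otimes> x = x \<otimes> y \<otimes> z"
  shows "almost_dihedral G l x y \<longleftrightarrow>
    z [^] ((2::nat) ^ l) = \<one> \<and> z \<otimes> x \<otimes> z = x \<and> z \<otimes> y \<otimes> z = y"
proof -
  have "(y \<otimes> x) [^] (k::nat) = (x \<otimes> y) [^] k \<otimes> z [^] k" if zx: "z \<otimes> x \<otimes> z = x" "z \<otimes> y \<otimes> z = y" for k
  proof -
    have "z \<otimes> x = x \<otimes> inv z" "z \<otimes> y = y \<otimes> inv z"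
      using zx inv_solve_right[of "z \<otimes> x" x z] inv_solve_right[of "z \<otimes> y" y z] by (metis assms(1-3) m_closed)+
    then have "inv z \<otimes> y = y \<otimes> z"
      by (metis assms(2,3) inv_closed inv_inv inv_solve_left inv_solve_right m_assoc m_closed)
    then have "x \<otimes> y \<otimes> z = z \<otimes> (x \<otimes> y)"
      using \<open>z \<otimes> x = x \<otimes> inv z\<close> by (metis assms(1-3) inv_closed m_assoc)
    then show ?thesis unfolding z by (intro pow_mult_distrib) auto
  qed
  then show ?thesis
    unfolding almost_dihedral_def squares_central_iff[OF assms] by auto
qed

end

section \<open>Evaluation of words and generation by letters\<close>

lemma weval_wgen: "group Q \<Longrightarrow> f a \<in> carrier Q \<Longrightarrow> weval Q f (wgen a) = f a"
  by (simp add: weval_def wgen_def group.is_monoid)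

lemma weval_wpow:
  assumes "group Q" "\<And>a. f a \<in> carrier Q"
  shows "weval Q f (wpow w k) = weval Q f w [^]\<^bsub>Q\<^esub> k"
proof -
  interpret group Q by fact
  have "weval Q f (wpow w (Suc k)) = weval Q f w \<otimes>\<^bsub>Q\<^esub> weval Q f (wpow w k)" for k
    by (simp add: wpow_def weval_append[OF assms])
  moreover have "weval Q f (wpow w 0) = \<one>\<^bsub>Q\<^esub>"
    by (simp add: wpow_def weval_def)
  ultimately show ?thesis
    by (induction k) (simp_all add: weval_closed[OF assms] nat_pow_Suc2[symmetric] del: nat_pow_Suc)
qed

lemma weval_winv:
  assumes "group Q" "\<And>a. f a \<in> carrier Q"
  shows "weval Q f (winv w) = inv\<^bsub>Q\<^esub> weval Q f w"
proof -
  interpret group Q by fact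
  \<comment> \<open>With the empty set of relations, congruence is free cancellation, which every
    evaluation respects.\<close>
  have "weval Q f (winv w @ w) = weval Q f []"
    by (rule weval_word_cong[where rels="{}"]) (auto simp: assms word_cong_winv_left)
  then have "weval Q f (winv w) \<otimes>\<^bsub>Q\<^esub> weval Q f w = \<one>\<^bsub>Q\<^esub>"
    by (simp add: weval_append[OF assms]) (simp add: weval_def)
  then show ?thesis
    by (simp add: inv_equality weval_closed[OF assms])
qed

lemma weval_wcomm:
  assumes "group Q" "\<And>a. f a \<in> carrier Q"
  shows "weval Q f (wcomm u v) = inv\<^bsub>Q\<^esub> weval Q f u \<otimes>\<^bsub>Q\<^esub> (inv\<^bsub>Q\<^esub> weval Q f v \<otimes>\<^bsub>Q\<^esub> (weval Q f u \<otimes>\<^bsub>Q\<^esub> weval Q f v))"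
  by (simp add: wcomm_def weval_append[OF assms] weval_winv[OF assms])

text \<open>Uniqueness of the induced homomorphism, applied to the identity map.\<close>

lemma weval_wclass:
  "weval (presented_group rels) (\<lambda>a. wclass rels (wgen a)) w = wclass rels w"
proof -
  have "(\<lambda>A. A) \<in> hom (presented_group rels) (presented_group rels)"
    by (auto simp: hom_def)
  from presented_group_hom_unique[OF group_presented_group _ this, of "\<lambda>a. wclass rels (wgen a)" w]
  show ?thesis by (simp add: presented_group_def)
qed

lemma presented_group_relation:
  "(u, v) \<in> rels \<Longrightarrow> weval (presented_group rels) (\<lambda>a. wclass rels (wgen a)) u =
     weval (presented_group rels) (\<lambda>a. wclass rels (wgen a)) v"
  unfolding weval_wclass wclass_eq_iff by (rule word_cong.relation)

lemma wclass_mem [simp]: "wclass rels u \<in> carrier (presented_group rels)"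
  by (simp add: presented_group_def)

text \<open>Generation by the letters, in the form in which it is used: \<open>S\<close> is the set
  of elements with some property, and only the generators have to be tested.\<close>

lemma presented_group_subgroup:
  assumes S: "subgroup S (presented_group rels)" and gen: "\<And>a. wclass rels (wgen a) \<in> S"
  shows "carrier (presented_group rels) = S"
proof
  interpret P: group "presented_group rels" by (rule group_presented_group)
  have "weval (presented_group rels) (\<lambda>a. wclass rels (wgen a)) w \<in> S" for w
    by (induction w) (auto simp: weval_def gen subgroup.one_closed[OF S]
        intro!: subgroup.m_closed[OF S] P.subgroupE(3)[OF S])
  then show "carrier (presented_group rels) \<subseteq> S"
    unfolding weval_wclass by (auto simp: presented_group_def)
qed (rule subgroup.subset[OF S])

section \<open>Both groups as groups on two generators\<close>

definition rels_G :: "nat \<Rightarrow> nat \<Rightarrow> nat \<Rightarrow> (gen_G gword \<times> gen_G gword) set" where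
  "rels_G n m l =
     {(wpow (wgen Gx) (2 ^ n), []), (wpow (wgen Gy) (2 ^ m), []), (wpow (wgen Gz) (2 ^ l), []),
      (wcomm (wgen Gy) (wgen Gx), wgen Gz),
      (wcomm (wgen Gz) (wgen Gx), winv (wpow (wgen Gz) 2)),
      (wcomm (wgen Gz) (wgen Gy), winv (wpow (wgen Gz) 2))}"

definition rels_H :: "nat \<Rightarrow> nat \<Rightarrow> nat \<Rightarrow> (gen_H gword \<times> gen_H gword) set" where
  "rels_H n m l =
     {(wpow (wgen Ha) (2 ^ n), []), (wpow (wgen Hb) (2 ^ m), wpow (wgen Ha) (2 ^ m)),
      (wpow (wgen Hc) (2 ^ l), []),
      (wcomm (wgen Hb) (wgen Ha), wgen Hc),
      (wcomm (wgen Hc) (wgen Ha), winv (wpow (wgen Hc) 2)),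
      (wcomm (wgen Hc) (wgen Hb), winv (wpow (wgen Hc) 2))}"

lemma rels_G_mem:
  "(wpow (wgen Gx) (2 ^ n), []) \<in> rels_G n m l" "(wpow (wgen Gy) (2 ^ m), []) \<in> rels_G n m l"
  "(wpow (wgen Gz) (2 ^ l), []) \<in> rels_G n m l" "(wcomm (wgen Gy) (wgen Gx), wgen Gz) \<in> rels_G n m l"
  "(wcomm (wgen Gz) (wgen Gx), winv (wpow (wgen Gz) 2)) \<in> rels_G n m l"
  "(wcomm (wgen Gz) (wgen Gy), winv (wpow (wgen Gz) 2)) \<in> rels_G n m l"
  by (simp_all add: rels_G_def)

lemma rels_H_mem:
  "(wpow (wgen Ha) (2 ^ n), []) \<in> rels_H n m l" "(wpow (wgen Hb) (2 ^ m), wpow (wgen Ha) (2 ^ m)) \<in> rels_H n m l"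
  "(wpow (wgen Hc) (2 ^ l), []) \<in> rels_H n m l" "(wcomm (wgen Hb) (wgen Ha), wgen Hc) \<in> rels_H n m l"
  "(wcomm (wgen Hc) (wgen Ha), winv (wpow (wgen Hc) 2)) \<in> rels_H n m l"
  "(wcomm (wgen Hc) (wgen Hb), winv (wpow (wgen Hc) 2)) \<in> rels_H n m l"
  by (simp_all add: rels_H_def)

lemma group_G_eq: "group_G n m l = presented_group (rels_G n m l)"
  by (simp add: group_G_def rels_G_def Let_def)

lemma group_H_eq: "group_H n m l = presented_group (rels_H n m l)"
  by (simp add: group_H_def rels_H_def Let_def)

lemma group_group_G: "group (group_G n m l)"
  by (simp add: group_G_eq group_presented_group)

lemma group_group_H: "group (group_H n m l)"
  by (simp add: group_H_eq group_presented_group)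

definition G_x where "G_x n m l = wclass (rels_G n m l) (wgen Gx)"
definition G_y where "G_y n m l = wclass (rels_G n m l) (wgen Gy)"
definition H_a where "H_a n m l = wclass (rels_H n m l) (wgen Ha)"
definition H_b where "H_b n m l = wclass (rels_H n m l) (wgen Hb)"

lemma (in group) comm_relation:
  assumes [simp]: "x \<in> carrier G" "y \<in> carrier G" "z \<in> carrier G"
  shows "inv y \<otimes> (inv x \<otimes> (y \<otimes> x)) = z \<longleftrightarrow> y \<otimes> x = x \<otimes> y \<otimes> z"
proof -
  have "inv y \<otimes> (inv x \<otimes> (y \<otimes> x)) = inv (x \<otimes> y) \<otimes> (y \<otimes> x)"
    by (simp add: inv_mult_group m_assoc)
  then show ?thesis
    using inv_solve_left[of z "x \<otimes> y" "y \<otimes> x"] by (metis assms m_closed)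
qed

lemma (in group) pow_two: "z \<in> carrier G \<Longrightarrow> z [^] (2::nat) = z \<otimes> z"
  by (simp add: numeral_2_eq_2)

context
  fixes n m l :: nat
begin

interpretation G: group "group_G n m l" by (rule group_group_G)
interpretation H: group "group_H n m l" by (rule group_group_H)

lemma G_gens_mem [simp]: "G_x n m l \<in> carrier (group_G n m l)" "G_y n m l \<in> carrier (group_G n m l)"
  by (simp_all add: G_x_def G_y_def group_G_eq)

lemma H_gens_mem [simp]: "H_a n m l \<in> carrier (group_H n m l)" "H_b n m l \<in> carrier (group_H n m l)"
  by (simp_all add: H_a_def H_b_def group_H_eq)

text \<open>The last equation makes the third generator a word in the other two; together with
  \<open>almost_dihedral\<close> it allows all later arguments to mention only x and y.\<close>

lemma G_relations:
  defines "G \<equiv> group_G n m l" and "x \<equiv> G_x n m l" and "y \<equiv> G_y n m l"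
    and "z \<equiv> wclass (rels_G n m l) (wgen Gz)"
  shows "x [^]\<^bsub>G\<^esub> ((2::nat) ^ n) = \<one>\<^bsub>G\<^esub>" "y [^]\<^bsub>G\<^esub> ((2::nat) ^ m) = \<one>\<^bsub>G\<^esub>"
    "almost_dihedral G l x y" "inv\<^bsub>G\<^esub> y \<otimes>\<^bsub>G\<^esub> (inv\<^bsub>G\<^esub> x \<otimes>\<^bsub>G\<^esub> (y \<otimes>\<^bsub>G\<^esub> x)) = z"
proof -
  let ?f = "\<lambda>g. wclass (rels_G n m l) (wgen g)"
  interpret Q: group G unfolding G_def by (rule group_group_G)
  have f: "?f g \<in> carrier G" for g by (simp add: G_def group_G_eq)
  have [simp]: "x \<in> carrier G" "y \<in> carrier G" "z \<in> carrier G"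
    using f by (auto simp: x_def y_def z_def G_x_def G_y_def)
  have gens: "?f Gx = x" "?f Gy = y" "?f Gz = z"
    by (simp_all add: x_def y_def z_def G_x_def G_y_def)
  note rel = rels_G_mem[THEN presented_group_relation, of n m l, folded group_G_eq G_def]
  note ev = weval_wgen[OF Q.is_group] weval_wpow[OF Q.is_group f]
    weval_winv[OF Q.is_group f] weval_wcomm[OF Q.is_group f]
  have nil: "weval G ?f [] = \<one>\<^bsub>G\<^esub>" by (simp add: weval_def)
  note rel = rel[unfolded ev(2-4) nil, unfolded ev(1)[of ?f, OF f] gens]
  show "x [^]\<^bsub>G\<^esub> ((2::nat) ^ n) = \<one>\<^bsub>G\<^esub>" "y [^]\<^bsub>G\<^esub> ((2::nat) ^ m) = \<one>\<^bsub>G\<^esub>"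
    by (fact rel)+
  show yx: "inv\<^bsub>G\<^esub> y \<otimes>\<^bsub>G\<^esub> (inv\<^bsub>G\<^esub> x \<otimes>\<^bsub>G\<^esub> (y \<otimes>\<^bsub>G\<^esub> x)) = z"
    by (fact rel)
  show "almost_dihedral G l x y"
    using Q.almost_dihedral_iff[of x y z l] Q.comm_relation[of x y z] yx rel(3)
      rel(5,6)[unfolded Q.pow_two[OF \<open>z \<in> carrier G\<close>]] Q.inverts_iff[of x z] Q.inverts_iff[of y z]
    by (metis \<open>x \<in> carrier G\<close> \<open>y \<in> carrier G\<close> \<open>z \<in> carrier G\<close>)
qed

lemma H_relations:
  defines "H \<equiv> group_H n m l" and "a \<equiv> H_a n m l" and "b \<equiv> H_b n m l"
    and "c \<equiv> wclass (rels_H n m l) (wgen Hc)"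
  shows "a [^]\<^bsub>H\<^esub> ((2::nat) ^ n) = \<one>\<^bsub>H\<^esub>" "b [^]\<^bsub>H\<^esub> ((2::nat) ^ m) = a [^]\<^bsub>H\<^esub> ((2::nat) ^ m)"
    "almost_dihedral H l a b" "inv\<^bsub>H\<^esub> b \<otimes>\<^bsub>H\<^esub> (inv\<^bsub>H\<^esub> a \<otimes>\<^bsub>H\<^esub> (b \<otimes>\<^bsub>H\<^esub> a)) = c"
proof -
  let ?f = "\<lambda>g. wclass (rels_H n m l) (wgen g)"
  interpret Q: group H unfolding H_def by (rule group_group_H)
  have f: "?f g \<in> carrier H" for g by (simp add: H_def group_H_eq)
  have [simp]: "a \<in> carrier H" "b \<in> carrier H" "c \<in> carrier H"
    using f by (auto simp: a_def b_def c_def H_a_def H_b_def)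
  have gens: "?f Ha = a" "?f Hb = b" "?f Hc = c"
    by (simp_all add: a_def b_def c_def H_a_def H_b_def)
  note rel = rels_H_mem[THEN presented_group_relation, of n m l, folded group_H_eq H_def]
  note ev = weval_wgen[OF Q.is_group] weval_wpow[OF Q.is_group f]
    weval_winv[OF Q.is_group f] weval_wcomm[OF Q.is_group f]
  have nil: "weval H ?f [] = \<one>\<^bsub>H\<^esub>" by (simp add: weval_def)
  note rel = rel[unfolded ev(2-4) nil, unfolded ev(1)[of ?f, OF f] gens]
  show "a [^]\<^bsub>H\<^esub> ((2::nat) ^ n) = \<one>\<^bsub>H\<^esub>" "b [^]\<^bsub>H\<^esub> ((2::nat) ^ m) = a [^]\<^bsub>H\<^esub> ((2::nat) ^ m)"
    by (fact rel)+
  show ba: "inv\<^bsub>H\<^esub> b \<otimes>\<^bsub>H\<^esub> (inv\<^bsub>H\<^esub> a \<otimes>\<^bsub>H\<^esub> (b \<otimes>\<^bsub>H\<^esub> a)) = c"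
    by (fact rel)
  show "almost_dihedral H l a b"
    using Q.almost_dihedral_iff[of a b c l] Q.comm_relation[of a b c] ba rel(3)
      rel(5,6)[unfolded Q.pow_two[OF \<open>c \<in> carrier H\<close>]] Q.inverts_iff[of a c] Q.inverts_iff[of b c]
    by (metis \<open>a \<in> carrier H\<close> \<open>b \<in> carrier H\<close> \<open>c \<in> carrier H\<close>)
qed

lemma G_subgroup:
  assumes S: "subgroup S (group_G n m l)" and "G_x n m l \<in> S" "G_y n m l \<in> S"
  shows "carrier (group_G n m l) = S"
proof -
  have "wclass (rels_G n m l) (wgen a) \<in> S" for a
  proof (cases a)
    case Gz
    have "inv\<^bsub>group_G n m l\<^esub> G_y n m l \<otimes>\<^bsub>group_G n m l\<^esub> (inv\<^bsub>group_G n m l\<^esub> G_x n m l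
        \<otimes>\<^bsub>group_G n m l\<^esub> (G_y n m l \<otimes>\<^bsub>group_G n m l\<^esub> G_x n m l)) \<in> S"
      using assms by (intro subgroup.m_closed[OF S] G.subgroupE(3)[OF S])
    then show ?thesis unfolding G_relations(4) Gz .
  qed (use assms in \<open>simp_all add: G_x_def G_y_def\<close>)
  then show ?thesis
    using S unfolding group_G_eq by (intro presented_group_subgroup)
qed

lemma H_subgroup:
  assumes S: "subgroup S (group_H n m l)" and "H_a n m l \<in> S" "H_b n m l \<in> S"
  shows "carrier (group_H n m l) = S"
proof -
  have "wclass (rels_H n m l) (wgen a) \<in> S" for a
  proof (cases a)
    case Hc
    have "inv\<^bsub>group_H n m l\<^esub> H_b n m l \<otimes>\<^bsub>group_H n m l\<^esub> (inv\<^bsub>group_H n m l\<^esub> H_a n m l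
        \<otimes>\<^bsub>group_H n m l\<^esub> (H_b n m l \<otimes>\<^bsub>group_H n m l\<^esub> H_a n m l)) \<in> S"
      using assms by (intro subgroup.m_closed[OF S] H.subgroupE(3)[OF S])
    then show ?thesis unfolding H_relations(4) Hc .
  qed (use assms in \<open>simp_all add: H_a_def H_b_def\<close>)
  then show ?thesis
    using S unfolding group_H_eq by (intro presented_group_subgroup)
qed

text \<open>Two-generator form of von Dyck's theorem. The image of the third generator is chosen as
  the commutator, so [y, x] = z holds by construction, and the remaining relations on z come from
  \<open>almost_dihedral_iff\<close>.\<close>

lemma G_hom_exists:
  assumes Q: "group Q" and [simp]: "x \<in> carrier Q" "y \<in> carrier Q"
    and "x [^]\<^bsub>Q\<^esub> ((2::nat) ^ n) = \<one>\<^bsub>Q\<^esub>" "y [^]\<^bsub>Q\<^esub> ((2::nat) ^ m) = \<one>\<^bsub>Q\<^esub>" "almost_dihedral Q l x y"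
  shows "\<exists>\<phi> \<in> hom (group_G n m l) Q. \<phi> (G_x n m l) = x \<and> \<phi> (G_y n m l) = y"
proof -
  interpret Q: group Q by fact
  define z where "z = inv\<^bsub>Q\<^esub> y \<otimes>\<^bsub>Q\<^esub> (inv\<^bsub>Q\<^esub> x \<otimes>\<^bsub>Q\<^esub> (y \<otimes>\<^bsub>Q\<^esub> x))"
  have [simp]: "z \<in> carrier Q" by (simp add: z_def)
  have z: "y \<otimes>\<^bsub>Q\<^esub> x = x \<otimes>\<^bsub>Q\<^esub> y \<otimes>\<^bsub>Q\<^esub> z"
    using Q.comm_relation[of x y z] by (simp add: z_def)
  define f where "f a = (case a of Gx \<Rightarrow> x | Gy \<Rightarrow> y | Gz \<Rightarrow> z)" for a
  have f: "f a \<in> carrier Q" for a by (simp add: f_def split: gen_G.split)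
  have gens: "f Gx = x" "f Gy = y" "f Gz = z" by (simp_all add: f_def)
  have nil: "weval Q f [] = \<one>\<^bsub>Q\<^esub>" by (simp add: weval_def)
  note ev = weval_wgen[OF Q] weval_wpow[OF Q f] weval_winv[OF Q f] weval_wcomm[OF Q f]
  have "weval Q f u = weval Q f v" if "(u, v) \<in> rels_G n m l" for u v
    using that assms(4-) unfolding Q.almost_dihedral_iff[OF assms(2,3) \<open>z \<in> carrier Q\<close> z]
    by (auto simp: rels_G_def ev f nil Q.pow_two gens Q.inverts_iff z_def[symmetric])
  from presented_group_universal[OF Q f this]
  show ?thesis unfolding group_G_eq G_x_def G_y_def using gens by metis
qed

lemma H_hom_exists:
  assumes Q: "group Q" and [simp]: "x \<in> carrier Q" "y \<in> carrier Q"
    and "x [^]\<^bsub>Q\<^esub> ((2::nat) ^ n) = \<one>\<^bsub>Q\<^esub>" "y [^]\<^bsub>Q\<^esub> ((2::nat) ^ m) = x [^]\<^bsub>Q\<^esub> ((2::nat) ^ m)"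
      "almost_dihedral Q l x y"
  shows "\<exists>\<phi> \<in> hom (group_H n m l) Q. \<phi> (H_a n m l) = x \<and> \<phi> (H_b n m l) = y"
proof -
  interpret Q: group Q by fact
  define z where "z = inv\<^bsub>Q\<^esub> y \<otimes>\<^bsub>Q\<^esub> (inv\<^bsub>Q\<^esub> x \<otimes>\<^bsub>Q\<^esub> (y \<otimes>\<^bsub>Q\<^esub> x))"
  have [simp]: "z \<in> carrier Q" by (simp add: z_def)
  have z: "y \<otimes>\<^bsub>Q\<^esub> x = x \<otimes>\<^bsub>Q\<^esub> y \<otimes>\<^bsub>Q\<^esub> z"
    using Q.comm_relation[of x y z] by (simp add: z_def)
  define f where "f a = (case a of Ha \<Rightarrow> x | Hb \<Rightarrow> y | Hc \<Rightarrow> z)" for a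
  have f: "f a \<in> carrier Q" for a by (simp add: f_def split: gen_H.split)
  have gens: "f Ha = x" "f Hb = y" "f Hc = z" by (simp_all add: f_def)
  have nil: "weval Q f [] = \<one>\<^bsub>Q\<^esub>" by (simp add: weval_def)
  note ev = weval_wgen[OF Q] weval_wpow[OF Q f] weval_winv[OF Q f] weval_wcomm[OF Q f]
  have "weval Q f u = weval Q f v" if "(u, v) \<in> rels_H n m l" for u v
    using that assms(4-) unfolding Q.almost_dihedral_iff[OF assms(2,3) \<open>z \<in> carrier Q\<close> z]
    by (auto simp: rels_H_def ev f nil Q.pow_two gens Q.inverts_iff z_def[symmetric])
  from presented_group_universal[OF Q f this]
  show ?thesis unfolding group_H_eq H_a_def H_b_def using gens by metis
qed

end

text \<open>Combined with the generation lemmas this shows that homomorphisms which agree on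
  generators agree everywhere.\<close>

lemma hom_eq_on_subgroup:
  assumes "group Q" "group M" "h1 \<in> hom Q M" "h2 \<in> hom Q M"
  shows "subgroup {g \<in> carrier Q. h1 g = h2 g} Q"
proof -
  interpret Q: group Q by fact
  interpret h1: group_hom Q M h1 using assms by (simp add: group_hom_def group_hom_axioms_def)
  interpret h2: group_hom Q M h2 using assms by (simp add: group_hom_def group_hom_axioms_def)
  show ?thesis by (rule Q.subgroupI) auto
qed

section \<open>Characteristic two\<close>

context ring
begin

lemma char_two_double:
  assumes "\<one> \<oplus> \<one> = \<zero>" "a \<in> carrier R"
  shows "a \<oplus> a = \<zero>"
proof -
  have "a \<oplus> a = (\<one> \<oplus> \<one>) \<otimes> a" using assms(2) by (simp only: l_distr one_closed l_one)
  then show ?thesis using assms by simp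
qed

text \<open>The two cross terms are equal and cancel. Commutation is demanded of the pair and not of
  the ring, because the lemma is applied inside noncommutative group algebras.\<close>

lemma frobenius_commuting:
  assumes "\<one> \<oplus> \<one> = \<zero>" and [simp]: "a \<in> carrier R" "b \<in> carrier R" and ab: "a \<otimes> b = b \<otimes> a"
  shows "(a \<oplus> b) [^] ((2::nat) ^ k) = a [^] ((2::nat) ^ k) \<oplus> b [^] ((2::nat) ^ k)"
proof (induction k)
  case (Suc k)
  let ?a = "a [^] ((2::nat) ^ k)" and ?b = "b [^] ((2::nat) ^ k)"
  have double: "c [^] ((2::nat) ^ Suc k) = c [^] ((2::nat) ^ k) \<otimes> c [^] ((2::nat) ^ k)" if "c \<in> carrier R" for c
    using that by (simp add: nat_pow_mult mult_2)
  have "?a \<otimes> b = b \<otimes> ?a" using ab by (simp add: group_commutes_pow)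
  then have comm: "?a \<otimes> ?b = ?b \<otimes> ?a" using group_commutes_pow[of b ?a] by simp
  have "(a \<oplus> b) [^] ((2::nat) ^ Suc k) = (?a \<oplus> ?b) \<otimes> (?a \<oplus> ?b)"
    using Suc by (simp only: double add.m_closed assms)
  also have "\<dots> = ?a \<otimes> ?a \<oplus> (?b \<otimes> ?a \<oplus> ?b \<otimes> ?a) \<oplus> ?b \<otimes> ?b"
    using comm by (simp add: l_distr r_distr a_ac)
  also have "\<dots> = ?a \<otimes> ?a \<oplus> ?b \<otimes> ?b"
    using char_two_double[OF assms(1)] by simp
  finally show ?case by (simp only: double assms)
qed simp

lemma nat_pow_pow_two: "a \<in> carrier R \<Longrightarrow> (a \<otimes> a) [^] ((2::nat) ^ k) = a [^] ((2::nat) ^ Suc k)"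
  by (simp add: nat_pow_mult[symmetric] pow_mult_distrib mult_2)

text \<open>
  With \<open>t = x y + y x\<close> one has \<open>(1 + x + y)\<^sup>2 = 1 + x\<^sup>2 + y\<^sup>2 + t\<close>, and \<open>t\<close> is nilpotent and commutes
  with \<open>x\<close> and \<open>y\<close>.
\<close>

lemma almost_dihedral_char_two:
  assumes two: "\<one> \<oplus> \<one> = \<zero>" and [simp]: "x \<in> carrier R" "y \<in> carrier R"
    and xy: "almost_dihedral R l x y"
  defines "b \<equiv> \<one> \<oplus> x \<oplus> y"
  shows "almost_dihedral R l x b"
    and "l < m \<Longrightarrow> b [^] ((2::nat) ^ m) = \<one> \<oplus> x [^] ((2::nat) ^ m) \<oplus> y [^] ((2::nat) ^ m)"
proof -
  define t where "t = x \<otimes> y \<oplus> y \<otimes> x"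
  have [simp]: "t \<in> carrier R" "b \<in> carrier R" by (simp_all add: t_def b_def)
  note double = char_two_double[OF two]
  have double': "c \<oplus> (c \<oplus> d) = d" if "c \<in> carrier R" "d \<in> carrier R" for c d
    using that double[of c] by (simp add: a_assoc[symmetric])
  have xx: "x \<otimes> x \<otimes> y = y \<otimes> (x \<otimes> x)" and yy: "y \<otimes> y \<otimes> x = x \<otimes> (y \<otimes> y)"
    and pow: "(y \<otimes> x) [^] ((2::nat) ^ l) = (x \<otimes> y) [^] ((2::nat) ^ l)"
    using xy by (simp_all add: almost_dihedral_def)
  \<comment> \<open>Both sides are x y x plus a product of x^2 and y, and x^2 commutes with
    y.\<close>
  have tx: "t \<otimes> x = x \<otimes> t"
    using xx by (simp add: t_def l_distr r_distr m_assoc a_comm)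
  have ty: "t \<otimes> y = y \<otimes> t"
    using yy by (simp add: t_def l_distr r_distr m_assoc a_comm)
  \<comment> \<open>The products x y y x and y x x y both equal x^2 y^2, so x y and y x commute and
    Frobenius applies to t.\<close>
  have "x \<otimes> y \<otimes> (y \<otimes> x) = x \<otimes> (y \<otimes> y \<otimes> x)" by (simp add: m_assoc)
  also have "\<dots> = x \<otimes> x \<otimes> y \<otimes> y" unfolding yy by (simp add: m_assoc)
  also have "\<dots> = y \<otimes> x \<otimes> (x \<otimes> y)" unfolding xx by (simp add: m_assoc)
  finally have "t [^] ((2::nat) ^ l) = (x \<otimes> y) [^] ((2::nat) ^ l) \<oplus> (y \<otimes> x) [^] ((2::nat) ^ l)"
    unfolding t_def by (intro frobenius_commuting[OF two]) simp_all
  then have t_nil: "t [^] ((2::nat) ^ l) = \<zero>"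
    unfolding pow by (simp add: double)
  have bb: "b \<otimes> b = \<one> \<oplus> x \<otimes> x \<oplus> y \<otimes> y \<oplus> t"
    by (simp add: b_def t_def l_distr r_distr a_ac double double')
  \<comment> \<open>Replacing y by b keeps the same t: b x and x b differ by it. Since t commutes
    with x b, their powers with exponent 2^l differ by t^(2^l) = 0.\<close>
  have bx: "b \<otimes> x = x \<otimes> b \<oplus> t"
    by (simp add: b_def t_def l_distr r_distr a_ac double double')
  have t_xb: "x \<otimes> b \<otimes> t = t \<otimes> (x \<otimes> b)"
  proof -
    have "b \<otimes> t = t \<otimes> b" using tx ty by (simp add: b_def l_distr r_distr)
    then show ?thesis using tx by (metis \<open>b \<in> carrier R\<close> \<open>t \<in> carrier R\<close> assms(2) m_assoc)
  qed
  show "almost_dihedral R l x b"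
    unfolding almost_dihedral_def
  proof (intro conjI)
    show "x \<otimes> x \<otimes> b = b \<otimes> (x \<otimes> x)"
      using xx by (simp add: b_def l_distr r_distr m_assoc)
    show "b \<otimes> b \<otimes> x = x \<otimes> (b \<otimes> b)"
      unfolding bb using yy tx by (simp add: l_distr r_distr m_assoc)
    show "(b \<otimes> x) [^] ((2::nat) ^ l) = (x \<otimes> b) [^] ((2::nat) ^ l)"
      unfolding bx using t_xb by (subst frobenius_commuting[OF two]) (simp_all add: t_nil)
  qed
  show "b [^] ((2::nat) ^ m) = \<one> \<oplus> x [^] ((2::nat) ^ m) \<oplus> y [^] ((2::nat) ^ m)" if "l < m"
  proof -
    \<comment> \<open>The first squaring, which produces t, uses up one factor 2 of the exponent; as
      m > l, the remaining k = m - 1 is still at least l and t^(2^k) vanishes.\<close>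
    from that obtain k where m: "m = Suc k" and "l \<le> k" by (cases m) auto
    have "t [^] ((2::nat) ^ k) = (t [^] ((2::nat) ^ l)) [^] ((2::nat) ^ (k - l))"
      using \<open>l \<le> k\<close> by (simp add: nat_pow_pow power_add[symmetric])
    then have t_nil': "t [^] ((2::nat) ^ k) = \<zero>" by (simp add: t_nil nat_pow_zero)
    have txx: "x \<otimes> x \<otimes> t = t \<otimes> (x \<otimes> x)" and tyy: "y \<otimes> y \<otimes> t = t \<otimes> (y \<otimes> y)"
      using tx ty by (metis assms(2,3) \<open>t \<in> carrier R\<close> m_assoc)+
    have xxyy: "x \<otimes> x \<otimes> (y \<otimes> y) = y \<otimes> y \<otimes> (x \<otimes> x)"
      using xx by (metis assms(2,3) m_assoc m_closed)
    have "b [^] ((2::nat) ^ m) = (\<one> \<oplus> x \<otimes> x \<oplus> y \<otimes> y \<oplus> t) [^] ((2::nat) ^ k)"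
      unfolding m bb[symmetric] by (simp add: nat_pow_pow_two)
    also have "\<dots> = (\<one> \<oplus> x \<otimes> x \<oplus> y \<otimes> y) [^] ((2::nat) ^ k) \<oplus> t [^] ((2::nat) ^ k)"
      using txx tyy by (intro frobenius_commuting[OF two]) (simp_all add: l_distr r_distr)
    also have "(\<one> \<oplus> x \<otimes> x \<oplus> y \<otimes> y) [^] ((2::nat) ^ k) = (\<one> \<oplus> x \<otimes> x) [^] ((2::nat) ^ k) \<oplus> (y \<otimes> y) [^] ((2::nat) ^ k)"
      using xxyy by (intro frobenius_commuting[OF two]) (simp_all add: l_distr r_distr)
    also have "(\<one> \<oplus> x \<otimes> x) [^] ((2::nat) ^ k) = \<one> \<oplus> (x \<otimes> x) [^] ((2::nat) ^ k)"
      by (subst frobenius_commuting[OF two]) simp_all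
    finally show ?thesis by (simp add: t_nil' nat_pow_pow_two m)
  qed
qed

lemma unit_of_pow_eq_one:
  assumes "b \<in> carrier R" "b [^] k = \<one>" "k > (0::nat)"
  shows "b \<in> Units R"
proof -
  obtain j where "k = Suc j" using assms(3) by (cases k) auto
  then have "b [^] j \<otimes> b = \<one>" "b \<otimes> b [^] j = \<one>"
    using assms nat_pow_Suc[of b j] nat_pow_Suc2[of b j] by metis+
  then show ?thesis using assms(1) unfolding Units_def by auto
qed

end

text \<open>The relations contain no inverses, so they mean the same in a ring and in its unit
  group.\<close>

lemma almost_dihedral_units_of:
  assumes "monoid T" "x \<in> Units T" "y \<in> Units T"
  shows "almost_dihedral (units_of T) l x y \<longleftrightarrow> almost_dihedral T l x y"
proof -
  interpret monoid T by fact
  show ?thesis using assms(2,3)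
    by (simp add: almost_dihedral_def units_of_mult units_of_pow)
qed

lemma almost_dihedral_hom:
  assumes "\<phi> \<in> hom Q M" "monoid Q" "monoid M" "\<phi> \<one>\<^bsub>Q\<^esub> = \<one>\<^bsub>M\<^esub>" 
    and [simp]: "x \<in> carrier Q" "y \<in> carrier Q" and xy: "almost_dihedral Q l x y"
  shows "almost_dihedral M l (\<phi> x) (\<phi> y)"
proof -
  interpret Q: monoid Q by fact
  interpret M: monoid M by fact
  have pow: "\<phi> (g [^]\<^bsub>Q\<^esub> (k::nat)) = \<phi> g [^]\<^bsub>M\<^esub> k" if "g \<in> carrier Q" for g k
    using that by (induction k) (simp_all add: assms hom_mult[OF assms(1)])
  have m: "\<phi> (g \<otimes>\<^bsub>Q\<^esub> h) = \<phi> g \<otimes>\<^bsub>M\<^esub> \<phi> h" if "g \<in> carrier Q" "h \<in> carrier Q" for g h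
    using hom_mult[OF assms(1)] that .
  show ?thesis
    using xy[unfolded almost_dihedral_def, THEN conjunct1, THEN arg_cong[where f=\<phi>]]
      xy[unfolded almost_dihedral_def, THEN conjunct2, THEN conjunct1, THEN arg_cong[where f=\<phi>]]
      xy[unfolded almost_dihedral_def, THEN conjunct2, THEN conjunct2, THEN arg_cong[where f=\<phi>]]
    by (simp add: almost_dihedral_def m pow)
qed

section \<open>Algebra homomorphisms given on generators, and the isomorphism\<close>

context group_alg
begin

lemma basis_one: "basis \<one>\<^bsub>G\<^esub> = \<one>\<^bsub>RG\<^esub>"
  by (simp add: basis_def one_eq)

lemma basis_pow: "g \<in> carrier G \<Longrightarrow> basis g [^]\<^bsub>RG\<^esub> (k::nat) = basis (g [^]\<^bsub>G\<^esub> k)"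
  by (induction k) (simp_all add: basis_one basis_mult)

lemma basis_almost_dihedral:
  assumes "almost_dihedral G l x y" "x \<in> carrier G" "y \<in> carrier G"
  shows "almost_dihedral RG l (basis x) (basis y)"
  by (rule almost_dihedral_hom[where \<phi>=basis and Q=G])
    (use assms in \<open>auto intro!: homI simp: basis_mult basis_one RG.is_monoid\<close>)

lemma basis_unit: "g \<in> carrier G \<Longrightarrow> basis g \<in> Units RG"
  using hom_in_carrier[OF basis_hom] by (simp add: units_of_carrier)

text \<open>The universal property with another group algebra over \<open>R\<close> as target and
  scalars sent to constants, which commute with everything.\<close>

lemma induced_hom:
  assumes "group_alg R H" and c: "c \<in> hom G (units_of (group_algebra R H))"
  shows "\<exists>\<theta> \<in> ring_hom RG (group_algebra R H).
    (\<forall>r \<in> carrier R. \<forall>f \<in> carrier RG. \<theta> (r \<odot>\<^bsub>RG\<^esub> f) = r \<odot>\<^bsub>group_algebra R H\<^esub> \<theta> f) \<and>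
    (\<forall>g \<in> carrier G. \<theta> (basis g) = c g)"
proof -
  interpret H: group_alg R H by fact
  let ?\<rho> = "\<lambda>r. gsingle R H r \<one>\<^bsub>H\<^esub>"
  have c_mem: "c g \<in> carrier H.RG" if "g \<in> carrier G" for g
    using hom_in_carrier[OF c that] by (simp add: units_of_carrier H.RG.Units_closed)
  then have c': "c \<in> carrier G \<rightarrow> carrier H.RG" by auto
  note lin = H.RG.ring_axioms H.const_hom c'
  have "lin H.RG ?\<rho> c \<in> ring_hom RG H.RG"
    using c c_mem by (intro lin_ring_hom[OF H.RG.ring_axioms H.const_hom] H.const_comm)
  moreover have "lin H.RG ?\<rho> c (r \<odot>\<^bsub>RG\<^esub> f) = r \<odot>\<^bsub>H.RG\<^esub> lin H.RG ?\<rho> c f"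
    if "r \<in> carrier R" "f \<in> carrier RG" for r f
    using that by (simp add: lin_smult[OF lin] H.smult_eq_mult lin_closed[OF lin])
  moreover have "lin H.RG ?\<rho> c (basis g) = c g" if "g \<in> carrier G" for g
    using that c_mem[OF that] by (simp add: basis_def lin_gsingle[OF lin] H.one_eq[symmetric])
  ultimately show ?thesis by blast
qed

lemma hom_eq_id:
  assumes \<theta>: "\<theta> \<in> ring_hom RG RG"
    and smult: "\<And>r f. r \<in> carrier R \<Longrightarrow> f \<in> carrier RG \<Longrightarrow> \<theta> (r \<odot>\<^bsub>RG\<^esub> f) = r \<odot>\<^bsub>RG\<^esub> \<theta> f"
    and S: "\<And>S. subgroup S G \<Longrightarrow> gens \<subseteq> S \<Longrightarrow> carrier G = S"
    and gens: "gens \<subseteq> carrier G" "\<And>g. g \<in> gens \<Longrightarrow> \<theta> (basis g) = basis g"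
    and f: "f \<in> carrier RG"
  shows "\<theta> f = f"
proof -
  \<comment> \<open>Composed with \<open>basis\<close>, \<theta> is again a homomorphism into the
    unit group; the subgroup where it agrees with \<open>basis\<close> contains the
    generators.\<close>
  have "(\<lambda>g. \<theta> (basis g)) \<in> hom G (units_of RG)"
  proof (rule homI)
    fix g assume "g \<in> carrier G"
    then have "basis g \<in> Units RG" by (rule basis_unit)
    then obtain v where v: "v \<in> carrier RG" "v \<otimes>\<^bsub>RG\<^esub> basis g = \<one>\<^bsub>RG\<^esub>" "basis g \<otimes>\<^bsub>RG\<^esub> v = \<one>\<^bsub>RG\<^esub>"
      unfolding Units_def by auto
    have "\<theta> v \<otimes>\<^bsub>RG\<^esub> \<theta> (basis g) = \<one>\<^bsub>RG\<^esub>" "\<theta> (basis g) \<otimes>\<^bsub>RG\<^esub> \<theta> v = \<one>\<^bsub>RG\<^esub>"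
      using v by (simp_all flip: ring_hom_mult[OF \<theta>] add: ring_hom_one[OF \<theta>])
    then show "\<theta> (basis g) \<in> carrier (units_of RG)"
      using ring_hom_closed[OF \<theta>] v(1) unfolding units_of_carrier Units_def by auto
  qed (simp add: units_of_mult ring_hom_mult[OF \<theta>] flip: basis_mult)
  then have "subgroup {g \<in> carrier G. \<theta> (basis g) = basis g} G"
    by (intro hom_eq_on_subgroup[OF G.is_group RG.units_group] basis_hom)
  then have "carrier G = {g \<in> carrier G. \<theta> (basis g) = basis g}"
    by (rule S) (use gens in auto)
  then have basis: "\<theta> (basis g) = basis g" if "g \<in> carrier G" for g using that by blast
  show ?thesis using f
  proof (induction f rule: elem_induct)
    case (single r g)
    then have "gsingle R G r g = r \<odot>\<^bsub>RG\<^esub> basis g" by (simp add: basis_def smult_gsingle)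
    then show ?case using single by (simp add: smult basis)
  qed (simp add: ring_hom_add[OF \<theta>])
qed

end

theorem char_two_isomorphic:
  fixes R :: "('r, 'e) ring_scheme" (structure)
  assumes R: "cring R" and "n > m" "m > l" and two: "ring_char R = 2"
  shows "algebra_isomorphic R (group_algebra R (group_G n m l)) (group_algebra R (group_H n m l))"
proof -
  let ?G = "group_G n m l" and ?H = "group_H n m l"
  interpret G: group_alg R ?G by (intro group_alg.intro R group_group_G)
  interpret H: group_alg R ?H by (intro group_alg.intro R group_group_H)
  let ?x = "G_x n m l" and ?y = "G_y n m l" and ?a = "H_a n m l" and ?b = "H_b n m l"
  have "add_pow R (2::nat) \<one> = \<zero>" using two by (simp add: G.ring_char_dvd_iff)
  then have R2: "\<one> \<oplus> \<one> = \<zero>" by (simp add: numeral_2_eq_2)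
  have G2: "\<one>\<^bsub>G.RG\<^esub> \<oplus>\<^bsub>G.RG\<^esub> \<one>\<^bsub>G.RG\<^esub> = \<zero>\<^bsub>G.RG\<^esub>"
    by (simp add: G.one_eq R2 G.gsingle_zero flip: G.gsingle_add)
  have H2: "\<one>\<^bsub>H.RG\<^esub> \<oplus>\<^bsub>H.RG\<^esub> \<one>\<^bsub>H.RG\<^esub> = \<zero>\<^bsub>H.RG\<^esub>"
    by (simp add: H.one_eq R2 H.gsingle_zero flip: H.gsingle_add)
  note double = G.RG.char_two_double[OF G2] H.RG.char_two_double[OF H2]
  have double': "u \<oplus>\<^bsub>G.RG\<^esub> (u \<oplus>\<^bsub>G.RG\<^esub> v) = v" if "u \<in> carrier G.RG" "v \<in> carrier G.RG" for u v
    using that double(1)[of u] by (simp flip: G.RG.a_assoc)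
  have double'': "u \<oplus>\<^bsub>H.RG\<^esub> (u \<oplus>\<^bsub>H.RG\<^esub> v) = v" if "u \<in> carrier H.RG" "v \<in> carrier H.RG" for u v
    using that double(2)[of u] by (simp flip: H.RG.a_assoc)
  define b where "b = \<one>\<^bsub>G.RG\<^esub> \<oplus>\<^bsub>G.RG\<^esub> G.basis ?x \<oplus>\<^bsub>G.RG\<^esub> G.basis ?y"
  define y where "y = \<one>\<^bsub>H.RG\<^esub> \<oplus>\<^bsub>H.RG\<^esub> H.basis ?a \<oplus>\<^bsub>H.RG\<^esub> H.basis ?b"
  have [simp]: "b \<in> carrier G.RG" "y \<in> carrier H.RG" by (simp_all add: b_def y_def)
  have n: "(2::nat) ^ n = 2 ^ m * 2 ^ (n - m)" using \<open>n > m\<close> by (simp add: power_add[symmetric])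
  \<comment> \<open>In G the power y^(2^m) = 1 cancels the summand 1, which leaves the relation of H
    for the pair x, b.\<close>
  have b: "almost_dihedral G.RG l (G.basis ?x) b" "b [^]\<^bsub>G.RG\<^esub> ((2::nat) ^ m) = G.basis ?x [^]\<^bsub>G.RG\<^esub> ((2::nat) ^ m)"
  proof -
    have ad: "almost_dihedral G.RG l (G.basis ?x) (G.basis ?y)"
      by (rule G.basis_almost_dihedral) (simp_all add: G_relations)
    show "almost_dihedral G.RG l (G.basis ?x) b"
      unfolding b_def by (rule G.RG.almost_dihedral_char_two[OF G2 _ _ ad]) simp_all
    have "b [^]\<^bsub>G.RG\<^esub> ((2::nat) ^ m) = \<one>\<^bsub>G.RG\<^esub> \<oplus>\<^bsub>G.RG\<^esub> G.basis ?x [^]\<^bsub>G.RG\<^esub> ((2::nat) ^ m)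
        \<oplus>\<^bsub>G.RG\<^esub> G.basis ?y [^]\<^bsub>G.RG\<^esub> ((2::nat) ^ m)"
      unfolding b_def by (rule G.RG.almost_dihedral_char_two[OF G2 _ _ ad]) (simp_all add: \<open>l < m\<close>)
    then show "b [^]\<^bsub>G.RG\<^esub> ((2::nat) ^ m) = G.basis ?x [^]\<^bsub>G.RG\<^esub> ((2::nat) ^ m)"
      by (simp add: G.basis_pow G_relations G.basis_one double' G.RG.a_ac)
  qed
  \<comment> \<open>In H the equal powers of a and b cancel each other instead, which leaves 1, as
    the relation of G demands.\<close>
  have y: "almost_dihedral H.RG l (H.basis ?a) y" "y [^]\<^bsub>H.RG\<^esub> ((2::nat) ^ m) = \<one>\<^bsub>H.RG\<^esub>"
  proof -
    have ad: "almost_dihedral H.RG l (H.basis ?a) (H.basis ?b)"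
      by (rule H.basis_almost_dihedral) (simp_all add: H_relations)
    show "almost_dihedral H.RG l (H.basis ?a) y"
      unfolding y_def by (rule H.RG.almost_dihedral_char_two[OF H2 _ _ ad]) simp_all
    have "y [^]\<^bsub>H.RG\<^esub> ((2::nat) ^ m) = \<one>\<^bsub>H.RG\<^esub> \<oplus>\<^bsub>H.RG\<^esub> H.basis ?a [^]\<^bsub>H.RG\<^esub> ((2::nat) ^ m)
        \<oplus>\<^bsub>H.RG\<^esub> H.basis ?b [^]\<^bsub>H.RG\<^esub> ((2::nat) ^ m)"
      unfolding y_def by (rule H.RG.almost_dihedral_char_two[OF H2 _ _ ad]) (simp_all add: \<open>l < m\<close>)
    then show "y [^]\<^bsub>H.RG\<^esub> ((2::nat) ^ m) = \<one>\<^bsub>H.RG\<^esub>"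
      by (simp add: H.basis_pow H_relations double H.RG.a_assoc)
  qed
  have x_pow: "G.basis ?x [^]\<^bsub>G.RG\<^esub> ((2::nat) ^ n) = \<one>\<^bsub>G.RG\<^esub>"
    by (simp add: G.basis_pow G_relations G.basis_one)
  have a_pow: "H.basis ?a [^]\<^bsub>H.RG\<^esub> ((2::nat) ^ n) = \<one>\<^bsub>H.RG\<^esub>"
    by (simp add: H.basis_pow H_relations H.basis_one)
  \<comment> \<open>As n > m, equality of the 2^m-th powers of b and x passes to exponent 2^n, where
    x gives 1.\<close>
  have "b [^]\<^bsub>G.RG\<^esub> ((2::nat) ^ n) = \<one>\<^bsub>G.RG\<^esub>"
    using x_pow b(2) by (simp add: n flip: G.RG.nat_pow_pow)
  then have b_unit: "b \<in> Units G.RG" by (rule G.RG.unit_of_pow_eq_one[rotated]) simp_all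
  have y_unit: "y \<in> Units H.RG" using y(2) by (rule H.RG.unit_of_pow_eq_one[rotated]) simp_all
  have x_unit: "G.basis ?x \<in> Units G.RG" by (simp add: G.basis_unit)
  have a_unit: "H.basis ?a \<in> Units H.RG" by (simp add: H.basis_unit)
  have "\<exists>c \<in> hom ?G (units_of H.RG). c ?x = H.basis ?a \<and> c ?y = y"
    by (rule G_hom_exists[OF H.RG.units_group])
      (use a_unit y_unit y a_pow in \<open>simp_all add: units_of_carrier almost_dihedral_units_of[OF H.RG.is_monoid]
        H.RG.units_of_pow units_of_one\<close>)
  then obtain c where "c \<in> hom ?G (units_of H.RG)" and c: "c ?x = H.basis ?a" "c ?y = y" by blast
  from G.induced_hom[OF H.group_alg_axioms this(1)]
  obtain \<phi> where \<phi>: "\<phi> \<in> ring_hom G.RG H.RG"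
    and \<phi>_smult: "\<And>r f. r \<in> carrier R \<Longrightarrow> f \<in> carrier G.RG \<Longrightarrow> \<phi> (r \<odot>\<^bsub>G.RG\<^esub> f) = r \<odot>\<^bsub>H.RG\<^esub> \<phi> f"
    and "\<And>g. g \<in> carrier ?G \<Longrightarrow> \<phi> (G.basis g) = c g" by blast
  then have \<phi>_gen: "\<phi> (G.basis ?x) = H.basis ?a" "\<phi> (G.basis ?y) = y" using c by simp_all
  have "\<exists>c \<in> hom ?H (units_of G.RG). c ?a = G.basis ?x \<and> c ?b = b"
    by (rule H_hom_exists[OF G.RG.units_group])
      (use x_unit b_unit b x_pow in \<open>simp_all add: units_of_carrier almost_dihedral_units_of[OF G.RG.is_monoid]
        G.RG.units_of_pow units_of_one\<close>)
  then obtain d where "d \<in> hom ?H (units_of G.RG)" and d: "d ?a = G.basis ?x" "d ?b = b" by blast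
  from H.induced_hom[OF G.group_alg_axioms this(1)]
  obtain \<psi> where \<psi>: "\<psi> \<in> ring_hom H.RG G.RG"
    and \<psi>_smult: "\<And>r f. r \<in> carrier R \<Longrightarrow> f \<in> carrier H.RG \<Longrightarrow> \<psi> (r \<odot>\<^bsub>H.RG\<^esub> f) = r \<odot>\<^bsub>G.RG\<^esub> \<psi> f"
    and "\<And>g. g \<in> carrier ?H \<Longrightarrow> \<psi> (H.basis g) = d g" by blast
  then have \<psi>_gen: "\<psi> (H.basis ?a) = G.basis ?x" "\<psi> (H.basis ?b) = b" using d by simp_all
  \<comment> \<open>Substituting twice gives 1 + a + (1 + a + b) = b in characteristic two.\<close>
  have \<phi>_b: "\<phi> b = H.basis ?b"
    unfolding b_def
    by (simp add: ring_hom_add[OF \<phi>] ring_hom_one[OF \<phi>] \<phi>_gen y_def double'' H.RG.a_ac double)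
  have \<psi>_y: "\<psi> y = G.basis ?y"
    unfolding y_def
    by (simp add: ring_hom_add[OF \<psi>] ring_hom_one[OF \<psi>] \<psi>_gen b_def double' G.RG.a_ac double)
  have \<psi>\<phi>: "\<psi> (\<phi> f) = f" if "f \<in> carrier G.RG" for f
  proof -
    have "(\<psi> \<circ> \<phi>) f = f"
    proof (rule G.hom_eq_id[OF ring_hom_trans[OF \<phi> \<psi>], where gens = "{?x, ?y}"])
      show "carrier ?G = S" if "subgroup S ?G" "{?x, ?y} \<subseteq> S" for S
        using that by (intro G_subgroup) auto
    qed (use that in \<open>auto simp: \<phi>_gen \<psi>_gen \<psi>_y \<phi>_smult \<psi>_smult ring_hom_closed[OF \<phi>]\<close>)
    then show ?thesis by simp
  qed
  have \<phi>\<psi>: "\<phi> (\<psi> f) = f" if "f \<in> carrier H.RG" for f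
  proof -
    have "(\<phi> \<circ> \<psi>) f = f"
    proof (rule H.hom_eq_id[OF ring_hom_trans[OF \<psi> \<phi>], where gens = "{?a, ?b}"])
      show "carrier ?H = S" if "subgroup S ?H" "{?a, ?b} \<subseteq> S" for S
        using that by (intro H_subgroup) auto
    qed (use that in \<open>auto simp: \<phi>_gen \<psi>_gen \<phi>_b \<phi>_smult \<psi>_smult ring_hom_closed[OF \<psi>]\<close>)
    then show ?thesis by simp
  qed
  have "bij_betw \<phi> (carrier G.RG) (carrier H.RG)"
    by (rule bij_betw_byWitness[where f'=\<psi>])
      (auto simp: \<psi>\<phi> \<phi>\<psi> ring_hom_closed[OF \<phi>] ring_hom_closed[OF \<psi>])
  then show ?thesis
    unfolding algebra_isomorphic_def ring_iso_def using \<phi> \<phi>_smult by blast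
qed

section \<open>A dihedral quotient\<close>

text \<open>\<open>(i, b)\<close> stands for \<open>w ^ i s ^ b\<close> with a rotation \<open>w\<close> of order 8 and a reflection \<open>s\<close>.\<close>

definition dihedral8 :: "(int \<times> bool) monoid" where
  "dihedral8 = \<lparr>carrier = {0..<8} \<times> UNIV,
     monoid.mult = (\<lambda>(i, b) (j, c). ((if b then i - j else i + j) mod 8, b \<noteq> c)), one = (0, False)\<rparr>"

lemma carrier_dihedral8: "carrier dihedral8 = {0..<8} \<times> UNIV"
  by (simp add: dihedral8_def)

lemma one_dihedral8: "\<one>\<^bsub>dihedral8\<^esub> = (0, False)"
  by (simp add: dihedral8_def)

lemma mult_dihedral8:
  "(i, b) \<otimes>\<^bsub>dihedral8\<^esub> (j, c) = ((if b then i - j else i + j) mod 8, b \<noteq> c)"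
  by (simp add: dihedral8_def)

lemma group_dihedral8: "group dihedral8"
proof (rule groupI)
  fix g assume g: "g \<in> carrier dihedral8"
  obtain i b where [simp]: "g = (i, b)" by (cases g)
  have "(if b then i else (- i) mod 8, b) \<otimes>\<^bsub>dihedral8\<^esub> g = \<one>\<^bsub>dihedral8\<^esub>"
    by (simp add: mult_dihedral8 one_dihedral8 mod_simps)
  moreover have "(if b then i else (- i) mod 8, b) \<in> carrier dihedral8"
    using g by (auto simp: carrier_dihedral8)
  ultimately show "\<exists>h\<in>carrier dihedral8. h \<otimes>\<^bsub>dihedral8\<^esub> g = \<one>\<^bsub>dihedral8\<^esub>" by blast
next
  fix g h k assume "g \<in> carrier dihedral8" "h \<in> carrier dihedral8" "k \<in> carrier dihedral8"
  then show "g \<otimes>\<^bsub>dihedral8\<^esub> h \<otimes>\<^bsub>dihedral8\<^esub> k = g \<otimes>\<^bsub>dihedral8\<^esub> (h \<otimes>\<^bsub>dihedral8\<^esub> k)"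
    by (cases g; cases h; cases k) (auto simp: mult_dihedral8 mod_simps algebra_simps)
qed (auto simp: carrier_dihedral8 mult_dihedral8 one_dihedral8)

lemma inv_dihedral8:
  assumes "(i, b) \<in> carrier dihedral8"
  shows "inv\<^bsub>dihedral8\<^esub> (i, b) = (if b then i else (- i) mod 8, b)"
proof -
  interpret group dihedral8 by (rule group_dihedral8)
  show ?thesis
    using assms by (intro inv_equality) (auto simp: mult_dihedral8 one_dihedral8 mod_simps carrier_dihedral8)
qed

lemma carrier_dihedral8_explicit: "carrier dihedral8 =
  {(0,False),(1,False),(2,False),(3,False),(4,False),(5,False),(6,False),(7,False),
   (0,True),(1,True),(2,True),(3,True),(4,True),(5,True),(6,True),(7,True)}"
proof -
  have "{0..<8::int} = {0,1,2,3,4,5,6,7}" by auto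
  then show ?thesis unfolding carrier_dihedral8 UNIV_bool by auto
qed

text \<open>Written out so that the coefficients of a product become explicit polynomials in the
  coefficients of its factors.\<close>

lemma (in abelian_monoid) finsum_dihedral8:
  assumes "f \<in> carrier dihedral8 \<rightarrow> carrier G"
  shows "(\<Oplus>u\<in>carrier dihedral8. f u) =
    f (0, False) \<oplus> (f (1, False) \<oplus> (f (2, False) \<oplus> (f (3, False) \<oplus> (
    f (4, False) \<oplus> (f (5, False) \<oplus> (f (6, False) \<oplus> (f (7, False) \<oplus> (f (0, True) \<oplus> (f (1, True) \<oplus> (f (2, True) \<oplus> (f (3, True) \<oplus> (
    f (4, True) \<oplus> (f (5, True) \<oplus> (f (6, True) \<oplus> (f (7, True))))))))))))))))"
proof -
  have "f u \<in> carrier G" if "u \<in> carrier dihedral8" for u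
    using assms that by auto
  then show ?thesis
    unfolding carrier_dihedral8_explicit by (simp add: Pi_def)
qed

section \<open>Coefficients, derivations and passage to a quotient group\<close>

context group_alg
begin

lemma mult_gsingle_app:
  assumes "r \<in> carrier R" "g \<in> carrier G" "f \<in> carrier RG" "k \<in> carrier G"
  shows "(f \<otimes>\<^bsub>RG\<^esub> gsingle R G r g) k = f (k \<otimes>\<^bsub>G\<^esub> inv\<^bsub>G\<^esub> g) \<otimes> r"
  using assms(3)
proof (induction f rule: elem_induct)
  case (single s h)
  have "h \<otimes>\<^bsub>G\<^esub> g = k \<longleftrightarrow> k \<otimes>\<^bsub>G\<^esub> inv\<^bsub>G\<^esub> g = h"
    using assms single by (metis G.inv_solve_right)
  then show ?case using assms single by (auto simp: gsingle_mult gsingle_app)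
next
  case (add f f')
  then show ?case using assms by (simp add: l_distr_RG mult_mem R.l_distr)
qed

text \<open>Compare the coefficients of both sides at g k g. The conclusion is invariance under
  conjugation by g, phrased without inverses.\<close>

lemma commuting_coeff:
  assumes "f \<in> carrier RG" "g \<in> carrier G" "k \<in> carrier G"
    and comm: "basis g \<otimes>\<^bsub>RG\<^esub> f = f \<otimes>\<^bsub>RG\<^esub> basis g"
  shows "f (g \<otimes>\<^bsub>G\<^esub> k) = f (k \<otimes>\<^bsub>G\<^esub> g)"
proof -
  have "(basis g \<otimes>\<^bsub>RG\<^esub> f) (g \<otimes>\<^bsub>G\<^esub> k \<otimes>\<^bsub>G\<^esub> g) = (f \<otimes>\<^bsub>RG\<^esub> basis g) (g \<otimes>\<^bsub>G\<^esub> k \<otimes>\<^bsub>G\<^esub> g)"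
    by (simp only: comm)
  moreover have "inv\<^bsub>G\<^esub> g \<otimes>\<^bsub>G\<^esub> (g \<otimes>\<^bsub>G\<^esub> k \<otimes>\<^bsub>G\<^esub> g) = k \<otimes>\<^bsub>G\<^esub> g"
    using assms(2,3) by (simp add: G.m_assoc[symmetric])
  moreover have "g \<otimes>\<^bsub>G\<^esub> k \<otimes>\<^bsub>G\<^esub> g \<otimes>\<^bsub>G\<^esub> inv\<^bsub>G\<^esub> g = g \<otimes>\<^bsub>G\<^esub> k"
    using assms(2,3) by (simp add: G.m_assoc)
  ultimately show ?thesis
    using assms(1-3) by (simp add: basis_def gsingle_mult_app mult_gsingle_app)
qed

text \<open>An additive character extends to a derivation over the augmentation: on monomials both
  sides are the image of r s times \<chi> g + \<chi> h, and both sides are biadditive.\<close>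

lemma lin_derivation:
  assumes K: "cring K" and \<rho>: "\<rho> \<in> ring_hom R K" and \<chi>: "\<chi> \<in> carrier G \<rightarrow> carrier K"
    and \<chi>_mult: "\<And>g h. g \<in> carrier G \<Longrightarrow> h \<in> carrier G \<Longrightarrow> \<chi> (g \<otimes>\<^bsub>G\<^esub> h) = \<chi> g \<oplus>\<^bsub>K\<^esub> \<chi> h"
    and f: "f \<in> carrier RG" "f' \<in> carrier RG"
  shows "lin K \<rho> \<chi> (f \<otimes>\<^bsub>RG\<^esub> f') =
    lin K \<rho> \<chi> f \<otimes>\<^bsub>K\<^esub> lin K \<rho> (\<lambda>g. \<one>\<^bsub>K\<^esub>) f' \<oplus>\<^bsub>K\<^esub> lin K \<rho> (\<lambda>g. \<one>\<^bsub>K\<^esub>) f \<otimes>\<^bsub>K\<^esub> lin K \<rho> \<chi> f'"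
proof -
  interpret K: cring K by fact
  have one: "(\<lambda>g. \<one>\<^bsub>K\<^esub>) \<in> carrier G \<rightarrow> carrier K" by simp
  note lin = lin_gsingle[OF K.ring_axioms \<rho>] lin_add[OF K.ring_axioms \<rho>] lin_closed[OF K.ring_axioms \<rho>]
  note closed = ring_hom_closed[OF \<rho>] funcset_mem[OF \<chi>]
  show ?thesis using f(1)
  proof (induction f rule: elem_induct)
    case (single r g)
    show ?case using f(2)
    proof (induction f' rule: elem_induct)
      case (single s h)
      then show ?case using \<open>r \<in> carrier R\<close> \<open>g \<in> carrier G\<close>
        by (simp add: gsingle_mult lin one \<chi> \<chi>_mult ring_hom_mult[OF \<rho>] closed K.r_distr K.m_ac)
    next
      case (add f f')
      then show ?case using \<open>r \<in> carrier R\<close> \<open>g \<in> carrier G\<close>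
        by (simp add: RG.r_distr lin one \<chi> closed K.r_distr K.a_ac)
    qed
  next
    case (add f1 f2)
    then show ?case using f(2) by (simp add: RG.l_distr lin one \<chi> K.l_distr K.a_ac)
  qed
qed

text \<open>The constant function 1 defines the augmentation, the sum of all coefficients read in
  \<open>K\<close>.\<close>

lemma lin_one_mult:
  assumes K: "cring K" and \<rho>: "\<rho> \<in> ring_hom R K"
  shows "lin K \<rho> (\<lambda>g. \<one>\<^bsub>K\<^esub>) \<in> ring_hom RG K"
proof -
  interpret K: cring K by fact
  show ?thesis
    by (rule lin_ring_hom[OF K.ring_axioms \<rho>])
      (auto simp: hom_def units_of_carrier units_of_mult ring_hom_closed[OF \<rho>])
qed

lemma lin_comb:
  assumes K: "cring K" and \<rho>: "\<rho> \<in> ring_hom R K"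
    and \<chi>: "\<chi> \<in> carrier G \<rightarrow> carrier K" and \<psi>: "\<psi> \<in> carrier G \<rightarrow> carrier K"
    and ab: "a \<in> carrier K" "b \<in> carrier K" and f: "f \<in> carrier RG"
  shows "lin K \<rho> (\<lambda>g. a \<otimes>\<^bsub>K\<^esub> \<chi> g \<oplus>\<^bsub>K\<^esub> b \<otimes>\<^bsub>K\<^esub> \<psi> g) f = a \<otimes>\<^bsub>K\<^esub> lin K \<rho> \<chi> f \<oplus>\<^bsub>K\<^esub> b \<otimes>\<^bsub>K\<^esub> lin K \<rho> \<psi> f"
proof -
  interpret K: cring K by fact
  note lin = lin_gsingle[OF K.ring_axioms \<rho>] lin_add[OF K.ring_axioms \<rho>] lin_closed[OF K.ring_axioms \<rho>]
  note closed = ring_hom_closed[OF \<rho>] funcset_mem[OF \<chi>] funcset_mem[OF \<psi>]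
  have comb: "(\<lambda>g. a \<otimes>\<^bsub>K\<^esub> \<chi> g \<oplus>\<^bsub>K\<^esub> b \<otimes>\<^bsub>K\<^esub> \<psi> g) \<in> carrier G \<rightarrow> carrier K"
    using ab closed by simp
  show ?thesis using f
    by (induction f rule: elem_induct)
      (simp_all add: lin comb \<chi> \<psi> ab closed K.r_distr K.m_lcomm K.a_ac)
qed

text \<open>A functional that factors through a quotient group can be evaluated after pushing the
  element forward. In the application this turns a sum over G into one over sixteen
  coefficients.\<close>

lemma lin_pushforward:
  assumes K: "ring K" and \<rho>: "\<rho> \<in> ring_hom R K" and Q: "group_alg R Q"
    and \<phi>: "\<phi> \<in> carrier G \<rightarrow> carrier Q" and \<chi>: "\<chi> \<in> carrier Q \<rightarrow> carrier K" and f: "f \<in> carrier RG"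
  shows "group_alg.lin R Q K \<rho> \<chi>
      (lin (group_algebra R Q) (\<lambda>r. gsingle R Q r \<one>\<^bsub>Q\<^esub>) (\<lambda>g. group_alg.basis R Q (\<phi> g)) f) =
    lin K \<rho> (\<lambda>g. \<chi> (\<phi> g)) f"
proof -
  interpret Q: group_alg R Q by fact
  have basis: "(\<lambda>g. Q.basis (\<phi> g)) \<in> carrier G \<rightarrow> carrier Q.RG" by simp
  have \<chi>\<phi>: "(\<lambda>g. \<chi> (\<phi> g)) \<in> carrier G \<rightarrow> carrier K" using \<phi> \<chi> by auto
  note lin = lin_gsingle[OF Q.RG.ring_axioms Q.const_hom basis] lin_add[OF Q.RG.ring_axioms Q.const_hom basis]
    lin_closed[OF Q.RG.ring_axioms Q.const_hom basis]
    lin_gsingle[OF K \<rho> \<chi>\<phi>] lin_add[OF K \<rho> \<chi>\<phi>]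
    Q.lin_gsingle[OF K \<rho> \<chi>] Q.lin_add[OF K \<rho> \<chi>]
  show ?thesis using f
    by (induction f rule: elem_induct) (simp_all add: lin funcset_mem[OF \<phi>] Q.const_mult_basis)
qed

end

text \<open>The quotient map sends x to s and y to w s, hence y x to w. A rotation step thus counts
  one x and one y and the reflection s counts one x: modulo 2 the number of letters x in w^i s^b is
  i + b, the number of letters y is i.\<close>

definition parity_x :: "('k, 'c) ring_scheme \<Rightarrow> int \<times> bool \<Rightarrow> 'k" where
  "parity_x K = (\<lambda>(i, b). if odd i \<noteq> b then \<one>\<^bsub>K\<^esub> else \<zero>\<^bsub>K\<^esub>)"

definition parity_y :: "('k, 'c) ring_scheme \<Rightarrow> int \<times> bool \<Rightarrow> 'k" where
  "parity_y K = (\<lambda>(i, b). if odd i then \<one>\<^bsub>K\<^esub> else \<zero>\<^bsub>K\<^esub>)"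

text \<open>The last assumption is the only trace of characteristic four in the dihedral
  computation. It concerns elements of \<open>R\<close>, which is why coefficients stay in
  \<open>R\<close> until \<open>\<rho>\<close> is applied.\<close>

locale dihedral_alg = group_alg R dihedral8 + K: field K
  for R :: "('r, 'e) ring_scheme" (structure) and K :: "('k, 'c) ring_scheme" +
  fixes \<rho> :: "'r \<Rightarrow> 'k"
  assumes \<rho>: "\<rho> \<in> ring_hom R K" and K_two: "\<one>\<^bsub>K\<^esub> \<oplus>\<^bsub>K\<^esub> \<one>\<^bsub>K\<^esub> = \<zero>\<^bsub>K\<^esub>"
    and \<rho>_two: "\<And>r. r \<in> carrier R \<Longrightarrow> r \<oplus> r = \<zero> \<Longrightarrow> \<rho> r = \<zero>\<^bsub>K\<^esub>"
begin

text \<open>The inverse of the rotation w^i takes index k to k - i. A reflection w^i s is its own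
  inverse; it takes k to i - k and exchanges rotations with reflections.\<close>

lemma mult_expand:
  assumes F: "F \<in> carrier RG" "F' \<in> carrier RG" and k: "0 \<le> k" "k < 8"
  shows "(F \<otimes>\<^bsub>RG\<^esub> F') (k, b) =
    F (0, False) \<otimes> F' ((k - 0) mod 8, b) \<oplus> (F (1, False) \<otimes> F' ((k - 1) mod 8, b) \<oplus> (
    F (2, False) \<otimes> F' ((k - 2) mod 8, b) \<oplus> (F (3, False) \<otimes> F' ((k - 3) mod 8, b) \<oplus> (
    F (4, False) \<otimes> F' ((k - 4) mod 8, b) \<oplus> (F (5, False) \<otimes> F' ((k - 5) mod 8, b) \<oplus> (
    F (6, False) \<otimes> F' ((k - 6) mod 8, b) \<oplus> (F (7, False) \<otimes> F' ((k - 7) mod 8, b) \<oplus> (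
    F (0, True) \<otimes> F' ((0 - k) mod 8, \<not> b) \<oplus> (F (1, True) \<otimes> F' ((1 - k) mod 8, \<not> b) \<oplus> (
    F (2, True) \<otimes> F' ((2 - k) mod 8, \<not> b) \<oplus> (F (3, True) \<otimes> F' ((3 - k) mod 8, \<not> b) \<oplus> (
    F (4, True) \<otimes> F' ((4 - k) mod 8, \<not> b) \<oplus> (F (5, True) \<otimes> F' ((5 - k) mod 8, \<not> b) \<oplus> (
    F (6, True) \<otimes> F' ((6 - k) mod 8, \<not> b) \<oplus> (F (7, True) \<otimes> F' ((7 - k) mod 8, \<not> b))))))))))))))))"
proof -
  have app: "inv\<^bsub>dihedral8\<^esub> (i, c) \<otimes>\<^bsub>dihedral8\<^esub> (k, b) = (if c then (i - k) mod 8 else (k - i) mod 8, c \<noteq> b)"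
    if "0 \<le> i" "i < 8" for i c
    using that by (auto simp: inv_dihedral8 carrier_dihedral8 mult_dihedral8 mod_simps)
  have mem: "(if c then j mod 8 else j' mod 8, d) \<in> carrier dihedral8" for j j' c d
    by (simp add: carrier_dihedral8)
  have mem': "(k, b) \<in> carrier dihedral8" using k by (simp add: carrier_dihedral8)
  let ?f = "\<lambda>u. F u \<otimes> F' (if snd u then (fst u - k) mod 8 else (k - fst u) mod 8, snd u \<noteq> b)"
  have f: "?f \<in> carrier dihedral8 \<rightarrow> carrier R"
    using coeff_closed[OF F(1)] coeff_closed[OF F(2) mem] by (intro funcsetI R.m_closed)
  have "(F \<otimes>\<^bsub>RG\<^esub> F') (k, b) =
    (\<Oplus>u\<in>carrier dihedral8. F u \<otimes> F' (inv\<^bsub>dihedral8\<^esub> u \<otimes>\<^bsub>dihedral8\<^esub> (k, b)))"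
    using F mem' by (intro mult_app) (auto simp: carrier_dihedral8)
  also have "\<dots> = (\<Oplus>u\<in>carrier dihedral8. ?f u)"
    using f by (rule R.finsum_cong'[OF HOL.refl]) (auto simp: carrier_dihedral8 app)
  also have "\<dots> = F (0, False) \<otimes> F' ((k - 0) mod 8, b) \<oplus> (F (1, False) \<otimes> F' ((k - 1) mod 8, b) \<oplus> (
    F (2, False) \<otimes> F' ((k - 2) mod 8, b) \<oplus> (F (3, False) \<otimes> F' ((k - 3) mod 8, b) \<oplus> (
    F (4, False) \<otimes> F' ((k - 4) mod 8, b) \<oplus> (F (5, False) \<otimes> F' ((k - 5) mod 8, b) \<oplus> (
    F (6, False) \<otimes> F' ((k - 6) mod 8, b) \<oplus> (F (7, False) \<otimes> F' ((k - 7) mod 8, b) \<oplus> (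
    F (0, True) \<otimes> F' ((0 - k) mod 8, \<not> b) \<oplus> (F (1, True) \<otimes> F' ((1 - k) mod 8, \<not> b) \<oplus> (
    F (2, True) \<otimes> F' ((2 - k) mod 8, \<not> b) \<oplus> (F (3, True) \<otimes> F' ((3 - k) mod 8, \<not> b) \<oplus> (
    F (4, True) \<otimes> F' ((4 - k) mod 8, \<not> b) \<oplus> (F (5, True) \<otimes> F' ((5 - k) mod 8, \<not> b) \<oplus> (
    F (6, True) \<otimes> F' ((6 - k) mod 8, \<not> b) \<oplus> (F (7, True) \<otimes> F' ((7 - k) mod 8, \<not> b))))))))))))))))"
    unfolding R.finsum_dihedral8[OF f] by simp
  finally show ?thesis .
qed

lemma lin_expand:
  assumes \<chi>: "\<chi> \<in> carrier dihedral8 \<rightarrow> carrier K" and F: "F \<in> carrier RG"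
  shows "lin K \<rho> \<chi> F =
    \<rho> (F (0, False)) \<otimes>\<^bsub>K\<^esub> \<chi> (0, False) \<oplus>\<^bsub>K\<^esub> (\<rho> (F (1, False)) \<otimes>\<^bsub>K\<^esub> \<chi> (1, False) \<oplus>\<^bsub>K\<^esub> (
    \<rho> (F (2, False)) \<otimes>\<^bsub>K\<^esub> \<chi> (2, False) \<oplus>\<^bsub>K\<^esub> (\<rho> (F (3, False)) \<otimes>\<^bsub>K\<^esub> \<chi> (3, False) \<oplus>\<^bsub>K\<^esub> (
    \<rho> (F (4, False)) \<otimes>\<^bsub>K\<^esub> \<chi> (4, False) \<oplus>\<^bsub>K\<^esub> (\<rho> (F (5, False)) \<otimes>\<^bsub>K\<^esub> \<chi> (5, False) \<oplus>\<^bsub>K\<^esub> (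
    \<rho> (F (6, False)) \<otimes>\<^bsub>K\<^esub> \<chi> (6, False) \<oplus>\<^bsub>K\<^esub> (\<rho> (F (7, False)) \<otimes>\<^bsub>K\<^esub> \<chi> (7, False) \<oplus>\<^bsub>K\<^esub> (
    \<rho> (F (0, True)) \<otimes>\<^bsub>K\<^esub> \<chi> (0, True) \<oplus>\<^bsub>K\<^esub> (\<rho> (F (1, True)) \<otimes>\<^bsub>K\<^esub> \<chi> (1, True) \<oplus>\<^bsub>K\<^esub> (
    \<rho> (F (2, True)) \<otimes>\<^bsub>K\<^esub> \<chi> (2, True) \<oplus>\<^bsub>K\<^esub> (\<rho> (F (3, True)) \<otimes>\<^bsub>K\<^esub> \<chi> (3, True) \<oplus>\<^bsub>K\<^esub> (
    \<rho> (F (4, True)) \<otimes>\<^bsub>K\<^esub> \<chi> (4, True) \<oplus>\<^bsub>K\<^esub> (\<rho> (F (5, True)) \<otimes>\<^bsub>K\<^esub> \<chi> (5, True) \<oplus>\<^bsub>K\<^esub> (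
    \<rho> (F (6, True)) \<otimes>\<^bsub>K\<^esub> \<chi> (6, True) \<oplus>\<^bsub>K\<^esub> (\<rho> (F (7, True)) \<otimes>\<^bsub>K\<^esub> \<chi> (7, True))))))))))))))))"
proof -
  have closed: "(\<lambda>u. \<rho> (F u) \<otimes>\<^bsub>K\<^esub> \<chi> u) \<in> carrier dihedral8 \<rightarrow> carrier K"
    using \<chi> F by (intro funcsetI K.m_closed ring_hom_closed[OF \<rho>]) auto
  have "lin K \<rho> \<chi> F = (\<Oplus>\<^bsub>K\<^esub>u\<in>carrier dihedral8. \<rho> (F u) \<otimes>\<^bsub>K\<^esub> \<chi> u)"
    by (rule lin_superset[OF K.ring_axioms \<rho> \<chi> F]) (auto simp: carrier_dihedral8)
  then show ?thesis unfolding K.finsum_dihedral8[OF closed] .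
qed

end

section \<open>Central squares in the dihedral group algebra\<close>

context dihedral_alg
begin

lemma \<rho>_minus: "a \<in> carrier R \<Longrightarrow> b \<in> carrier R \<Longrightarrow> \<rho> (a \<ominus> b) = \<rho> a \<oplus>\<^bsub>K\<^esub> \<rho> b"
proof -
  assume ab: "a \<in> carrier R" "b \<in> carrier R"
  have "a \<oplus> b = (a \<ominus> b) \<oplus> (b \<oplus> b)" using ab by (simp add: R.minus_eq R.a_assoc R.r_neg1)
  then have "\<rho> a \<oplus>\<^bsub>K\<^esub> \<rho> b = \<rho> (a \<ominus> b) \<oplus>\<^bsub>K\<^esub> (\<rho> b \<oplus>\<^bsub>K\<^esub> \<rho> b)"
    using ab by (simp flip: ring_hom_add[OF \<rho>])
  then show ?thesis
    using ab K.char_two_double[OF K_two] by (simp add: ring_hom_closed[OF \<rho>])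
qed

text \<open>Even and odd rotations are the classes of 1 and x y, even and odd reflections those of x
  and y. With \<open>e\<close>, \<open>a\<close>, \<open>f\<close>, \<open>f'\<close> the
  coefficient sums over these four classes, the claim follows from \<rho> a = 0 and from the
  vanishing of \<rho> e times \<rho> f and times \<rho> f', because s + u + v is then \<rho>
  e.\<close>

lemma square_commuting:
  assumes F: "F \<in> carrier RG"
    and comm_s: "basis (0, True) \<otimes>\<^bsub>RG\<^esub> (F \<otimes>\<^bsub>RG\<^esub> F) = F \<otimes>\<^bsub>RG\<^esub> F \<otimes>\<^bsub>RG\<^esub> basis (0, True)"
    and comm_w: "basis (1, False) \<otimes>\<^bsub>RG\<^esub> (F \<otimes>\<^bsub>RG\<^esub> F) = F \<otimes>\<^bsub>RG\<^esub> F \<otimes>\<^bsub>RG\<^esub> basis (1, False)"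
  defines "s \<equiv> lin K \<rho> (\<lambda>g. \<one>\<^bsub>K\<^esub>) F" and "u \<equiv> lin K \<rho> (parity_x K) F" and "v \<equiv> lin K \<rho> (parity_y K) F"
  shows "(s \<oplus>\<^bsub>K\<^esub> u \<oplus>\<^bsub>K\<^esub> v) \<otimes>\<^bsub>K\<^esub> u = \<zero>\<^bsub>K\<^esub>" "(s \<oplus>\<^bsub>K\<^esub> u \<oplus>\<^bsub>K\<^esub> v) \<otimes>\<^bsub>K\<^esub> v = \<zero>\<^bsub>K\<^esub>"
proof -
  let ?C = "F \<otimes>\<^bsub>RG\<^esub> F"
  have Cmem: "?C \<in> carrier RG" using F by (rule mult_mem[OF F])
  define p0 p1 p2 p3 p4 p5 p6 p7 where p: "p0 = F (0, False)" "p1 = F (1, False)" "p2 = F (2, False)" "p3 = F (3, False)"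
    "p4 = F (4, False)" "p5 = F (5, False)" "p6 = F (6, False)" "p7 = F (7, False)"
  define q0 q1 q2 q3 q4 q5 q6 q7 where q: "q0 = F (0, True)" "q1 = F (1, True)" "q2 = F (2, True)" "q3 = F (3, True)"
    "q4 = F (4, True)" "q5 = F (5, True)" "q6 = F (6, True)" "q7 = F (7, True)"
  have pc [simp]: "p0 \<in> carrier R" "p1 \<in> carrier R" "p2 \<in> carrier R" "p3 \<in> carrier R"
    "p4 \<in> carrier R" "p5 \<in> carrier R" "p6 \<in> carrier R" "p7 \<in> carrier R"
    unfolding p by (intro coeff_closed F, simp add: carrier_dihedral8)+
  have qc [simp]: "q0 \<in> carrier R" "q1 \<in> carrier R" "q2 \<in> carrier R" "q3 \<in> carrier R"
    "q4 \<in> carrier R" "q5 \<in> carrier R" "q6 \<in> carrier R" "q7 \<in> carrier R"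
    unfolding q by (intro coeff_closed F, simp add: carrier_dihedral8)+
  have \<rho>c [simp]: "r \<in> carrier R \<Longrightarrow> \<rho> r \<in> carrier K" for r by (rule ring_hom_closed[OF \<rho>])
  \<comment> \<open>Conjugation by s sends w^2 to w^6.\<close>
  have even: "?C (6, False) = ?C (2, False)"
    using commuting_coeff[OF Cmem _ _ comm_s, of "(2, True)"] by (simp add: carrier_dihedral8 mult_dihedral8)
  \<comment> \<open>Conjugation by w sends w^j s to w^(j+2) s.\<close>
  have odd: "?C (2, True) = ?C (0, True)" "?C (6, True) = ?C (4, True)"
      "?C (3, True) = ?C (1, True)" "?C (7, True) = ?C (5, True)"
    using commuting_coeff[OF Cmem _ _ comm_w, of "(1, True)"] commuting_coeff[OF Cmem _ _ comm_w, of "(5, True)"]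
      commuting_coeff[OF Cmem _ _ comm_w, of "(2, True)"] commuting_coeff[OF Cmem _ _ comm_w, of "(6, True)"]
    by (simp_all add: carrier_dihedral8 mult_dihedral8)
  note C = mult_expand[OF F F, of 2 False, simplified, folded p q] mult_expand[OF F F, of 6 False, simplified, folded p q]
    mult_expand[OF F F, of 0 True, simplified, folded p q] mult_expand[OF F F, of 1 True, simplified, folded p q]
    mult_expand[OF F F, of 2 True, simplified, folded p q] mult_expand[OF F F, of 3 True, simplified, folded p q]
    mult_expand[OF F F, of 4 True, simplified, folded p q] mult_expand[OF F F, of 5 True, simplified, folded p q]
    mult_expand[OF F F, of 6 True, simplified, folded p q] mult_expand[OF F F, of 7 True, simplified, folded p q]
  have square_add: "(x \<oplus>\<^bsub>K\<^esub> y) \<otimes>\<^bsub>K\<^esub> (x \<oplus>\<^bsub>K\<^esub> y) = x \<otimes>\<^bsub>K\<^esub> x \<oplus>\<^bsub>K\<^esub> y \<otimes>\<^bsub>K\<^esub> y"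
    if "x \<in> carrier K" "y \<in> carrier K" for x y
    using that K.frobenius_commuting[OF K_two that K.m_comm[OF that], of 1] by (simp add: numeral_2_eq_2)
  define a where "a = p1 \<oplus> p5 \<oplus> (p3 \<oplus> p7)"
  \<comment> \<open>These are the coefficients in the dihedral quotient of order 8, where w^4 =
    1.\<close>
  define P0 P1 P2 P3 where P: "P0 = p0 \<oplus> p4" "P1 = p1 \<oplus> p5" "P2 = p2 \<oplus> p6" "P3 = p3 \<oplus> p7"
  define Q0 Q1 Q2 Q3 where Q: "Q0 = q0 \<oplus> q4" "Q1 = q1 \<oplus> q5" "Q2 = q2 \<oplus> q6" "Q3 = q3 \<oplus> q7"
  have PQ [simp]: "P0 \<in> carrier R" "P1 \<in> carrier R" "P2 \<in> carrier R" "P3 \<in> carrier R"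
    "Q0 \<in> carrier R" "Q1 \<in> carrier R" "Q2 \<in> carrier R" "Q3 \<in> carrier R"
    by (simp_all add: P Q)
  define e where "e = P0 \<oplus> P2"
  define f where "f = Q0 \<oplus> Q2"
  define f' where "f' = Q1 \<oplus> Q3"
  \<comment> \<open>\<open>d\<close> and \<open>d'\<close> collect the unordered pairs of distinct
    rotations with product w^2 and w^6; each pair occurs in both orders. \<open>t\<close> collects
    the pairs of reflections with product w^2; exchanging the two reflections inverts the product,
    so \<open>t\<close> serves for w^6 as well.\<close>
  define d where "d = p0 \<otimes> p2 \<oplus> p3 \<otimes> p7 \<oplus> p4 \<otimes> p6"
  define d' where "d' = p0 \<otimes> p6 \<oplus> p1 \<otimes> p5 \<oplus> p2 \<otimes> p4"
  define t where "t = q2 \<otimes> q0 \<oplus> q3 \<otimes> q1 \<oplus> q4 \<otimes> q2 \<oplus> q5 \<otimes> q3 \<oplus> q6 \<otimes> q4 \<oplus> q7 \<otimes> q5 \<oplus> q0 \<otimes> q6 \<oplus> q1 \<otimes> q7"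
  have [simp]: "a \<in> carrier R" "e \<in> carrier R" "f \<in> carrier R" "f' \<in> carrier R" "d \<in> carrier R" "d' \<in> carrier R" "t \<in> carrier R"
    by (simp_all add: a_def e_def f_def f'_def d_def d'_def t_def)
  have "?C (2, False) = p1 \<otimes> p1 \<oplus> p5 \<otimes> p5 \<oplus> (d \<oplus> d) \<oplus> t"
    unfolding C d_def t_def by (simp add: R.a_ac R.m_ac)
  moreover have "?C (6, False) = p3 \<otimes> p3 \<oplus> p7 \<otimes> p7 \<oplus> (d' \<oplus> d') \<oplus> t"
    unfolding C d'_def t_def by (simp add: R.a_ac R.m_ac)
  ultimately have "p1 \<otimes> p1 \<oplus> p5 \<otimes> p5 \<oplus> (d \<oplus> d) = p3 \<otimes> p3 \<oplus> p7 \<otimes> p7 \<oplus> (d' \<oplus> d')"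
    using even by simp
  \<comment> \<open>In \<open>K\<close> the doubled terms vanish and a sum of squares is the square
    of the sum.\<close>
  from arg_cong[where f=\<rho>, OF this]
  have "\<rho> p1 \<otimes>\<^bsub>K\<^esub> \<rho> p1 \<oplus>\<^bsub>K\<^esub> \<rho> p5 \<otimes>\<^bsub>K\<^esub> \<rho> p5 = \<rho> p3 \<otimes>\<^bsub>K\<^esub> \<rho> p3 \<oplus>\<^bsub>K\<^esub> \<rho> p7 \<otimes>\<^bsub>K\<^esub> \<rho> p7"
    by (simp add: ring_hom_add[OF \<rho>] ring_hom_mult[OF \<rho>] K.char_two_double[OF K_two])
  then have "\<rho> a \<otimes>\<^bsub>K\<^esub> \<rho> a = \<zero>\<^bsub>K\<^esub>"
    by (simp add: a_def ring_hom_add[OF \<rho>] square_add K.char_two_double[OF K_two])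
  then have a: "\<rho> a = \<zero>\<^bsub>K\<^esub>"
    by (simp add: K.integral_iff)
  have double_diff: "(x \<ominus> y) \<oplus> (x \<ominus> y) = \<zero>" if "x \<oplus> x = y \<oplus> y" "x \<in> carrier R" "y \<in> carrier R" for x y
  proof -
    have "(x \<ominus> y) \<oplus> (x \<ominus> y) = (x \<oplus> x) \<ominus> (y \<oplus> y)"
      using that(2,3) by (simp add: R.minus_eq R.minus_add R.a_ac)
    then show ?thesis using that by simp
  qed
  \<comment> \<open>Adding the coefficients at s and w^4 s gives a coefficient in the quotient of
    order 8. There even rotations are central, hence the doubled terms; the odd rotations contribute
    the same product at s and at w^2 s, and it cancels.\<close>
  have "?C (0, True) \<oplus> ?C (4, True) = (P0 \<otimes> Q0 \<oplus> P2 \<otimes> Q2) \<oplus> (P0 \<otimes> Q0 \<oplus> P2 \<otimes> Q2) \<oplus> (P1 \<oplus> P3) \<otimes> (Q1 \<oplus> Q3)"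
    unfolding C P Q by (simp add: R.l_distr R.r_distr R.a_ac R.m_ac)
  moreover have "?C (2, True) \<oplus> ?C (6, True) = (P0 \<otimes> Q2 \<oplus> P2 \<otimes> Q0) \<oplus> (P0 \<otimes> Q2 \<oplus> P2 \<otimes> Q0) \<oplus> (P1 \<oplus> P3) \<otimes> (Q1 \<oplus> Q3)"
    unfolding C P Q by (simp add: R.l_distr R.r_distr R.a_ac R.m_ac)
  ultimately have "P0 \<otimes> Q0 \<oplus> P2 \<otimes> Q2 \<oplus> (P0 \<otimes> Q0 \<oplus> P2 \<otimes> Q2) =
      P0 \<otimes> Q2 \<oplus> P2 \<otimes> Q0 \<oplus> (P0 \<otimes> Q2 \<oplus> P2 \<otimes> Q0)"
    using odd by simp
  \<comment> \<open>Twice this difference is zero in \<open>R\<close>, so the difference itself dies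
    in \<open>K\<close>. It is (P0 - P2) (Q0 - Q2), which becomes the product of \<rho> e and \<rho>
    f.\<close>
  then have "\<rho> (P0 \<otimes> Q0 \<oplus> P2 \<otimes> Q2 \<ominus> (P0 \<otimes> Q2 \<oplus> P2 \<otimes> Q0)) = \<zero>\<^bsub>K\<^esub>"
    by (intro \<rho>_two double_diff) simp_all
  then have ef: "\<rho> e \<otimes>\<^bsub>K\<^esub> \<rho> f = \<zero>\<^bsub>K\<^esub>"
    by (simp add: e_def f_def \<rho>_minus ring_hom_add[OF \<rho>] ring_hom_mult[OF \<rho>] K.l_distr K.r_distr K.a_ac)
  have "?C (1, True) \<oplus> ?C (5, True) = (P0 \<otimes> Q1 \<oplus> P2 \<otimes> Q3) \<oplus> (P0 \<otimes> Q1 \<oplus> P2 \<otimes> Q3) \<oplus> (P1 \<oplus> P3) \<otimes> (Q0 \<oplus> Q2)"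
    unfolding C P Q by (simp add: R.l_distr R.r_distr R.a_ac R.m_ac)
  moreover have "?C (3, True) \<oplus> ?C (7, True) = (P0 \<otimes> Q3 \<oplus> P2 \<otimes> Q1) \<oplus> (P0 \<otimes> Q3 \<oplus> P2 \<otimes> Q1) \<oplus> (P1 \<oplus> P3) \<otimes> (Q0 \<oplus> Q2)"
    unfolding C P Q by (simp add: R.l_distr R.r_distr R.a_ac R.m_ac)
  ultimately have "P0 \<otimes> Q1 \<oplus> P2 \<otimes> Q3 \<oplus> (P0 \<otimes> Q1 \<oplus> P2 \<otimes> Q3) =
      P0 \<otimes> Q3 \<oplus> P2 \<otimes> Q1 \<oplus> (P0 \<otimes> Q3 \<oplus> P2 \<otimes> Q1)"
    using odd by simp
  then have "\<rho> (P0 \<otimes> Q1 \<oplus> P2 \<otimes> Q3 \<ominus> (P0 \<otimes> Q3 \<oplus> P2 \<otimes> Q1)) = \<zero>\<^bsub>K\<^esub>"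
    by (intro \<rho>_two double_diff) simp_all
  then have ef': "\<rho> e \<otimes>\<^bsub>K\<^esub> \<rho> f' = \<zero>\<^bsub>K\<^esub>"
    by (simp add: e_def f'_def \<rho>_minus ring_hom_add[OF \<rho>] ring_hom_mult[OF \<rho>] K.l_distr K.r_distr K.a_ac)
  note hom = ring_hom_add[OF \<rho>] \<rho>_minus
  have par: "parity_x K \<in> carrier dihedral8 \<rightarrow> carrier K" "parity_y K \<in> carrier dihedral8 \<rightarrow> carrier K"
    "(\<lambda>g. \<one>\<^bsub>K\<^esub>) \<in> carrier dihedral8 \<rightarrow> carrier K"
    by (auto simp: parity_x_def parity_y_def)
  have u: "u = \<rho> a \<oplus>\<^bsub>K\<^esub> \<rho> f"
    unfolding u_def lin_expand[OF par(1) F, folded p q] a_def f_def P Q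
    by (simp add: hom parity_x_def K.a_ac)
  have v: "v = \<rho> a \<oplus>\<^bsub>K\<^esub> \<rho> f'"
    unfolding v_def lin_expand[OF par(2) F, folded p q] a_def f'_def P Q
    by (simp add: hom parity_y_def K.a_ac)
  have s: "s = \<rho> e \<oplus>\<^bsub>K\<^esub> \<rho> a \<oplus>\<^bsub>K\<^esub> \<rho> f \<oplus>\<^bsub>K\<^esub> \<rho> f'"
    unfolding s_def lin_expand[OF par(3) F, folded p q] a_def e_def f_def f'_def P Q
    by (simp add: hom K.a_ac)
  have cancel: "x \<oplus>\<^bsub>K\<^esub> (x \<oplus>\<^bsub>K\<^esub> y) = y" if "x \<in> carrier K" "y \<in> carrier K" for x y
    using that K.char_two_double[OF K_two, of x] by (simp flip: K.a_assoc)
  have "s \<oplus>\<^bsub>K\<^esub> u \<oplus>\<^bsub>K\<^esub> v = \<rho> e"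
    by (simp add: s u v a K.a_ac cancel K.char_two_double[OF K_two])
  then show "(s \<oplus>\<^bsub>K\<^esub> u \<oplus>\<^bsub>K\<^esub> v) \<otimes>\<^bsub>K\<^esub> u = \<zero>\<^bsub>K\<^esub>" "(s \<oplus>\<^bsub>K\<^esub> u \<oplus>\<^bsub>K\<^esub> v) \<otimes>\<^bsub>K\<^esub> v = \<zero>\<^bsub>K\<^esub>"
    using ef ef' by (simp_all add: u v a)
qed

end

section \<open>Non-isomorphism\<close>

lemma ring_hom_pow:
  assumes "h \<in> ring_hom A B" "ring A" "ring B" "a \<in> carrier A"
  shows "h (a [^]\<^bsub>A\<^esub> (k::nat)) = h a [^]\<^bsub>B\<^esub> k"
  using ring_hom_ring.hom_nat_pow[OF ring_hom_ringI2[OF assms(2,3,1)] assms(4)] .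

section \<open>Frobenius and two by two determinants over the residue field\<close>

context field
begin

text \<open>Frobenius is injective on a field: (a + b)^(2^k) = 0 forces a + b = 0.\<close>

lemma char_two_root_unique:
  assumes two: "\<one> \<oplus> \<one> = \<zero>" and [simp]: "a \<in> carrier R" "b \<in> carrier R"
    and ab: "a [^] ((2::nat) ^ k) = b [^] ((2::nat) ^ k)"
  shows "a = b"
proof -
  have "c = \<zero>" if "c [^] (j::nat) = \<zero>" "c \<in> carrier R" for c j
    using that by (induction j) (auto simp: integral_iff)
  moreover have "(a \<oplus> b) [^] ((2::nat) ^ k) = \<zero>"
    by (subst frobenius_commuting[OF two]) (simp_all add: ab m_comm char_two_double[OF two])
  ultimately have "a \<oplus> b = b \<oplus> b" by (simp add: char_two_double[OF two])
  then show ?thesis by simp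
qed

text \<open>If the determinant vanished, (v', -u') and (v, -u) would lie in the kernel; then all
  four entries would be zero and (1, 0) would lie in it too.\<close>

lemma nondegenerate_pair:
  assumes [simp]: "u \<in> carrier R" "v \<in> carrier R" "u' \<in> carrier R" "v' \<in> carrier R"
    and ker: "\<And>a b. \<lbrakk>a \<in> carrier R; b \<in> carrier R; a \<otimes> u \<oplus> b \<otimes> v = \<zero>; a \<otimes> u' \<oplus> b \<otimes> v' = \<zero>\<rbrakk>
      \<Longrightarrow> a = \<zero> \<and> b = \<zero>"
  shows "u \<otimes> v' \<noteq> v \<otimes> u'"
proof
  assume eq: "u \<otimes> v' = v \<otimes> u'"
  have "v' = \<zero> \<and> \<ominus> u' = \<zero>"
    using eq by (intro ker) (simp_all add: l_minus m_comm[of v'] m_comm[of u' v] r_neg)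
  moreover have "v = \<zero> \<and> \<ominus> u = \<zero>"
    using eq by (intro ker) (simp_all add: l_minus m_comm[of v u] r_neg)
  ultimately have "u = \<zero>" "v = \<zero>" "u' = \<zero>" "v' = \<zero>" by (auto simp: add.inv_eq_1_iff)
  then have "\<one> = \<zero> \<and> \<zero> = \<zero>" by (intro ker) simp_all
  then show False by simp
qed

end

lemma (in group) centralizer_subgroup:
  assumes [simp]: "c \<in> carrier G"
  shows "subgroup {g \<in> carrier G. c \<otimes> g = g \<otimes> c} G"
proof (rule subgroupI)
  fix g assume "g \<in> {g \<in> carrier G. c \<otimes> g = g \<otimes> c}"
  then have [simp]: "g \<in> carrier G" and comm: "c \<otimes> g = g \<otimes> c" by auto
  have "inv g \<otimes> c = inv g \<otimes> (c \<otimes> g) \<otimes> inv g" by (simp add: m_assoc)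
  also have "\<dots> = c \<otimes> inv g" unfolding comm by (simp add: m_assoc[symmetric])
  finally show "inv g \<in> {g \<in> carrier G. c \<otimes> g = g \<otimes> c}" by simp
next
  fix g h assume "g \<in> {g \<in> carrier G. c \<otimes> g = g \<otimes> c}" "h \<in> {g \<in> carrier G. c \<otimes> g = g \<otimes> c}"
  then have [simp]: "g \<in> carrier G" "h \<in> carrier G" and comm: "c \<otimes> g = g \<otimes> c" "c \<otimes> h = h \<otimes> c" by auto
  have "c \<otimes> (g \<otimes> h) = g \<otimes> (c \<otimes> h)" using comm(1) by (simp add: m_assoc[symmetric])
  also have "\<dots> = g \<otimes> h \<otimes> c" unfolding comm(2) by (simp add: m_assoc)
  finally show "g \<otimes> h \<in> {g \<in> carrier G. c \<otimes> g = g \<otimes> c}" by simp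
qed auto

section \<open>Powers in the group algebra of a cyclic group\<close>

context group_alg
begin

lemma basis_central:
  assumes c: "c \<in> carrier G" "\<And>g. g \<in> carrier G \<Longrightarrow> c \<otimes>\<^bsub>G\<^esub> g = g \<otimes>\<^bsub>G\<^esub> c" and "f \<in> carrier RG"
  shows "basis c \<otimes>\<^bsub>RG\<^esub> f = f \<otimes>\<^bsub>RG\<^esub> basis c"
  using assms(3)
  by (induction f rule: elem_induct) (simp_all add: c basis_def gsingle_mult RG.l_distr RG.r_distr)

lemma mult_commutative:
  assumes comm: "\<And>g h. g \<in> carrier G \<Longrightarrow> h \<in> carrier G \<Longrightarrow> g \<otimes>\<^bsub>G\<^esub> h = h \<otimes>\<^bsub>G\<^esub> g"
    and f: "f \<in> carrier RG" "f' \<in> carrier RG"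
  shows "f \<otimes>\<^bsub>RG\<^esub> f' = f' \<otimes>\<^bsub>RG\<^esub> f"
  using f(1)
proof (induction f rule: elem_induct)
  case (single r g)
  show ?case using f(2)
    by (induction f' rule: elem_induct)
      (use single in \<open>simp_all add: gsingle_mult RG.l_distr RG.r_distr comm[of g] R.m_comm[of r]\<close>)
qed (simp add: f RG.l_distr RG.r_distr)

lemma gsingle_pow:
  "r \<in> carrier R \<Longrightarrow> g \<in> carrier G \<Longrightarrow> gsingle R G r g [^]\<^bsub>RG\<^esub> (k::nat) = gsingle R G (r [^] k) (g [^]\<^bsub>G\<^esub> k)"
  by (induction k) (simp_all add: one_eq gsingle_mult)

text \<open>
  In characteristic two the \<open>2 ^ m\<close>-th power of an element of the group algebra of a cyclic group of
  order \<open>2 ^ (m + 1)\<close> only involves the two sums of the coefficients over the even and the odd exponents.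
\<close>

lemma cyclic_quotient_power:
  assumes K: "field K" and \<rho>: "\<rho> \<in> ring_hom R K" and two: "\<one>\<^bsub>K\<^esub> \<oplus>\<^bsub>K\<^esub> \<one>\<^bsub>K\<^esub> = \<zero>\<^bsub>K\<^esub>"
    and \<kappa>: "\<kappa> \<in> hom G (integer_mod_group (2 ^ Suc m))"
  defines "\<chi> \<equiv> \<lambda>g. if odd (\<kappa> g) then \<one>\<^bsub>K\<^esub> else \<zero>\<^bsub>K\<^esub>"
  assumes f: "f \<in> carrier RG" "f' \<in> carrier RG" and eq: "f [^]\<^bsub>RG\<^esub> ((2::nat) ^ m) = f' [^]\<^bsub>RG\<^esub> ((2::nat) ^ m)"
  shows "lin K \<rho> (\<lambda>g. \<one>\<^bsub>K\<^esub>) f = lin K \<rho> (\<lambda>g. \<one>\<^bsub>K\<^esub>) f'" "lin K \<rho> \<chi> f = lin K \<rho> \<chi> f'"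
proof -
  define C where "C = integer_mod_group (2 ^ Suc m)"
  have C: "group C" "\<one>\<^bsub>C\<^esub> = 0" "0 \<in> carrier C" "(2::int) ^ m \<in> carrier C"
    "j \<otimes>\<^bsub>C\<^esub> k = k \<otimes>\<^bsub>C\<^esub> j" "j [^]\<^bsub>C\<^esub> (i::nat) = int i * j mod 2 ^ Suc m" for j k i
    by (simp_all add: C_def add.commute carrier_integer_mod_group)
  note \<kappa> = \<kappa>[folded C_def]
  interpret K: field K by fact
  interpret C: group_alg K C by (intro group_alg.intro K.cring_axioms C(1))
  have C_two: "\<one>\<^bsub>C.RG\<^esub> \<oplus>\<^bsub>C.RG\<^esub> \<one>\<^bsub>C.RG\<^esub> = \<zero>\<^bsub>C.RG\<^esub>"
    unfolding C.one_eq C.gsingle_add[OF K.one_closed K.one_closed, symmetric] two C.gsingle_zero ..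
  have C_comm: "F \<otimes>\<^bsub>C.RG\<^esub> F' = F' \<otimes>\<^bsub>C.RG\<^esub> F" if "F \<in> carrier C.RG" "F' \<in> carrier C.RG" for F F'
    using that by (intro C.mult_commutative C(5))
  let ?c = "\<lambda>g. C.basis (\<kappa> g)" and ?r = "\<lambda>r. gsingle K C (\<rho> r) \<one>\<^bsub>C\<^esub>"
  have r: "?r \<in> ring_hom R C.RG"
    using ring_hom_trans[OF \<rho> C.const_hom] by (simp only: comp_def)
  have c: "?c \<in> hom G (units_of C.RG)"
    using hom_compose[OF \<kappa> C.basis_hom] by (simp only: comp_def)
  have \<kappa>_mem: "\<kappa> g \<in> carrier C" if "g \<in> carrier G" for g
    using hom_in_carrier[OF \<kappa> that] .
  define \<pi> where "\<pi> = lin C.RG ?r ?c"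
  have \<pi>: "\<pi> \<in> ring_hom RG C.RG"
    unfolding \<pi>_def
    by (rule lin_ring_hom[OF C.RG.ring_axioms r c]) (intro C.const_comm ring_hom_closed[OF \<rho>] C.basis_mem)
  have \<chi>: "\<chi> \<in> carrier G \<rightarrow> carrier K" and one: "(\<lambda>g. \<one>\<^bsub>K\<^esub>) \<in> carrier G \<rightarrow> carrier K"
    by (auto simp: \<chi>_def)
  have \<chi>_app: "\<chi> g = (if odd (\<kappa> g) then \<one>\<^bsub>K\<^esub> else \<zero>\<^bsub>K\<^esub>)" for g
    by (simp add: \<chi>_def)
  have c': "?c \<in> carrier G \<rightarrow> carrier C.RG" by simp
  note lin = lin_gsingle[OF K.ring_axioms \<rho>] lin_add[OF K.ring_axioms \<rho>] lin_closed[OF K.ring_axioms \<rho>]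
  let ?N = "(2::nat) ^ m"
  \<comment> \<open>In characteristic two the full sum plus the sum over odd exponents is the sum
    over even exponents.\<close>
  let ?e = "\<lambda>f. lin K \<rho> (\<lambda>g. \<one>\<^bsub>K\<^esub>) f \<oplus>\<^bsub>K\<^esub> lin K \<rho> \<chi> f"
  have zero_pow: "\<zero>\<^bsub>K\<^esub> [^]\<^bsub>K\<^esub> ?N = \<zero>\<^bsub>K\<^esub>" by (simp add: K.nat_pow_zero)
  have frob: "(a \<oplus>\<^bsub>K\<^esub> b) [^]\<^bsub>K\<^esub> ?N = a [^]\<^bsub>K\<^esub> ?N \<oplus>\<^bsub>K\<^esub> b [^]\<^bsub>K\<^esub> ?N" if "a \<in> carrier K" "b \<in> carrier K" for a b
    using that by (intro K.frobenius_commuting[OF two] K.m_comm)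
  have frob': "(a \<oplus>\<^bsub>C.RG\<^esub> b) [^]\<^bsub>C.RG\<^esub> ?N = a [^]\<^bsub>C.RG\<^esub> ?N \<oplus>\<^bsub>C.RG\<^esub> b [^]\<^bsub>C.RG\<^esub> ?N"
    if "a \<in> carrier C.RG" "b \<in> carrier C.RG" for a b
    using that by (intro C.RG.frobenius_commuting[OF C_two] C_comm)
  \<comment> \<open>Raising to the power 2^m multiplies exponents by 2^m modulo 2^(m+1), so only
    their parity survives. Both sides are additive in f by Frobenius, the cyclic group algebra being
    commutative, so monomials suffice.\<close>
  have power: "\<pi> f [^]\<^bsub>C.RG\<^esub> ?N = gsingle K C (?e f [^]\<^bsub>K\<^esub> ?N) 0 \<oplus>\<^bsub>C.RG\<^esub> gsingle K C (lin K \<rho> \<chi> f [^]\<^bsub>K\<^esub> ?N) (2 ^ m)"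
    if "f \<in> carrier RG" for f
    using that
  proof (induction f rule: elem_induct)
    case (single r g)
    have \<rho>r: "\<rho> r \<in> carrier K" using ring_hom_closed[OF \<rho> single(1)] .
    have "\<pi> (gsingle R G r g) = gsingle K C (\<rho> r) (\<kappa> g)"
      unfolding \<pi>_def using single \<rho>r \<kappa>_mem
      by (simp only: lin_gsingle[OF C.RG.ring_axioms r c'] C.const_mult_basis)
    then have *: "\<pi> (gsingle R G r g) [^]\<^bsub>C.RG\<^esub> ?N = gsingle K C (\<rho> r [^]\<^bsub>K\<^esub> ?N) (\<kappa> g [^]\<^bsub>C\<^esub> ?N)"
      using single \<rho>r \<kappa>_mem by (simp only: C.gsingle_pow)
    have mem: "gsingle K C (\<rho> r [^]\<^bsub>K\<^esub> ?N) k \<in> carrier C.RG" for k using \<rho>r by simp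
    show ?case
    proof (cases "odd (\<kappa> g)")
      case True
      then obtain j where j: "\<kappa> g = 2 * j + 1" by (auto elim: oddE)
      have "\<kappa> g [^]\<^bsub>C\<^esub> ?N = 2 ^ m"
      proof -
        have "2 ^ m * \<kappa> g = 2 ^ m + j * 2 ^ Suc m" by (simp add: j algebra_simps)
        then show ?thesis by (simp add: C(6))
      qed
      moreover have "lin K \<rho> \<chi> (gsingle R G r g) = \<rho> r" "?e (gsingle R G r g) = \<zero>\<^bsub>K\<^esub>"
        using True single \<rho>r by (simp_all add: lin \<chi> \<chi>_app K.char_two_double[OF two])
      ultimately show ?thesis using mem unfolding * by (simp add: zero_pow C.gsingle_zero)
    next
      case False
      then obtain j where j: "\<kappa> g = 2 * j" by (auto elim: evenE)
      have "\<kappa> g [^]\<^bsub>C\<^esub> ?N = 0"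
      proof -
        have "2 ^ m * \<kappa> g = j * 2 ^ Suc m" by (simp add: j algebra_simps)
        then show ?thesis by (simp add: C(6))
      qed
      moreover have "lin K \<rho> \<chi> (gsingle R G r g) = \<zero>\<^bsub>K\<^esub>" "?e (gsingle R G r g) = \<rho> r"
        using False single \<rho>r by (simp_all add: lin \<chi> \<chi>_app)
      ultimately show ?thesis using mem unfolding * by (simp add: zero_pow C.gsingle_zero)
    qed
  next
    case (add f f')
    have e_closed: "lin K \<rho> (\<lambda>g. \<one>\<^bsub>K\<^esub>) F \<in> carrier K" "lin K \<rho> \<chi> F \<in> carrier K" "\<pi> F \<in> carrier C.RG"
      if "F \<in> carrier RG" for F
      using that ring_hom_closed[OF \<pi>] by (simp_all add: lin \<chi>)
    have e: "?e (f \<oplus>\<^bsub>RG\<^esub> f') = ?e f \<oplus>\<^bsub>K\<^esub> ?e f'"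
      using add e_closed by (simp add: lin \<chi> K.a_ac)
    have d: "lin K \<rho> \<chi> (f \<oplus>\<^bsub>RG\<^esub> f') = lin K \<rho> \<chi> f \<oplus>\<^bsub>K\<^esub> lin K \<rho> \<chi> f'"
      using add by (simp add: lin \<chi>)
    have exchange: "a \<oplus>\<^bsub>C.RG\<^esub> b \<oplus>\<^bsub>C.RG\<^esub> (c \<oplus>\<^bsub>C.RG\<^esub> d) = a \<oplus>\<^bsub>C.RG\<^esub> c \<oplus>\<^bsub>C.RG\<^esub> (b \<oplus>\<^bsub>C.RG\<^esub> d)"
      if "a \<in> carrier C.RG" "b \<in> carrier C.RG" "c \<in> carrier C.RG" "d \<in> carrier C.RG" for a b c d
      using that by (simp add: C.RG.a_ac)
    have single_pow: "gsingle K C ((a \<oplus>\<^bsub>K\<^esub> b) [^]\<^bsub>K\<^esub> ?N) k =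
        gsingle K C (a [^]\<^bsub>K\<^esub> ?N) k \<oplus>\<^bsub>C.RG\<^esub> gsingle K C (b [^]\<^bsub>K\<^esub> ?N) k"
      if "a \<in> carrier K" "b \<in> carrier K" for a b k
      using that by (simp only: frob C.gsingle_add K.nat_pow_closed)
    have "\<pi> (f \<oplus>\<^bsub>RG\<^esub> f') [^]\<^bsub>C.RG\<^esub> ?N = \<pi> f [^]\<^bsub>C.RG\<^esub> ?N \<oplus>\<^bsub>C.RG\<^esub> \<pi> f' [^]\<^bsub>C.RG\<^esub> ?N"
      using add(1,2) e_closed by (simp only: ring_hom_add[OF \<pi>] frob')
    also have "\<dots> = gsingle K C (?e (f \<oplus>\<^bsub>RG\<^esub> f') [^]\<^bsub>K\<^esub> ?N) 0 \<oplus>\<^bsub>C.RG\<^esub>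
        gsingle K C (lin K \<rho> \<chi> (f \<oplus>\<^bsub>RG\<^esub> f') [^]\<^bsub>K\<^esub> ?N) (2 ^ m)"
      unfolding e add(3,4) unfolding d using add(1,2) e_closed
      by (simp only: single_pow K.a_closed exchange C.gsingle_mem K.nat_pow_closed C.add_mem)
    finally show ?case .
  qed
  have "\<pi> f [^]\<^bsub>C.RG\<^esub> ?N = \<pi> f' [^]\<^bsub>C.RG\<^esub> ?N"
    using eq f by (simp flip: ring_hom_pow[OF \<pi> RG.ring_axioms C.RG.ring_axioms])
  note coeffs = this[unfolded power[OF f(1)] power[OF f(2)], THEN fun_cong]
  have closed: "lin K \<rho> (\<lambda>g. \<one>\<^bsub>K\<^esub>) F \<in> carrier K" "lin K \<rho> \<chi> F \<in> carrier K" if "F \<in> carrier RG" for F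
    using that by (simp_all add: lin \<chi>)
  \<comment> \<open>The exponents 0 and 2^m are distinct modulo 2^(m+1), so the two powers can be
    read off as separate coefficients.\<close>
  have e_pow: "?e f [^]\<^bsub>K\<^esub> ?N = ?e f' [^]\<^bsub>K\<^esub> ?N"
    using coeffs[of 0] closed f by (simp add: C.gsingle_app C(3))
  have e: "?e f = ?e f'"
    by (rule K.char_two_root_unique[OF two _ _ e_pow]) (use closed f in simp_all)
  have d_pow: "lin K \<rho> \<chi> f [^]\<^bsub>K\<^esub> ?N = lin K \<rho> \<chi> f' [^]\<^bsub>K\<^esub> ?N"
    using coeffs[of "2 ^ m"] closed f by (simp add: C.gsingle_app C(4))
  show d: "lin K \<rho> \<chi> f = lin K \<rho> \<chi> f'"
    by (rule K.char_two_root_unique[OF two _ _ d_pow]) (use closed f in simp_all)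
  show "lin K \<rho> (\<lambda>g. \<one>\<^bsub>K\<^esub>) f = lin K \<rho> (\<lambda>g. \<one>\<^bsub>K\<^esub>) f'"
    using e closed f unfolding d by simp
qed

end

section \<open>Parity characters and the two quotients of G\<close>

lemma parity_dihedral8:
  assumes two: "\<one>\<^bsub>K\<^esub> \<oplus>\<^bsub>K\<^esub> \<one>\<^bsub>K\<^esub> = \<zero>\<^bsub>K\<^esub>" and "ring K"
  shows "parity_x K \<in> hom dihedral8 (add_monoid K)" "parity_y K \<in> hom dihedral8 (add_monoid K)"
proof -
  interpret K: ring K by fact
  have "odd (i mod 8) = odd i" for i :: int by presburger
  then show "parity_x K \<in> hom dihedral8 (add_monoid K)" "parity_y K \<in> hom dihedral8 (add_monoid K)"
    by (auto simp: hom_def parity_x_def parity_y_def mult_dihedral8 two split: if_splits)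
qed

text \<open>With x = s and y = w s the products y x and x y are w and w^(-1), the latter appearing
  as (7, False). Their 2^l-th powers agree because w^8 = 1 and 4 divides 2^l.\<close>

lemma G_dihedral_quotient:
  assumes "n \<ge> 1" "m \<ge> 1" "l \<ge> 2"
  shows "\<exists>\<phi> \<in> hom (group_G n m l) dihedral8. \<phi> (G_x n m l) = (0, True) \<and> \<phi> (G_y n m l) = (1, True)"
proof (rule G_hom_exists[OF group_dihedral8])
  interpret D: group dihedral8 by (rule group_dihedral8)
  have sq: "(0, True) \<otimes>\<^bsub>dihedral8\<^esub> (0, True) = \<one>\<^bsub>dihedral8\<^esub>" "(1, True) \<otimes>\<^bsub>dihedral8\<^esub> (1, True) = \<one>\<^bsub>dihedral8\<^esub>"
    by (simp_all add: mult_dihedral8 one_dihedral8)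
  have pow: "g [^]\<^bsub>dihedral8\<^esub> ((2::nat) ^ k) = \<one>\<^bsub>dihedral8\<^esub>"
    if "g \<otimes>\<^bsub>dihedral8\<^esub> g = \<one>\<^bsub>dihedral8\<^esub>" "g \<in> carrier dihedral8" "k \<ge> 1" for g k
  proof -
    have "(2::nat) ^ k = 2 * 2 ^ (k - 1)" using \<open>k \<ge> 1\<close> by (simp flip: power_Suc)
    then show ?thesis using that by (simp add: D.pow_two flip: D.nat_pow_pow)
  qed
  show mem: "(0, True) \<in> carrier dihedral8" "(1, True) \<in> carrier dihedral8"
    by (simp_all add: carrier_dihedral8)
  show "(0, True) [^]\<^bsub>dihedral8\<^esub> ((2::nat) ^ n) = \<one>\<^bsub>dihedral8\<^esub>" "(1, True) [^]\<^bsub>dihedral8\<^esub> ((2::nat) ^ m) = \<one>\<^bsub>dihedral8\<^esub>"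
    using sq mem assms by (simp_all add: pow)
  have w: "(1, True) \<otimes>\<^bsub>dihedral8\<^esub> (0, True) = (1, False)" "(0, True) \<otimes>\<^bsub>dihedral8\<^esub> (1, True) = (7, False)"
    by (simp_all add: mult_dihedral8)
  have "(2::nat) ^ l = 4 * 2 ^ (l - 2)" using \<open>l \<ge> 2\<close> by (metis le_add_diff_inverse power2_eq_square power_add mult_2 numeral_Bit0 numeral_One one_add_one)
  moreover have "(1, False) [^]\<^bsub>dihedral8\<^esub> (4::nat) = (7, False) [^]\<^bsub>dihedral8\<^esub> (4::nat)"
    by (simp add: numeral_eq_Suc mult_dihedral8 one_dihedral8)
  ultimately have "(1, False) [^]\<^bsub>dihedral8\<^esub> ((2::nat) ^ l) = (7, False) [^]\<^bsub>dihedral8\<^esub> ((2::nat) ^ l)"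
    by (simp add: carrier_dihedral8 flip: D.nat_pow_pow)
  then show "almost_dihedral dihedral8 l (0, True) (1, True)"
    using mem unfolding almost_dihedral_def sq w by simp
qed

text \<open>The order 2^(m+1) divides 2^n because n > m, and x^(2^m) still has a nontrivial
  image.\<close>

lemma G_cyclic_quotient:
  assumes "n > m"
  shows "\<exists>\<kappa> \<in> hom (group_G n m l) (integer_mod_group (2 ^ Suc m)). \<kappa> (G_x n m l) = 1 \<and> \<kappa> (G_y n m l) = 0"
proof (rule G_hom_exists)
  have "(2::int) ^ Suc m dvd 2 ^ n" using assms by (intro le_imp_power_dvd) simp
  then show "1 [^]\<^bsub>integer_mod_group (2 ^ Suc m)\<^esub> ((2::nat) ^ n) = \<one>\<^bsub>integer_mod_group (2 ^ Suc m)\<^esub>"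
    by simp
  have "(1::int) < 2 ^ Suc m" by (rule one_less_power) simp_all
  then show "1 \<in> carrier (integer_mod_group (2 ^ Suc m))"
    by (simp add: carrier_integer_mod_group)
qed (simp_all add: almost_dihedral_def)

section \<open>The contradiction from an isomorphism\<close>

context dihedral_alg
begin

lemma K_pars: "parity_x K \<in> carrier dihedral8 \<rightarrow> carrier K" "parity_y K \<in> carrier dihedral8 \<rightarrow> carrier K"
  by (auto simp: parity_x_def parity_y_def)

theorem not_isomorphic:
  assumes nml: "n > m" "m > l" "l \<ge> 2"
  shows "\<not> algebra_isomorphic R (group_algebra R (group_G n m l)) (group_algebra R (group_H n m l))"
proof
  let ?G = "group_G n m l" and ?H = "group_H n m l"
  let ?x = "G_x n m l" and ?y = "G_y n m l" and ?a = "H_a n m l" and ?b = "H_b n m l"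
  interpret G: group_alg R ?G by (intro group_alg.intro R.cring_axioms group_group_G)
  interpret H: group_alg R ?H by (intro group_alg.intro R.cring_axioms group_group_H)
  assume "algebra_isomorphic R G.RG H.RG"
  then obtain h where h: "h \<in> ring_hom H.RG G.RG" and surj: "h ` carrier H.RG = carrier G.RG"
    and h_smult: "\<And>r f. r \<in> carrier R \<Longrightarrow> f \<in> carrier H.RG \<Longrightarrow> h (r \<odot>\<^bsub>H.RG\<^esub> f) = r \<odot>\<^bsub>G.RG\<^esub> h f"
  proof -
    assume iso: "algebra_isomorphic R G.RG H.RG"
      and that: "\<And>h. h \<in> ring_hom H.RG G.RG \<Longrightarrow> h ` carrier H.RG = carrier G.RG \<Longrightarrow>
        (\<And>r f. r \<in> carrier R \<Longrightarrow> f \<in> carrier H.RG \<Longrightarrow> h (r \<odot>\<^bsub>H.RG\<^esub> f) = r \<odot>\<^bsub>G.RG\<^esub> h f) \<Longrightarrow> thesis"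
    \<comment> \<open>The images of a and b inside RG are needed, hence the inverse of the given
      isomorphism, whose linearity over \<open>R\<close> is checked here.\<close>
    from iso obtain k where k: "k \<in> ring_iso G.RG H.RG"
      and k_smult: "\<And>r f. r \<in> carrier R \<Longrightarrow> f \<in> carrier G.RG \<Longrightarrow> k (r \<odot>\<^bsub>G.RG\<^esub> f) = r \<odot>\<^bsub>H.RG\<^esub> k f"
      unfolding algebra_isomorphic_def by blast
    have bij: "bij_betw k (carrier G.RG) (carrier H.RG)" using k by (simp add: ring_iso_def)
    let ?h = "inv_into (carrier G.RG) k"
    have h: "?h \<in> ring_iso H.RG G.RG" by (rule ring_iso_set_sym[OF G.RG.ring_axioms k])
    show thesis
    proof (rule that)
      show "?h \<in> ring_hom H.RG G.RG" "?h ` carrier H.RG = carrier G.RG"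
        using h by (auto simp: ring_iso_def bij_betw_def)
      fix r f assume rf: "r \<in> carrier R" "f \<in> carrier H.RG"
      then have hf: "?h f \<in> carrier G.RG" "k (?h f) = f"
        using bij bij_betw_inv_into_right[OF bij] inv_into_into[of f k "carrier G.RG"]
        by (auto simp: bij_betw_def)
      then have "r \<odot>\<^bsub>H.RG\<^esub> f = k (r \<odot>\<^bsub>G.RG\<^esub> ?h f)" using rf by (simp add: k_smult)
      then show "?h (r \<odot>\<^bsub>H.RG\<^esub> f) = r \<odot>\<^bsub>G.RG\<^esub> ?h f"
        using bij_betw_inv_into_left[OF bij] hf rf by (simp add: G.smult_mem)
    qed
  qed
  note h_closed = ring_hom_closed[OF h]
  obtain \<phi> where \<phi>: "\<phi> \<in> hom ?G dihedral8" "\<phi> ?x = (0, True)" "\<phi> ?y = (1, True)"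
    using G_dihedral_quotient[of n m l] nml by auto
  obtain \<kappa> where \<kappa>: "\<kappa> \<in> hom ?G (integer_mod_group (2 ^ Suc m))" "\<kappa> ?x = 1" "\<kappa> ?y = 0"
    using G_cyclic_quotient[of m n l] nml by auto
  have \<phi>_mem: "\<phi> \<in> carrier ?G \<rightarrow> carrier dihedral8" using hom_in_carrier[OF \<phi>(1)] by auto
  let ?\<chi> = "\<lambda>g. parity_x K (\<phi> g)" and ?\<chi>' = "\<lambda>g. parity_y K (\<phi> g)" and ?one = "\<lambda>g. \<one>\<^bsub>K\<^esub>"
  have \<chi>_hom: "?\<chi> \<in> hom ?G (add_monoid K)" "?\<chi>' \<in> hom ?G (add_monoid K)"
    using hom_compose[OF \<phi>(1) parity_dihedral8(1)[OF K_two K.ring_axioms]]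
      hom_compose[OF \<phi>(1) parity_dihedral8(2)[OF K_two K.ring_axioms]] by (simp_all add: comp_def)
  have \<chi>_mem: "?\<chi> \<in> carrier ?G \<rightarrow> carrier K" "?\<chi>' \<in> carrier ?G \<rightarrow> carrier K" "?one \<in> carrier ?G \<rightarrow> carrier K"
    using \<phi>_mem K_pars by auto
  \<comment> \<open>Both characters send x to 1 and y to 0, so they agree on G. This ties the two
    quotients together: \<open>?u\<close> can be computed in either of them.\<close>
  have \<chi>_\<kappa>: "?\<chi> g = (if odd (\<kappa> g) then \<one>\<^bsub>K\<^esub> else \<zero>\<^bsub>K\<^esub>)" if "g \<in> carrier ?G" for g
  proof -
    have "odd (i mod 2 ^ Suc m) = odd i" for i :: int
      by (simp add: dvd_mod_iff)
    then have "(\<lambda>g. if odd (\<kappa> g) then \<one>\<^bsub>K\<^esub> else \<zero>\<^bsub>K\<^esub>) \<in> hom ?G (add_monoid K)"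
      by (intro homI) (simp_all add: hom_mult[OF \<kappa>(1)] K_two)
    then have "subgroup {g \<in> carrier ?G. ?\<chi> g = (if odd (\<kappa> g) then \<one>\<^bsub>K\<^esub> else \<zero>\<^bsub>K\<^esub>)} ?G"
      by (intro hom_eq_on_subgroup[OF G.G.is_group K.add.is_group] \<chi>_hom)
    then have "carrier ?G = {g \<in> carrier ?G. ?\<chi> g = (if odd (\<kappa> g) then \<one>\<^bsub>K\<^esub> else \<zero>\<^bsub>K\<^esub>)}"
      by (rule G_subgroup) (simp_all add: \<phi> \<kappa> parity_x_def)
    then show ?thesis using that by blast
  qed
  \<comment> \<open>\<open>?s\<close> is the augmentation; in terms of the class sums,
    \<open>?u\<close> is e_10 + e_11 and \<open>?v\<close> is e_01 + e_11.\<close>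
  let ?s = "G.lin K \<rho> ?one" and ?u = "G.lin K \<rho> ?\<chi>" and ?v = "G.lin K \<rho> ?\<chi>'"
  let ?A = "h (H.basis ?a)" and ?B = "h (H.basis ?b)"
  have AB [simp]: "?A \<in> carrier G.RG" "?B \<in> carrier G.RG" by (simp_all add: h_closed)
  have closed [simp]: "?s F \<in> carrier K" "?u F \<in> carrier K" "?v F \<in> carrier K" if "F \<in> carrier G.RG" for F
    using that \<chi>_mem by (simp_all add: G.lin_closed[OF K.ring_axioms \<rho>])

  have "?A [^]\<^bsub>G.RG\<^esub> ((2::nat) ^ m) = ?B [^]\<^bsub>G.RG\<^esub> ((2::nat) ^ m)"
    by (simp add: H.basis_pow H_relations flip: ring_hom_pow[OF h H.RG.ring_axioms G.RG.ring_axioms])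
  note cyc = G.cyclic_quotient_power[OF K.field_axioms \<rho> K_two \<kappa>(1) AB this]
  have lin_cong: "G.lin K \<rho> (\<lambda>g. if odd (\<kappa> g) then \<one>\<^bsub>K\<^esub> else \<zero>\<^bsub>K\<^esub>) F = ?u F" if "F \<in> carrier G.RG" for F
    unfolding G.lin_def using that \<chi>_mem(1) \<chi>_\<kappa>
    by (intro K.finsum_cong') (auto intro!: K.m_closed ring_hom_closed[OF \<rho>])
  have AB_eq: "?s ?A = ?s ?B" "?u ?A = ?u ?B"
    using cyc by (simp_all add: lin_cong)

  \<comment> \<open>As \<open>h\<close> is surjective, centrality of g^2 in H makes F^2 central in
    RG. Its image in the dihedral algebra then commutes with s and w, the images of x and y
    x.\<close>
  have key: "(?s F \<oplus>\<^bsub>K\<^esub> ?u F \<oplus>\<^bsub>K\<^esub> ?v F) \<otimes>\<^bsub>K\<^esub> ?u F = \<zero>\<^bsub>K\<^esub>" "(?s F \<oplus>\<^bsub>K\<^esub> ?u F \<oplus>\<^bsub>K\<^esub> ?v F) \<otimes>\<^bsub>K\<^esub> ?v F = \<zero>\<^bsub>K\<^esub>"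
    if g: "g \<in> carrier ?H" and F: "F = h (H.basis g)"
      and central: "g \<otimes>\<^bsub>?H\<^esub> g \<otimes>\<^bsub>?H\<^esub> ?a = ?a \<otimes>\<^bsub>?H\<^esub> (g \<otimes>\<^bsub>?H\<^esub> g)" "g \<otimes>\<^bsub>?H\<^esub> g \<otimes>\<^bsub>?H\<^esub> ?b = ?b \<otimes>\<^bsub>?H\<^esub> (g \<otimes>\<^bsub>?H\<^esub> g)"
    for g F
  proof -
    have F_mem [simp]: "F \<in> carrier G.RG" using g by (simp add: F h_closed)
    define S where "S = {k \<in> carrier ?H. g \<otimes>\<^bsub>?H\<^esub> g \<otimes>\<^bsub>?H\<^esub> k = k \<otimes>\<^bsub>?H\<^esub> (g \<otimes>\<^bsub>?H\<^esub> g)}"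
    have "subgroup S ?H" unfolding S_def using g by (intro H.G.centralizer_subgroup) simp
    moreover have "?a \<in> S" "?b \<in> S" using central by (simp_all add: S_def)
    ultimately have cent: "carrier ?H = S" by (rule H_subgroup)
    have comm: "F \<otimes>\<^bsub>G.RG\<^esub> F \<otimes>\<^bsub>G.RG\<^esub> f = f \<otimes>\<^bsub>G.RG\<^esub> (F \<otimes>\<^bsub>G.RG\<^esub> F)" if "f \<in> carrier G.RG" for f
    proof -
      from that have "f \<in> h ` carrier H.RG" unfolding surj .
      then obtain f' where f': "f' \<in> carrier H.RG" "f = h f'" by blast
      have "g \<otimes>\<^bsub>?H\<^esub> g \<otimes>\<^bsub>?H\<^esub> k = k \<otimes>\<^bsub>?H\<^esub> (g \<otimes>\<^bsub>?H\<^esub> g)" if "k \<in> carrier ?H" for k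
        using that unfolding cent by (simp add: S_def)
      then have "H.basis (g \<otimes>\<^bsub>?H\<^esub> g) \<otimes>\<^bsub>H.RG\<^esub> f' = f' \<otimes>\<^bsub>H.RG\<^esub> H.basis (g \<otimes>\<^bsub>?H\<^esub> g)"
        using g f' by (intro H.basis_central) simp_all
      then have "h (H.basis (g \<otimes>\<^bsub>?H\<^esub> g)) \<otimes>\<^bsub>G.RG\<^esub> f = f \<otimes>\<^bsub>G.RG\<^esub> h (H.basis (g \<otimes>\<^bsub>?H\<^esub> g))"
        using f' by (simp flip: ring_hom_mult[OF h])
      moreover have "h (H.basis (g \<otimes>\<^bsub>?H\<^esub> g)) = F \<otimes>\<^bsub>G.RG\<^esub> F"
        using g by (simp add: F ring_hom_mult[OF h] flip: H.basis_mult)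
      ultimately show ?thesis by simp
    qed
    let ?c = "\<lambda>k. basis (\<phi> k)" and ?r = "\<lambda>r. gsingle R dihedral8 r \<one>\<^bsub>dihedral8\<^esub>"
    define \<Psi> where "\<Psi> = G.lin RG ?r ?c"
    have c: "?c \<in> hom ?G (units_of RG)"
      using hom_compose[OF \<phi>(1) basis_hom] by (simp add: comp_def)
    have \<Psi>: "\<Psi> \<in> ring_hom G.RG RG"
      unfolding \<Psi>_def by (rule G.lin_ring_hom[OF RG.ring_axioms const_hom c]) (simp add: const_comm)
    have \<Psi>_basis: "\<Psi> (G.basis k) = basis (\<phi> k)" if "k \<in> carrier ?G" for k
      using that unfolding \<Psi>_def G.basis_def
      by (simp add: G.lin_gsingle[OF RG.ring_axioms const_hom] flip: one_eq)
    have comm': "basis (\<phi> k) \<otimes>\<^bsub>RG\<^esub> (\<Psi> F \<otimes>\<^bsub>RG\<^esub> \<Psi> F) = \<Psi> F \<otimes>\<^bsub>RG\<^esub> \<Psi> F \<otimes>\<^bsub>RG\<^esub> basis (\<phi> k)" if "k \<in> carrier ?G" for k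
    proof -
      have "\<Psi> (G.basis k \<otimes>\<^bsub>G.RG\<^esub> (F \<otimes>\<^bsub>G.RG\<^esub> F)) = \<Psi> (F \<otimes>\<^bsub>G.RG\<^esub> F \<otimes>\<^bsub>G.RG\<^esub> G.basis k)"
        by (simp add: comm)
      then show ?thesis using that by (simp add: ring_hom_mult[OF \<Psi>] \<Psi>_basis)
    qed
    have \<phi>_yx: "\<phi> (?y \<otimes>\<^bsub>?G\<^esub> ?x) = (1, False)"
      by (simp add: hom_mult[OF \<phi>(1)] \<phi> mult_dihedral8)
    have lin: "lin K \<rho> \<chi> (\<Psi> F) = G.lin K \<rho> (\<lambda>g. \<chi> (\<phi> g)) F" if "\<chi> \<in> carrier dihedral8 \<rightarrow> carrier K" for \<chi>
      unfolding \<Psi>_def by (rule G.lin_pushforward[OF K.ring_axioms \<rho> group_alg_axioms \<phi>_mem that F_mem])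
    show "(?s F \<oplus>\<^bsub>K\<^esub> ?u F \<oplus>\<^bsub>K\<^esub> ?v F) \<otimes>\<^bsub>K\<^esub> ?u F = \<zero>\<^bsub>K\<^esub>" "(?s F \<oplus>\<^bsub>K\<^esub> ?u F \<oplus>\<^bsub>K\<^esub> ?v F) \<otimes>\<^bsub>K\<^esub> ?v F = \<zero>\<^bsub>K\<^esub>"
      using square_commuting[OF ring_hom_closed[OF \<Psi> F_mem]] comm'[of ?x] comm'[of "?y \<otimes>\<^bsub>?G\<^esub> ?x"]
      by (simp_all add: \<phi>(2) \<phi>_yx lin K_pars)
  qed
  have ad: "almost_dihedral ?H l ?a ?b" by (rule H_relations)
  then have "(?s ?A \<oplus>\<^bsub>K\<^esub> ?u ?A \<oplus>\<^bsub>K\<^esub> ?v ?A) \<otimes>\<^bsub>K\<^esub> ?u ?A = \<zero>\<^bsub>K\<^esub>" "(?s ?A \<oplus>\<^bsub>K\<^esub> ?u ?A \<oplus>\<^bsub>K\<^esub> ?v ?A) \<otimes>\<^bsub>K\<^esub> ?v ?A = \<zero>\<^bsub>K\<^esub>"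
    "(?s ?B \<oplus>\<^bsub>K\<^esub> ?u ?B \<oplus>\<^bsub>K\<^esub> ?v ?B) \<otimes>\<^bsub>K\<^esub> ?u ?B = \<zero>\<^bsub>K\<^esub>" "(?s ?B \<oplus>\<^bsub>K\<^esub> ?u ?B \<oplus>\<^bsub>K\<^esub> ?v ?B) \<otimes>\<^bsub>K\<^esub> ?v ?B = \<zero>\<^bsub>K\<^esub>"
    by (intro key[OF _ HOL.refl]; simp add: almost_dihedral_def H.G.m_assoc)+
  then have zero: "?s F \<oplus>\<^bsub>K\<^esub> ?u F \<oplus>\<^bsub>K\<^esub> ?v F = \<zero>\<^bsub>K\<^esub> \<or> ?u F = \<zero>\<^bsub>K\<^esub> \<and> ?v F = \<zero>\<^bsub>K\<^esub>" if "F \<in> {?A, ?B}" for F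
    using that by (auto simp: K.integral_iff)

  \<comment> \<open>The derivation with coefficients \<alpha> and \<beta> vanishes at the images of
    a and b, hence at the images of all of H, hence on RG by linearity and surjectivity. Its values
    at x and y are \<alpha> and \<beta>.\<close>
  have nondeg: "?u ?A \<otimes>\<^bsub>K\<^esub> ?v ?B \<noteq> ?v ?A \<otimes>\<^bsub>K\<^esub> ?u ?B"
  proof (rule K.nondegenerate_pair)
    fix \<alpha> \<beta> assume lm: "\<alpha> \<in> carrier K" "\<beta> \<in> carrier K"
      and zero: "\<alpha> \<otimes>\<^bsub>K\<^esub> ?u ?A \<oplus>\<^bsub>K\<^esub> \<beta> \<otimes>\<^bsub>K\<^esub> ?v ?A = \<zero>\<^bsub>K\<^esub>" "\<alpha> \<otimes>\<^bsub>K\<^esub> ?u ?B \<oplus>\<^bsub>K\<^esub> \<beta> \<otimes>\<^bsub>K\<^esub> ?v ?B = \<zero>\<^bsub>K\<^esub>"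
    let ?\<delta> = "\<lambda>g. \<alpha> \<otimes>\<^bsub>K\<^esub> ?\<chi> g \<oplus>\<^bsub>K\<^esub> \<beta> \<otimes>\<^bsub>K\<^esub> ?\<chi>' g"
    let ?D = "G.lin K \<rho> ?\<delta>"
    have \<chi>_closed: "?\<chi> g \<in> carrier K" "?\<chi>' g \<in> carrier K" if "g \<in> carrier ?G" for g
      using that \<chi>_mem by auto
    have \<delta>: "?\<delta> \<in> carrier ?G \<rightarrow> carrier K" using lm \<chi>_closed by simp
    have \<delta>_mult: "?\<delta> (g \<otimes>\<^bsub>?G\<^esub> k) = ?\<delta> g \<oplus>\<^bsub>K\<^esub> ?\<delta> k" if "g \<in> carrier ?G" "k \<in> carrier ?G" for g k
      using hom_mult[OF \<chi>_hom(1) that] hom_mult[OF \<chi>_hom(2) that] that lm \<chi>_closed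
      by (simp add: K.r_distr K.a_ac)
    have D_mult: "?D (F \<otimes>\<^bsub>G.RG\<^esub> F') = ?D F \<otimes>\<^bsub>K\<^esub> ?s F' \<oplus>\<^bsub>K\<^esub> ?s F \<otimes>\<^bsub>K\<^esub> ?D F'"
      if "F \<in> carrier G.RG" "F' \<in> carrier G.RG" for F F'
      by (rule G.lin_derivation[OF K.cring_axioms \<rho> \<delta> \<delta>_mult that])
    have D: "?D F = \<alpha> \<otimes>\<^bsub>K\<^esub> ?u F \<oplus>\<^bsub>K\<^esub> \<beta> \<otimes>\<^bsub>K\<^esub> ?v F" if "F \<in> carrier G.RG" for F
      by (rule G.lin_comb[OF K.cring_axioms \<rho> \<chi>_mem(1,2) lm that])
    have D_closed: "?D F \<in> carrier K" if "F \<in> carrier G.RG" for F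
      using that by (rule G.lin_closed[OF K.ring_axioms \<rho> \<delta>])
    have s_hom: "?s \<in> ring_hom G.RG K" by (rule G.lin_one_mult[OF K.cring_axioms \<rho>])
    let ?hb = "\<lambda>g. h (H.basis g)"
    have hb_mult: "?hb (g \<otimes>\<^bsub>?H\<^esub> k) = ?hb g \<otimes>\<^bsub>G.RG\<^esub> ?hb k" if "g \<in> carrier ?H" "k \<in> carrier ?H" for g k
      using that by (simp add: ring_hom_mult[OF h] flip: H.basis_mult)
    have hb_one: "?hb \<one>\<^bsub>?H\<^esub> = \<one>\<^bsub>G.RG\<^esub>" by (simp add: H.basis_one ring_hom_one[OF h])
    have D_one: "?D \<one>\<^bsub>G.RG\<^esub> = \<zero>\<^bsub>K\<^esub>"
    proof -
      \<comment> \<open>The augmentation of 1 is 1, so the product rule gives twice the value at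
        1.\<close>
      have "?D \<one>\<^bsub>G.RG\<^esub> = ?D \<one>\<^bsub>G.RG\<^esub> \<oplus>\<^bsub>K\<^esub> ?D \<one>\<^bsub>G.RG\<^esub>"
        using D_mult[of "\<one>\<^bsub>G.RG\<^esub>" "\<one>\<^bsub>G.RG\<^esub>"] D_closed[of "\<one>\<^bsub>G.RG\<^esub>"] by (simp add: ring_hom_one[OF s_hom])
      then show ?thesis using D_closed[of "\<one>\<^bsub>G.RG\<^esub>"] K.char_two_double[OF K_two] by simp
    qed
    define S where "S = {g \<in> carrier ?H. ?D (?hb g) = \<zero>\<^bsub>K\<^esub>}"
    have "subgroup S ?H"
      unfolding S_def
    proof (rule H.G.subgroupI)
      have "\<one>\<^bsub>?H\<^esub> \<in> {g \<in> carrier ?H. ?D (?hb g) = \<zero>\<^bsub>K\<^esub>}" by (simp add: hb_one D_one)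
      then show "{g \<in> carrier ?H. ?D (?hb g) = \<zero>\<^bsub>K\<^esub>} \<noteq> {}" by blast
    next
      fix g assume "g \<in> {g \<in> carrier ?H. ?D (?hb g) = \<zero>\<^bsub>K\<^esub>}"
      then have g: "g \<in> carrier ?H" "?D (?hb g) = \<zero>\<^bsub>K\<^esub>" by auto
      let ?g' = "inv\<^bsub>?H\<^esub> g"
      have mem: "?hb g \<in> carrier G.RG" "?hb ?g' \<in> carrier G.RG" by (simp_all add: h_closed)
      \<comment> \<open>In the product rule for g and its inverse the term with the derivative of g
        drops out; the remaining factor \<open>?s (?hb g)\<close> is nonzero, being the augmentation
        of an invertible element.\<close>
      have "?s (?hb g) \<otimes>\<^bsub>K\<^esub> ?D (?hb ?g') = ?D (?hb g \<otimes>\<^bsub>G.RG\<^esub> ?hb ?g')"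
        using D_mult[OF mem] mem D_closed by (simp add: g)
      also have "\<dots> = \<zero>\<^bsub>K\<^esub>" using g by (simp add: hb_one D_one flip: hb_mult)
      finally have "?s (?hb g) = \<zero>\<^bsub>K\<^esub> \<or> ?D (?hb ?g') = \<zero>\<^bsub>K\<^esub>"
        using mem D_closed by (simp add: K.integral_iff)
      moreover have "?s (?hb g) \<otimes>\<^bsub>K\<^esub> ?s (?hb ?g') = \<one>\<^bsub>K\<^esub>"
        using mem g by (simp add: hb_one ring_hom_one[OF s_hom] flip: ring_hom_mult[OF s_hom] hb_mult)
      then have "?s (?hb g) \<noteq> \<zero>\<^bsub>K\<^esub>" using mem by auto
      ultimately show "?g' \<in> {g \<in> carrier ?H. ?D (?hb g) = \<zero>\<^bsub>K\<^esub>}" using g by simp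
    next
      fix g k assume "g \<in> {g \<in> carrier ?H. ?D (?hb g) = \<zero>\<^bsub>K\<^esub>}" "k \<in> {g \<in> carrier ?H. ?D (?hb g) = \<zero>\<^bsub>K\<^esub>}"
      then show "g \<otimes>\<^bsub>?H\<^esub> k \<in> {g \<in> carrier ?H. ?D (?hb g) = \<zero>\<^bsub>K\<^esub>}"
        by (simp add: hb_mult D_mult h_closed)
    qed auto
    then have "carrier ?H = S"
      by (rule H_subgroup) (use zero in \<open>simp_all add: D S_def\<close>)
    then have D_hb: "?D (?hb g) = \<zero>\<^bsub>K\<^esub>" if "g \<in> carrier ?H" for g
    proof -
      from that have "g \<in> S" unfolding \<open>carrier ?H = S\<close> .
      then show ?thesis by (simp add: S_def)
    qed
    have D_h: "?D (h f) = \<zero>\<^bsub>K\<^esub>" if "f \<in> carrier H.RG" for f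
      using that
    proof (induction f rule: H.elem_induct)
      case (single r g)
      then have "gsingle R ?H r g = r \<odot>\<^bsub>H.RG\<^esub> H.basis g" by (simp add: H.basis_def H.smult_gsingle)
      then show ?case using single
        by (simp add: h_smult h_closed G.lin_smult[OF K.ring_axioms \<rho> \<delta>] D_hb ring_hom_closed[OF \<rho>])
    next
      case (add f f')
      then show ?case
        by (simp add: ring_hom_add[OF h] h_closed G.lin_add[OF K.ring_axioms \<rho> \<delta>])
    qed
    have D_zero: "?D F = \<zero>\<^bsub>K\<^esub>" if "F \<in> carrier G.RG" for F
    proof -
      from that have "F \<in> h ` carrier H.RG" unfolding surj .
      then show ?thesis using D_h by blast
    qed
    have D_basis: "?D (G.basis g) = ?\<delta> g" if "g \<in> carrier ?G" for g
      using that \<delta> unfolding G.basis_def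
      by (simp add: G.lin_gsingle[OF K.ring_axioms \<rho> \<delta>] ring_hom_one[OF \<rho>] funcset_mem[OF \<delta>])
    have "?\<delta> ?x = \<zero>\<^bsub>K\<^esub>" "?\<delta> ?y = \<zero>\<^bsub>K\<^esub>"
      by (simp_all only: D_zero G.basis_mem G_gens_mem flip: D_basis)
    then show "\<alpha> = \<zero>\<^bsub>K\<^esub> \<and> \<beta> = \<zero>\<^bsub>K\<^esub>"
      using lm by (simp add: \<phi> parity_x_def parity_y_def)
  qed simp_all
  have v: "?v F = ?s F \<oplus>\<^bsub>K\<^esub> ?u F" if "F \<in> {?A, ?B}" for F
  proof -
    have F: "F \<in> carrier G.RG" using that by auto
    \<comment> \<open>A zero pair would make the determinant vanish, so the other alternative of
      \<open>zero\<close> holds.\<close>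
    have "\<not> (?u F = \<zero>\<^bsub>K\<^esub> \<and> ?v F = \<zero>\<^bsub>K\<^esub>)" using nondeg that by auto
    then have "?s F \<oplus>\<^bsub>K\<^esub> ?u F \<oplus>\<^bsub>K\<^esub> ?v F = \<zero>\<^bsub>K\<^esub>"
      using zero[OF that] by blast
    then have "?s F \<oplus>\<^bsub>K\<^esub> ?u F \<oplus>\<^bsub>K\<^esub> ?v F = ?v F \<oplus>\<^bsub>K\<^esub> ?v F"
      using F by (simp only: K.char_two_double[OF K_two] closed)
    then show ?thesis using F by simp
  qed
  \<comment> \<open>\<open>?s\<close> and \<open>?u\<close> agree at both elements and determine
    \<open>?v\<close>; two equal pairs have determinant zero.\<close>
  have "?v ?A = ?v ?B" by (simp only: v insert_iff AB_eq simp_thms)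
  then show False using nondeg AB_eq K.m_comm[of "?u ?B" "?v ?B"] by simp
qed

end

section \<open>From characteristic four to the residue field\<close>

lemma (in ideal) rcos_eq_zero_iff:
  assumes "a \<in> carrier R"
  shows "I +> a = \<zero>\<^bsub>R Quot I\<^esub> \<longleftrightarrow> a \<in> I"
proof
  assume "I +> a = \<zero>\<^bsub>R Quot I\<^esub>"
  then show "a \<in> I" using a_rcos_self[OF assms] by (simp add: FactRing_def)
next
  assume "a \<in> I"
  then show "I +> a = \<zero>\<^bsub>R Quot I\<^esub>" using a_rcos_zero[OF is_ideal] by (simp add: FactRing_def)
qed

theorem char_four_not_isomorphic:
  fixes R :: "('r, 'e) ring_scheme" (structure)
  assumes R: "cring R" and \<rr>: "ideal \<rr> R" and \<mm>: "maximalideal \<mm> R"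
    and sub: "\<mm> \<cdot> \<mm> \<subseteq> \<rr>" "\<rr> \<subseteq> \<mm>" and four: "ring_char (R Quot \<rr>) = 4"
    and nml: "n > m" "m > l" "l \<ge> 2"
  shows "\<not> algebra_isomorphic R (group_algebra R (group_G n m l)) (group_algebra R (group_H n m l))"
proof -
  interpret R: cring R by fact
  interpret \<rr>: ideal \<rr> R by fact
  interpret \<mm>: maximalideal \<mm> R by fact
  interpret prime: primeideal \<mm> R by (rule R.maximalideal_prime[OF \<mm>])
  interpret Q: ring "R Quot \<rr>" by (rule \<rr>.quotient_is_ring)
  interpret K: field "R Quot \<mm>" by (rule \<mm>.quotient_is_field[OF R])
  let ?q = "(+>) \<rr>" and ?\<rho> = "(+>) \<mm>"
  have q: "?q \<in> ring_hom R (R Quot \<rr>)" by (rule \<rr>.rcos_ring_hom)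
  have \<rho>: "?\<rho> \<in> ring_hom R (R Quot \<mm>)" by (rule \<mm>.rcos_ring_hom)
  have two: "\<one> \<oplus> \<one> \<notin> \<rr>"
  proof
    assume "\<one> \<oplus> \<one> \<in> \<rr>"
    then have "?q (\<one> \<oplus> \<one>) = \<zero>\<^bsub>R Quot \<rr>\<^esub>" by (simp add: \<rr>.rcos_eq_zero_iff)
    then have "add_pow (R Quot \<rr>) (2::nat) \<one>\<^bsub>R Quot \<rr>\<^esub> = \<zero>\<^bsub>R Quot \<rr>\<^esub>"
      by (simp add: ring_hom_add[OF q] ring_hom_one[OF q] numeral_2_eq_2)
    then show False by (simp add: Q.ring_char_dvd_iff four)
  qed
  \<comment> \<open>4 lies in \<rr> and hence in \<mm>; maximal ideals are prime, so 2 lies in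
    \<mm>.\<close>
  have "add_pow (R Quot \<rr>) (4::nat) \<one>\<^bsub>R Quot \<rr>\<^esub> = \<zero>\<^bsub>R Quot \<rr>\<^esub>"
    by (simp add: Q.ring_char_dvd_iff four)
  then have "?q ((\<one> \<oplus> \<one>) \<otimes> (\<one> \<oplus> \<one>)) = \<zero>\<^bsub>R Quot \<rr>\<^esub>"
    by (simp add: ring_hom_add[OF q] ring_hom_one[OF q] ring_hom_mult[OF q] numeral_eq_Suc
        Q.l_distr Q.a_assoc)
  then have "(\<one> \<oplus> \<one>) \<otimes> (\<one> \<oplus> \<one>) \<in> \<mm>"
    using sub(2) by (auto simp: \<rr>.rcos_eq_zero_iff)
  then have two_\<mm>: "\<one> \<oplus> \<one> \<in> \<mm>"
    using prime.I_prime[of "\<one> \<oplus> \<one>" "\<one> \<oplus> \<one>"] by simp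
  interpret dihedral_alg R "R Quot \<mm>" ?\<rho>
  proof (intro dihedral_alg.intro dihedral_alg_axioms.intro group_alg.intro R group_dihedral8 K.field_axioms \<rho>)
    have "?\<rho> (\<one> \<oplus> \<one>) = \<zero>\<^bsub>R Quot \<mm>\<^esub>" using two_\<mm> by (simp add: \<mm>.rcos_eq_zero_iff)
    then show "\<one>\<^bsub>R Quot \<mm>\<^esub> \<oplus>\<^bsub>R Quot \<mm>\<^esub> \<one>\<^bsub>R Quot \<mm>\<^esub> = \<zero>\<^bsub>R Quot \<mm>\<^esub>"
      by (simp add: ring_hom_add[OF \<rho>] ring_hom_one[OF \<rho>])
    fix r assume r: "r \<in> carrier R" and rr: "r \<oplus> r = \<zero>"
    show "?\<rho> r = \<zero>\<^bsub>R Quot \<mm>\<^esub>"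
    proof (rule ccontr)
      assume "?\<rho> r \<noteq> \<zero>\<^bsub>R Quot \<mm>\<^esub>"
      then have "?\<rho> r \<in> Units (R Quot \<mm>)"
        using ring_hom_closed[OF \<rho> r] by (simp add: K.field_Units)
      then obtain d' where "d' \<in> carrier (R Quot \<mm>)" and d': "?\<rho> r \<otimes>\<^bsub>R Quot \<mm>\<^esub> d' = \<one>\<^bsub>R Quot \<mm>\<^esub>"
        using K.Units_r_inv_ex by blast
      then obtain d where d: "d \<in> carrier R" "d' = ?\<rho> d"
        unfolding FactRing_def A_RCOSETS_def' by auto
      \<comment> \<open>\<open>e\<close> lies in \<mm> because d inverts r modulo \<mm>. As 2 is in
        \<mm> too, 2 e lies in \<mm>^2 and so in \<rr>; but 2 r = 0 gives 2 e = -2, while 2 is not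
        in \<rr>.\<close>
      define e where "e = r \<otimes> d \<oplus> \<ominus> \<one>"
      have e [simp]: "e \<in> carrier R" using r d by (simp add: e_def)
      have "r \<otimes> d = e \<oplus> \<one>" using r d by (simp add: e_def R.a_assoc R.l_neg)
      then have "?\<rho> e \<oplus>\<^bsub>R Quot \<mm>\<^esub> \<one>\<^bsub>R Quot \<mm>\<^esub> = \<zero>\<^bsub>R Quot \<mm>\<^esub> \<oplus>\<^bsub>R Quot \<mm>\<^esub> \<one>\<^bsub>R Quot \<mm>\<^esub>"
        using d' r d ring_hom_closed[OF \<rho>]
        by (simp flip: ring_hom_mult[OF \<rho>] add: ring_hom_add[OF \<rho>] ring_hom_one[OF \<rho>])
      then have "?\<rho> e = \<zero>\<^bsub>R Quot \<mm>\<^esub>" using ring_hom_closed[OF \<rho> e] by simp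
      then have "e \<in> \<mm>" by (simp add: \<mm>.rcos_eq_zero_iff)
      then have "(\<one> \<oplus> \<one>) \<otimes> e \<in> \<rr>" using two_\<mm> sub(1) ideal_prod.prod[of "\<one> \<oplus> \<one>" \<mm> e \<mm> R] by blast
      also have "(\<one> \<oplus> \<one>) \<otimes> e = (r \<oplus> r) \<otimes> d \<oplus> \<ominus> (\<one> \<oplus> \<one>)"
        using r d by (simp add: e_def R.l_distr R.r_distr R.minus_add R.a_ac)
      finally have "\<ominus> (\<one> \<oplus> \<one>) \<in> \<rr>" using d by (simp add: rr)
      then have "\<ominus> (\<ominus> (\<one> \<oplus> \<one>)) \<in> \<rr>" by (rule \<rr>.a_inv_closed)
      then show False using two by simp
    qed
  qed
  show ?thesis using nml by (rule not_isomorphic)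
qed

theorem theorem1:
  fixes R :: "('r, 'e) ring_scheme" (structure)
    and \<rr> :: "'r set"
    and n m l :: nat
  assumes "cring R" and "ideal \<rr> R"
    and "n > m" and "m > l" and "l \<ge> 2"
  shows "((\<exists>\<mm>. maximalideal \<mm> R \<and> \<mm> \<cdot> \<mm> \<subseteq> \<rr> \<and> \<rr> \<subseteq> \<mm>) \<and> ring_char (R Quot \<rr>) = 4
            \<longrightarrow> \<not> algebra_isomorphic R (group_algebra R (group_G n m l)) (group_algebra R (group_H n m l)))
       \<and> (ring_char R = 2
            \<longrightarrow> algebra_isomorphic R (group_algebra R (group_G n m l)) (group_algebra R (group_H n m l)))"
  using char_four_not_isomorphic[OF assms(1,2) _ _ _ _ assms(3-5)]
    char_two_isomorphic[OF assms(1,3,4)] by blast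

end
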